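(* There is a universal constant $C>0$ such that for every $n\ge 1$ and every centrally symmetric convex body $K\subset\mathbb{R}^n$ in isotropic position with $\mathrm{Vol}(K)=\mathrm{Vol}(D_n)$, $$L_K \le C\,\inf\left\{ \frac{\sqrt{p_0}}{M_p(L)} \;:\; K\subset L,\ L\in SL_p^n,\ p\ge 0\right\},$$ where $p_0=\max(1,\min(p,n))$.
   Context: $D_n$ is the Euclidean unit ball of $\mathbb{R}^n$, $\mathrm{Vol}$ is Lebesgue measure, $\sigma$ is the rotation-invariant (Haar) probability measure on $S^{n-1}$. A convex body is a compact convex set with non-empty interior; it is centrally symmetric if $K=-K$. Isotropic position and isotropic constant: a centrally symmetric convex body $K\subset\mathbb{R}^n$ is in isotropic position if $\int_K\langle x,\theta\rangle^2dx$ is the same for all $\theta\in S^{n-1}$. Every such body has an invertible linear image of volume 1 in isotropic position, unique up to rotation; $L_K$ is the number with $\int_{K'}\langle x,\theta\rangle^2dx=L_K^2$ for all $\theta\in S^{n-1}$, where $K'$ is such an image of $K$. Star-bodies: a (centrally symmetric) star-body $L\subset\mathbb{R}^n$ is a compact set with $L=-L$, $tL\subset L$ for $t\in[0,1]$, whose radial function $\rho_L(\theta)=\max\{r\ge 0: r\theta\in L\}$ is continuous (and positive) on $S^{n-1}$. Its Minkowski functional is $\|x\|_L=\min\{t\geq 0: x\in tL\}$, so $\|\theta\|_L=1/\rho_L(\theta)$ for $\theta\in S^{n-1}$. For $p>0$, $SL_p^n$ is the class of unit balls of $n$-dimensional subspaces of $L_p=L_p([0,1],dx)$, i.e. star-bodies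 $L\subset\mathbb{R}^n$ for which there is a linear map $J:\mathbb{R}^n\to L_p$ with $\|x\|_L=\|Jx\|_{L_p}$ for all $x$ (equivalently, $\|x\|_L^p=\int_{S^{n-1}}|\langle x,\theta\rangle|^p\,d\mu_L(\theta)$ for some finite non-negative Borel measure $\mu_L$ on $S^{n-1}$ when $p<\infty$). $SL_0^n$ is the class of star-bodies $L$ for which $\|x\|_L=\exp\left(\int_{S^{n-1}}\log|\langle x,\theta\rangle|\,d\mu_L(\theta)+c\right)$ for all $x\in\mathbb{R}^n$, for some Borel probability measure $\mu_L$ on $S^{n-1}$ and some constant $c\in\mathbb{R}$. For $p>0$, $M_p(L)=\left(\int_{S^{n-1}}\|x\|_L^p\,d\sigma(x)\right)^{1/p}$, and $M_0(L)=\exp\left(\int_{S^{n-1}}\log\|x\|_L\,d\sigma(x)\right)$. *)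

theory Defs
  imports "HOL-Probability.Probability"
begin

text \<open>
  The constant of the theorem must not depend on the dimension, so the dimension is a natural
  number rather than a type: a vector of \<open>\<real>\<^sup>n\<close> is a function in
  \<open>{..<n} \<rightarrow>\<^sub>E UNIV\<close>, which is both the space of the product measure \<open>lebn n\<close>
  and the carrier of the product topology \<open>topn n\<close>.
\<close>

definition Rn :: "nat \<Rightarrow> (nat \<Rightarrow> real) set" where
  "Rn n = ({..<n} \<rightarrow>\<^sub>E UNIV)"

definition topn :: "nat \<Rightarrow> (nat \<Rightarrow> real) topology" where
  "topn n = product_topology (\<lambda>_. euclideanreal) {..<n}"

definition lebn :: "nat \<Rightarrow> (nat \<Rightarrow> real) measure" where
  "lebn n = PiM {..<n} (\<lambda>_. lborel)"

lemma topspace_topn: "topspace (topn n) = Rn n"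
  by (simp add: topn_def Rn_def)

lemma space_lebn: "space (lebn n) = Rn n"
  by (simp add: lebn_def Rn_def space_PiM)

definition vol :: "nat \<Rightarrow> (nat \<Rightarrow> real) set \<Rightarrow> real" where
  "vol n A = measure (lebn n) A"

definition vzero :: "nat \<Rightarrow> nat \<Rightarrow> real" where
  "vzero n = (\<lambda>i\<in>{..<n}. 0)"

definition vadd :: "nat \<Rightarrow> (nat \<Rightarrow> real) \<Rightarrow> (nat \<Rightarrow> real) \<Rightarrow> nat \<Rightarrow> real" where
  "vadd n x y = (\<lambda>i\<in>{..<n}. x i + y i)"

definition vscale :: "nat \<Rightarrow> real \<Rightarrow> (nat \<Rightarrow> real) \<Rightarrow> nat \<Rightarrow> real" where
  "vscale n a x = (\<lambda>i\<in>{..<n}. a * x i)"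

definition dot :: "nat \<Rightarrow> (nat \<Rightarrow> real) \<Rightarrow> (nat \<Rightarrow> real) \<Rightarrow> real" where
  "dot n x y = (\<Sum>i<n. x i * y i)"

definition unit_ball :: "nat \<Rightarrow> (nat \<Rightarrow> real) set" where
  "unit_ball n = {x \<in> Rn n. L2_set x {..<n} \<le> 1}"

definition unit_sphere :: "nat \<Rightarrow> (nat \<Rightarrow> real) set" where
  "unit_sphere n = {x \<in> Rn n. L2_set x {..<n} = 1}"

definition linear_n :: "nat \<Rightarrow> ((nat \<Rightarrow> real) \<Rightarrow> nat \<Rightarrow> real) \<Rightarrow> bool" where
  "linear_n n T \<longleftrightarrow> T \<in> Rn n \<rightarrow> Rn n \<and>
     (\<forall>x\<in>Rn n. \<forall>y\<in>Rn n. T (vadd n x y) = vadd n (T x) (T y)) \<and>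
     (\<forall>a. \<forall>x\<in>Rn n. T (vscale n a x) = vscale n a (T x))"

definition orthogonal_n :: "nat \<Rightarrow> ((nat \<Rightarrow> real) \<Rightarrow> nat \<Rightarrow> real) \<Rightarrow> bool" where
  "orthogonal_n n U \<longleftrightarrow> linear_n n U \<and>
     (\<forall>x\<in>Rn n. L2_set (U x) {..<n} = L2_set x {..<n})"

definition sphere_borel :: "nat \<Rightarrow> (nat \<Rightarrow> real) measure" where
  "sphere_borel n = restrict_space (lebn n) (unit_sphere n)"

text \<open>
  Invariance is required under the full orthogonal group; for \<open>n \<ge> 2\<close> this is the same as
  invariance under proper rotations, and for \<open>n = 1\<close> it forces the uniform measure on two points.
\<close>

definition haar_sphere :: "nat \<Rightarrow> (nat \<Rightarrow> real) measure \<Rightarrow> bool" where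
  "haar_sphere n \<sigma> \<longleftrightarrow> prob_space \<sigma> \<and> sets \<sigma> = sets (sphere_borel n) \<and>
     (\<forall>U. orthogonal_n n U \<longrightarrow> distr \<sigma> \<sigma> U = \<sigma>)"

definition symmetric_n :: "nat \<Rightarrow> (nat \<Rightarrow> real) set \<Rightarrow> bool" where
  "symmetric_n n K \<longleftrightarrow> vscale n (-1) ` K = K"

definition convex_n :: "nat \<Rightarrow> (nat \<Rightarrow> real) set \<Rightarrow> bool" where
  "convex_n n K \<longleftrightarrow>
     (\<forall>x\<in>K. \<forall>y\<in>K. \<forall>t\<in>{0..1}. vadd n (vscale n (1 - t) x) (vscale n t y) \<in> K)"

definition sym_convex_body :: "nat \<Rightarrow> (nat \<Rightarrow> real) set \<Rightarrow> bool" where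
  "sym_convex_body n K \<longleftrightarrow> compactin (topn n) K \<and> convex_n n K \<and>
     topn n interior_of K \<noteq> {} \<and> symmetric_n n K"

definition second_moment :: "nat \<Rightarrow> (nat \<Rightarrow> real) set \<Rightarrow> (nat \<Rightarrow> real) \<Rightarrow> real" where
  "second_moment n K \<theta> = (LINT x:K|lebn n. (dot n x \<theta>)\<^sup>2)"

definition isotropic_position :: "nat \<Rightarrow> (nat \<Rightarrow> real) set \<Rightarrow> bool" where
  "isotropic_position n K \<longleftrightarrow>
     (\<forall>\<theta>\<in>unit_sphere n. \<forall>\<phi>\<in>unit_sphere n. second_moment n K \<theta> = second_moment n K \<phi>)"

definition isotropic_const :: "nat \<Rightarrow> (nat \<Rightarrow> real) set \<Rightarrow> real" where
  "isotropic_const n K = (THE l. 0 \<le> l \<and>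
     (\<exists>T. linear_n n T \<and> bij_betw T (Rn n) (Rn n) \<and> vol n (T ` K) = 1 \<and>
          isotropic_position n (T ` K) \<and>
          (\<forall>\<theta>\<in>unit_sphere n. second_moment n (T ` K) \<theta> = l\<^sup>2)))"

text \<open>
  For a star-body the supremum and the infimum below are attained (compactness), so they are the
  maximum and the minimum of the usual definitions.
\<close>

definition radial :: "nat \<Rightarrow> (nat \<Rightarrow> real) set \<Rightarrow> (nat \<Rightarrow> real) \<Rightarrow> real" where
  "radial n L \<theta> = Sup {r. 0 \<le> r \<and> vscale n r \<theta> \<in> L}"

definition minkowski :: "nat \<Rightarrow> (nat \<Rightarrow> real) set \<Rightarrow> (nat \<Rightarrow> real) \<Rightarrow> real" where
  "minkowski n L x = Inf {t. 0 \<le> t \<and> x \<in> vscale n t ` L}"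

text \<open>
  Nonemptiness is explicit because the supremum of the empty set of reals is an unspecified value.
\<close>

definition star_body :: "nat \<Rightarrow> (nat \<Rightarrow> real) set \<Rightarrow> bool" where
  "star_body n L \<longleftrightarrow> compactin (topn n) L \<and> L \<noteq> {} \<and> symmetric_n n L \<and>
     (\<forall>t\<in>{0..1}. vscale n t ` L \<subseteq> L) \<and>
     continuous_map (subtopology (topn n) (unit_sphere n)) euclideanreal (radial n L) \<and>
     (\<forall>\<theta>\<in>unit_sphere n. 0 < radial n L \<theta>)"

definition in_Lp :: "real \<Rightarrow> (real \<Rightarrow> real) \<Rightarrow> bool" where
  "in_Lp p f \<longleftrightarrow> f \<in> borel_measurable (lebesgue_on {0..1}) \<and>
     integrable (lebesgue_on {0..1}) (\<lambda>t. \<bar>f t\<bar> powr p)"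

definition Lp_norm :: "real \<Rightarrow> (real \<Rightarrow> real) \<Rightarrow> real" where
  "Lp_norm p f = (LINT t|lebesgue_on {0..1}. \<bar>f t\<bar> powr p) powr (1 / p)"

text \<open>
  A linear map into \<open>L\<^sub>p([0,1])\<close> is given by representatives, so linearity holds almost everywhere.
\<close>

definition linear_to_Lp :: "nat \<Rightarrow> real \<Rightarrow> ((nat \<Rightarrow> real) \<Rightarrow> real \<Rightarrow> real) \<Rightarrow> bool" where
  "linear_to_Lp n p J \<longleftrightarrow> (\<forall>x\<in>Rn n. in_Lp p (J x)) \<and>
     (\<forall>x\<in>Rn n. \<forall>y\<in>Rn n. AE t in lebesgue_on {0..1}. J (vadd n x y) t = J x t + J y t) \<and>
     (\<forall>a. \<forall>x\<in>Rn n. AE t in lebesgue_on {0..1}. J (vscale n a x) t = a * J x t)"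

definition SL_pos :: "nat \<Rightarrow> real \<Rightarrow> (nat \<Rightarrow> real) set set" where
  "SL_pos n p = {L. star_body n L \<and>
     (\<exists>J. linear_to_Lp n p J \<and> (\<forall>x\<in>Rn n. minkowski n L x = Lp_norm p (J x)))}"

text \<open>
  In \<open>\<parallel>x\<parallel> = exp (\<integral> log \<bar>\<langle>x,\<theta>\<rangle>\<bar> d\<mu>(\<theta>) + c)\<close> the logarithm of \<open>0\<close> is \<open>-\<infinity>\<close>. For \<open>x \<noteq> 0\<close> the
  left side is positive, so the integral is finite: \<open>\<langle>x,\<theta>\<rangle> \<noteq> 0\<close> almost everywhere and the
  logarithm is integrable. Both are stated, since \<open>ln 0 = 0\<close> and the Bochner integral of a
  non-integrable function is \<open>0\<close>. At \<open>x = 0\<close> the identity reads \<open>0 = exp (-\<infinity>)\<close> and is no condition.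
\<close>

definition SL_zero :: "nat \<Rightarrow> (nat \<Rightarrow> real) set set" where
  "SL_zero n = {L. star_body n L \<and>
     (\<exists>\<mu> c. prob_space \<mu> \<and> sets \<mu> = sets (sphere_borel n) \<and>
        (\<forall>x\<in>Rn n - {vzero n}.
           (AE \<theta> in \<mu>. dot n x \<theta> \<noteq> 0) \<and>
           integrable \<mu> (\<lambda>\<theta>. ln \<bar>dot n x \<theta>\<bar>) \<and>
           minkowski n L x = exp ((LINT \<theta>|\<mu>. ln \<bar>dot n x \<theta>\<bar>) + c)))}"

definition SL :: "nat \<Rightarrow> real \<Rightarrow> (nat \<Rightarrow> real) set set" where
  "SL n p = (if p = 0 then SL_zero n else SL_pos n p)"

definition M_mean :: "nat \<Rightarrow> (nat \<Rightarrow> real) measure \<Rightarrow> real \<Rightarrow> (nat \<Rightarrow> real) set \<Rightarrow> real" where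
  "M_mean n \<sigma> p L =
     (if p = 0 then exp (LINT x|\<sigma>. ln (minkowski n L x))
      else (LINT x|\<sigma>. minkowski n L x powr p) powr (1 / p))"

end

theory Submission
  imports Defs
begin

text \<open>
  Let \<open>s\<^sup>2\<close> be the mean of \<open>\<langle>x,\<theta>\<rangle>\<^sup>2\<close> over \<open>K\<close>. Comparing second moments of linear images gives
  \<open>L\<^sub>K = s Vol(D\<^sub>n)\<^bsup>-1/n\<^esup> \<le> s \<surd>n / 2\<close>, so it suffices to bound \<open>s \<surd>n M\<^sub>p(L)\<close>.

  Averaging \<open>\<parallel>x\<parallel>\<^sub>L\<^sup>p = \<integral> \<bar>\<langle>x,w\<rangle>\<bar>\<^sup>p\<close> over \<open>K \<subseteq> L\<close> gives at most \<open>1\<close>, and over the sphere gives \<open>M\<^sub>p(L)\<^sup>p\<close>; the two are compared one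
  linear functional at a time. On \<open>K\<close>, the Prekopa-Leindler inequality makes the tails of
  \<open>\<langle>x,w\<rangle>\<close> log-concave; hence these tails decay geometrically, \<open>\<bar>\<langle>x,w\<rangle>\<bar> < t\<close> has probability at most
  \<open>\<surd>2 t / (s \<bar>w\<bar>)\<close>, the mean of \<open>log (\<bar>\<langle>x,w\<rangle>\<bar> / (s \<bar>w\<bar>))\<close> is at least \<open>-2\<close>, and the \<open>p\<close>-th moment is at least
  \<open>(e\<^bsup>-2\<^esup> s \<bar>w\<bar>)\<^sup>p\<close> for every \<open>p > 0\<close>. On the sphere, rotation invariance allows averaging over the
  directions \<open>e / \<surd>n\<close> with random signs \<open>e\<close>, and the sub-Gaussian bound for sign sums gives \<open>(2 \<bar>w\<bar> \<surd>(p\<^sub>0/n))\<^sup>p\<close>.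
\<close>

section \<open>Prekopa-Leindler inequality\<close>

text \<open>The bound is claimed for all p >= 0 at once, so the comparison on \<open>K\<close> must
  not degenerate as p tends to 0; this is why it starts from the logarithm, whose bound 2 is the
  source of e^2. With D = e^-2 s on \<open>K\<close> and B = 2 sqrt(p_0/n) on the sphere, s sqrt n
  M_p(L) <= 2 e^2 sqrt(p_0); the factor 1/2 in the bound for L_K, due to a cube inscribed in D_n,
  leaves C = e^2. The cap p_0 <= n reflects |<x,theta>| <= 1 on the sphere. For p = 0 Jensen's
  inequality for the logarithm replaces the spherical moment bound. Volumes of linear images are
  handled without determinants: a translation-invariant measure is unique up to a factor, so T
  multiplies all volumes by one constant, which a reference body identifies. As Vol(K) = Vol(D_n),
  the ball D_n can be that body. The definite description in \<open>isotropic_const\<close> demands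
  uniqueness over all admissible T; each such T turns out to be a similarity. The infimum is
  meaningful only over a nonempty set, so a Euclidean ball containing \<open>K\<close> is exhibited
  in SL_2.\<close>

lemma emeasure_initial_segment_approx:
  fixes A :: "real set"
  assumes A[measurable]: "A \<in> sets borel" and c: "c < emeasure lborel A"
  shows "\<exists>a\<in>A. c < emeasure lborel (A \<inter> {..a})"
proof -
  have ne: "A \<noteq> {}" using c by auto
  \<comment> \<open>The cut must be a point of \<open>A\<close> itself, because later only midpoints
    with points of \<open>A\<close> are known to lie in \<open>C\<close>. A sequence
    \<open>q\<close> that is cofinal in \<open>A\<close> and stays below points of \<open>A\<close>
    exhausts \<open>A\<close> by initial segments; the three cases below supply it: the maximum,
    points just below the supremum, or the natural numbers.\<close>
  have main: "\<exists>a\<in>A. c < emeasure lborel (A \<inter> {..a})"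
    if q: "incseq q" "\<And>x. x \<in> A \<Longrightarrow> \<exists>k::nat. x \<le> q k" "\<And>k. \<exists>a\<in>A. q k \<le> a" for q :: "nat \<Rightarrow> real"
  proof -
    have inc: "incseq (\<lambda>k. A \<inter> {..q k})" using q(1) by (fastforce simp: incseq_def)
    have "(SUP k. emeasure lborel (A \<inter> {..q k})) = emeasure lborel (\<Union>k. A \<inter> {..q k})"
      by (rule SUP_emeasure_incseq) (use inc in auto)
    also have "(\<Union>k. A \<inter> {..q k}) = A" using q(2) by auto
    finally have "c < (SUP k. emeasure lborel (A \<inter> {..q k}))" using c by simp
    then obtain k where k: "c < emeasure lborel (A \<inter> {..q k})"
      by (auto simp: less_SUP_iff)
    obtain a where a: "a \<in> A" "q k \<le> a" using q(3) by blast
    have "emeasure lborel (A \<inter> {..q k}) \<le> emeasure lborel (A \<inter> {..a})"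
      by (rule emeasure_mono) (use a in auto)
    with k a show ?thesis by (auto intro: less_le_trans)
  qed
  show ?thesis
  proof (cases "\<exists>m\<in>A. \<forall>x\<in>A. x \<le> m")
    case True
    then obtain m where m: "m \<in> A" "\<forall>x\<in>A. x \<le> m" by blast
    show ?thesis by (rule main[of "\<lambda>_. m"]) (use m in \<open>auto simp: incseq_def\<close>)
  next
    case no_max: False
    show ?thesis
    proof (cases "bdd_above A")
      case True
      show ?thesis
      proof (rule main[of "\<lambda>k. Sup A - 1 / real (Suc k)"])
        show "incseq (\<lambda>k. Sup A - 1 / real (Suc k))"
          by (auto simp: incseq_def field_simps)
        show "\<exists>k. x \<le> Sup A - 1 / real (Suc k)" if x: "x \<in> A" for x
        proof -
          obtain y where "y \<in> A" "x < y" using no_max x by force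
          then have "x < Sup A" using cSup_upper[OF _ True] by (force intro: less_le_trans)
          then obtain k where "inverse (real (Suc k)) < Sup A - x"
            using reals_Archimedean[of "Sup A - x"] by auto
          then show ?thesis by (intro exI[of _ k]) (simp add: inverse_eq_divide)
        qed
        show "\<exists>a\<in>A. Sup A - 1 / real (Suc k) \<le> a" for k
        proof -
          have "Sup A - 1 / real (Suc k) < Sup A" by simp
          then obtain a where "a \<in> A" "Sup A - 1 / real (Suc k) < a"
            using less_cSup_iff[OF ne True] by blast
          then show ?thesis by (auto intro: less_imp_le)
        qed
      qed
    next
      case False
      show ?thesis
      proof (rule main[of real])
        show "\<exists>k. x \<le> real k" for x by (rule real_arch_simple)
        show "\<exists>a\<in>A. real k \<le> a" for k using False by (auto simp: bdd_above_def) (meson linear)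
      qed (auto simp: incseq_def)
    qed
  qed
qed

text \<open>With one summand \<open>b\<close> fixed, forming midpoints is an affine map that halves
  lengths.\<close>

lemma emeasure_half_image_le:
  fixes A C :: "real set"
  assumes [measurable]: "A \<in> sets borel" "C \<in> sets borel" and AC: "\<And>x. x \<in> A \<Longrightarrow> (x + b) / 2 \<in> C"
  shows "emeasure lborel A \<le> 2 * emeasure lborel C"
proof -
  have "emeasure lborel A = (\<integral>\<^sup>+x. indicator A x \<partial>lborel)" by simp
  also have "\<dots> \<le> (\<integral>\<^sup>+x. indicator C (b / 2 + (1/2) * x) \<partial>lborel)"
    using AC by (intro nn_integral_mono) (auto simp: indicator_def add_divide_distrib add.commute)
  also have "\<dots> = 2 * (ennreal (1/2) * (\<integral>\<^sup>+x. indicator C (b / 2 + (1/2) * x) \<partial>lborel))"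
  proof -
    have "ennreal 2 * ennreal (1/2) = 1" by (subst ennreal_mult[symmetric]) auto
    then show ?thesis by (simp only: mult.assoc[symmetric] ennreal_numeral) simp
  qed
  also have "ennreal (1/2) * (\<integral>\<^sup>+x. indicator C (b / 2 + (1/2) * x) \<partial>lborel) = (\<integral>\<^sup>+x. indicator C x \<partial>lborel)"
    by (subst nn_integral_real_affine[of "indicator C" "1/2" "b/2"]) auto
  finally show ?thesis by simp
qed

text \<open>Pushing an initial piece of \<open>A\<close> along a point of \<open>B\<close> and a final piece of \<open>B\<close> along a point
  of \<open>A\<close> gives two pieces of \<open>C\<close> on different sides of a point.\<close>

lemma brunn_minkowski_line:
  fixes A B C :: "real set"
  assumes [measurable]: "A \<in> sets borel" "B \<in> sets borel" "C \<in> sets borel"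
    and ne: "A \<noteq> {}" "B \<noteq> {}"
    and ABC: "\<And>x y. x \<in> A \<Longrightarrow> y \<in> B \<Longrightarrow> (x + y) / 2 \<in> C"
  shows "emeasure lborel A + emeasure lborel B \<le> 2 * emeasure lborel C"
proof -
  have piece: "emeasure lborel (A \<inter> {..a}) + emeasure lborel (B \<inter> {b..}) \<le> 2 * emeasure lborel C"
    if ab: "a \<in> A" "b \<in> B" for a b
  proof -
    define m where "m = (a + b) / 2"
    have "emeasure lborel (A \<inter> {..a}) \<le> 2 * emeasure lborel (C \<inter> {..m})"
      by (rule emeasure_half_image_le[where b = b]) (use ab ABC in \<open>auto simp: m_def\<close>)
    moreover have "emeasure lborel (B \<inter> {b..}) \<le> 2 * emeasure lborel (C \<inter> {m..})"
      by (rule emeasure_half_image_le[where b = a]) (use ab ABC in \<open>auto simp: m_def add.commute[of _ a]\<close>)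
    \<comment> \<open>The two pieces of \<open>C\<close> share only the null set \<open>{m}\<close>,
      so their measures add up.\<close>
    moreover have "emeasure lborel (C \<inter> {m..}) \<le> emeasure lborel (C \<inter> {m<..})"
    proof -
      have "emeasure lborel (C \<inter> {m..}) \<le> emeasure lborel ((C \<inter> {m<..}) \<union> {m})"
        by (rule emeasure_mono) auto
      also have "\<dots> \<le> emeasure lborel (C \<inter> {m<..}) + emeasure lborel {m}"
        by (rule emeasure_subadditive) auto
      finally show ?thesis by simp
    qed
    moreover have "emeasure lborel (C \<inter> {..m}) + emeasure lborel (C \<inter> {m<..}) = emeasure lborel C"
      by (subst plus_emeasure) (auto intro!: arg_cong[where f = "emeasure lborel"])
    ultimately show ?thesis
      by (smt (verit) add_mono distrib_left mult_left_mono order_trans zero_le)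
  qed
  have neg: "emeasure lborel (uminus ` X) = emeasure lborel X" if [measurable]: "X \<in> sets borel" for X :: "real set"
  proof -
    have "emeasure lborel X = emeasure (distr lborel borel uminus) X" by (simp add: lborel_distr_uminus)
    also have "\<dots> = emeasure lborel (uminus -` X)" by (subst emeasure_distr) auto
    also have "uminus -` X = uminus ` X" by force
    finally show ?thesis by simp
  qed
  have neg_sets[measurable]: "uminus ` X \<in> sets borel" if [measurable]: "X \<in> sets borel" for X :: "real set"
  proof -
    have "uminus ` X = uminus -` X \<inter> space borel" by force
    also have "\<dots> \<in> sets borel" by measurable
    finally show ?thesis .
  qed
  show ?thesis
  \<comment> \<open>Measures may be infinite, so the general case approximates both from strictly
    below, which requires them to be nonzero.\<close>
  proof (cases "emeasure lborel A = 0 \<or> emeasure lborel B = 0")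
    case True
    obtain a b where ab: "a \<in> A" "b \<in> B" using ne by auto
    have "emeasure lborel A \<le> 2 * emeasure lborel C"
      by (rule emeasure_half_image_le[where b = b]) (use ab ABC in auto)
    moreover have "emeasure lborel B \<le> 2 * emeasure lborel C"
      by (rule emeasure_half_image_le[where b = a]) (use ab ABC in \<open>auto simp: add.commute[of _ a]\<close>)
    ultimately show ?thesis using True by auto
  next
    case False
    show ?thesis
    proof (rule ccontr)
      assume "\<not> ?thesis"
      then have lt: "2 * emeasure lborel C < emeasure lborel A + emeasure lborel B" by simp
      have ne': "{..<emeasure lborel X} \<noteq> {}" if "emeasure lborel X \<noteq> 0" for X :: "real set"
        using that by (metis empty_iff lessThan_iff zero_less_iff_neq_zero)
      have "\<exists>u v. u < emeasure lborel A \<and> v < emeasure lborel B \<and> 2 * emeasure lborel C < u + v"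
      proof -
        have "emeasure lborel A + emeasure lborel B = (SUP u\<in>{..<emeasure lborel A}. u) + emeasure lborel B"
          by (simp add: Sup_lessThan)
        also have "\<dots> = (SUP u\<in>{..<emeasure lborel A}. u + emeasure lborel B)"
          using False by (subst ennreal_SUP_add_left) (auto simp: ne')
        finally obtain u where u: "u < emeasure lborel A" "2 * emeasure lborel C < u + emeasure lborel B"
          using lt by (auto simp: less_SUP_iff)
        have "u + emeasure lborel B = u + (SUP v\<in>{..<emeasure lborel B}. v)"
          by (simp add: Sup_lessThan)
        also have "\<dots> = (SUP v\<in>{..<emeasure lborel B}. u + v)"
          using False by (subst ennreal_SUP_add_right) (auto simp: ne')
        finally show ?thesis using u by (auto simp: less_SUP_iff)
      qed
      then obtain u v where uv: "u < emeasure lborel A" "v < emeasure lborel B" "2 * emeasure lborel C < u + v"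
        by blast
      obtain a where a: "a \<in> A" "u < emeasure lborel (A \<inter> {..a})"
        using emeasure_initial_segment_approx[of A u] uv by auto
      \<comment> \<open>A final segment of \<open>B\<close> is the reflection of an initial segment
        of -B.\<close>
      obtain b' where b': "b' \<in> uminus ` B" "v < emeasure lborel (uminus ` B \<inter> {..b'})"
        using emeasure_initial_segment_approx[of "uminus ` B" v] uv by (auto simp: neg)
      define b where "b = - b'"
      have "uminus ` B \<inter> {..b'} = uminus ` (B \<inter> {b..})" by (auto simp: b_def image_iff)
      then have "v < emeasure lborel (B \<inter> {b..})" "b \<in> B" using b' by (auto simp: neg b_def)
      then have "u + v < 2 * emeasure lborel C"
        using piece[OF a(1), of b] a(2) by (meson add_strict_mono less_le_trans)
      with uv(3) show False by simp
    qed
  qed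
qed

lemma nn_integral_level_indicator:
  fixes u :: ennreal
  shows "(\<integral>\<^sup>+c. indicator {0<..<1} c * indicator {c. ennreal c < u} c \<partial>lborel) = min 1 u"
proof (cases u)
  case (real r)
  have "(\<integral>\<^sup>+c. indicator {0<..<1} c * indicator {c. ennreal c < u} c \<partial>lborel) =
     (\<integral>\<^sup>+c. indicator {0<..<min 1 r} c \<partial>lborel)"
    using real by (intro nn_integral_cong) (auto simp: indicator_def ennreal_less_iff)
  also have "\<dots> = ennreal (min 1 r)" using real by simp
  finally show ?thesis using real by (simp add: min_def flip: ennreal_1)
next
  case top
  have "(\<integral>\<^sup>+c. indicator {0<..<1} c * indicator {c. ennreal c < u} c \<partial>lborel) =
     (\<integral>\<^sup>+c. indicator {0<..<1::real} c \<partial>lborel)"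
    using top by (intro nn_integral_cong) (auto simp: indicator_def)
  then show ?thesis using top by simp
qed

text \<open>Layer cake formula cut off at height 1: for functions with supremum 1 every superlevel
  set below that height is nonempty, which \<open>brunn_minkowski_line\<close> requires.\<close>

lemma nn_integral_level_sets:
  fixes f :: "real \<Rightarrow> ennreal"
  assumes [measurable]: "f \<in> borel_measurable borel"
  shows "(\<integral>\<^sup>+x. min 1 (f x) \<partial>lborel) =
     (\<integral>\<^sup>+c. indicator {0<..<1} c * emeasure lborel {x. ennreal c < f x} \<partial>lborel)"
proof -
  have "(\<integral>\<^sup>+x. min 1 (f x) \<partial>lborel) =
     (\<integral>\<^sup>+x. (\<integral>\<^sup>+c. indicator {0<..<1} c * indicator {c. ennreal c < f x} c \<partial>lborel) \<partial>lborel)"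
    by (simp add: nn_integral_level_indicator)
  also have "\<dots> = (\<integral>\<^sup>+c. (\<integral>\<^sup>+x. indicator {0<..<1} c * indicator {x. ennreal c < f x} x \<partial>lborel) \<partial>lborel)"
    by (subst lborel_pair.Fubini') (auto simp: indicator_def)
  also have "\<dots> = (\<integral>\<^sup>+c. indicator {0<..<1} c * emeasure lborel {x. ennreal c < f x} \<partial>lborel)"
    by (intro nn_integral_cong) (simp add: nn_integral_cmult)
  finally show ?thesis .
qed

text \<open>If f(x) > c and g(y) > c, then h > c at the midpoint, so
  \<open>brunn_minkowski_line\<close> applies to the superlevel sets at each height c < 1.
  Integrating over c gives an additive inequality.\<close>

lemma prekopa_leindler_line_normalized:
  fixes f g h :: "real \<Rightarrow> ennreal"
  assumes [measurable]: "f \<in> borel_measurable borel" "g \<in> borel_measurable borel" "h \<in> borel_measurable borel"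
    and sup: "(SUP x. f x) = 1" "(SUP x. g x) = 1"
    and fgh: "\<And>x y. f x * g y \<le> (h ((x + y) / 2))\<^sup>2"
  shows "(\<integral>\<^sup>+x. f x \<partial>lborel) + (\<integral>\<^sup>+x. g x \<partial>lborel) \<le> 2 * (\<integral>\<^sup>+x. h x \<partial>lborel)"
proof -
  have min1: "min 1 (f x) = f x" "min 1 (g x) = g x" for x
    using SUP_upper[of x UNIV f] SUP_upper[of x UNIV g] sup by (auto simp: min_absorb2)
  have "(\<integral>\<^sup>+x. f x \<partial>lborel) + (\<integral>\<^sup>+x. g x \<partial>lborel) =
     (\<integral>\<^sup>+c. indicator {0<..<1} c * emeasure lborel {x. ennreal c < f x} +
            indicator {0<..<1} c * emeasure lborel {x. ennreal c < g x} \<partial>lborel)"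
    using nn_integral_level_sets[of f] nn_integral_level_sets[of g]
    by (subst nn_integral_add) (auto simp: min1)
  also have "\<dots> \<le> (\<integral>\<^sup>+c. 2 * (indicator {0<..<1} c * emeasure lborel {x. ennreal c < h x}) \<partial>lborel)"
  proof (intro nn_integral_mono)
    fix c :: real
    show "indicator {0<..<1} c * emeasure lborel {x. ennreal c < f x} +
            indicator {0<..<1} c * emeasure lborel {x. ennreal c < g x}
        \<le> 2 * (indicator {0<..<1} c * emeasure lborel {x. ennreal c < h x})"
    proof (cases "0 < c \<and> c < 1")
      case True
      then have c1: "ennreal c < 1" by (simp flip: ennreal_1 add: ennreal_less_iff)
      have "emeasure lborel {x. ennreal c < f x} + emeasure lborel {x. ennreal c < g x}
        \<le> 2 * emeasure lborel {x. ennreal c < h x}"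
      proof (rule brunn_minkowski_line)
        show "{x. ennreal c < f x} \<noteq> {}" "{x. ennreal c < g x} \<noteq> {}"
          using c1 less_SUP_iff[of "ennreal c" f UNIV] less_SUP_iff[of "ennreal c" g UNIV] sup by auto
        fix x y assume "x \<in> {x. ennreal c < f x}" "y \<in> {x. ennreal c < g x}"
        then have c: "ennreal c < f x" "ennreal c < g y" by auto
        have "ennreal c * ennreal c < ennreal c * g y"
          using c True by (intro ennreal_mult_strict_left_mono) auto
        also have "\<dots> \<le> f x * g y" using c by (intro mult_right_mono) auto
        also have "\<dots> \<le> (h ((x + y) / 2))\<^sup>2" by (rule fgh)
        finally have "(ennreal c)\<^sup>2 < (h ((x + y) / 2))\<^sup>2" by (simp add: power2_eq_square)
        then show "(x + y) / 2 \<in> {x. ennreal c < h x}"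
          using power_mono[of "h ((x + y) / 2)" "ennreal c" 2] by (force simp: not_less)
      qed measurable
      with True show ?thesis by simp
    qed auto
  qed
  also have "\<dots> = 2 * (\<integral>\<^sup>+x. min 1 (h x) \<partial>lborel)"
    by (subst nn_integral_cmult) (auto simp: nn_integral_level_sets)
  also have "\<dots> \<le> 2 * (\<integral>\<^sup>+x. h x \<partial>lborel)"
    by (intro mult_left_mono nn_integral_mono) auto
  finally show ?thesis .
qed

text \<open>AM-GM for extended reals; it turns the additive inequality on the line into the
  multiplicative one, the form that survives induction on the dimension.\<close>

lemma ennreal_product_le_square:
  fixes x y z :: ennreal
  assumes "x + y \<le> 2 * z"
  shows "x * y \<le> z\<^sup>2"
proof (cases z)
  case (real c)
  then have "2 * z < top" by (simp add: ennreal_mult_less_top)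
  then have "x + y < top" by (rule le_less_trans[OF assms])
  then obtain a b where ab: "x = ennreal a" "y = ennreal b" "0 \<le> a" "0 \<le> b"
    by (cases x; cases y) auto
  have "a + b \<le> 2 * c"
    using assms real ab by (simp flip: ennreal_plus ennreal_numeral ennreal_mult'' add: ennreal_le_iff)
  then have "(a + b)\<^sup>2 \<le> (2 * c)\<^sup>2" using ab by (intro power_mono) auto
  moreover have "4 * (a * b) \<le> (a + b)\<^sup>2" using zero_le_power2[of "a - b"] by (simp add: power2_eq_square algebra_simps)
  ultimately have "a * b \<le> c\<^sup>2" by (simp add: power_mult_distrib)
  then show ?thesis using real ab by (simp flip: ennreal_mult add: ennreal_power ennreal_le_iff)
qed simp

text \<open>Hypothesis and conclusion are homogeneous, so \<open>f\<close> and \<open>g\<close> may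
  be divided by their suprema and \<open>h\<close> by the geometric mean of the two. Boundedness
  makes the suprema finite.\<close>

lemma prekopa_leindler_line_bounded:
  fixes f g h :: "real \<Rightarrow> ennreal"
  assumes [measurable]: "f \<in> borel_measurable borel" "g \<in> borel_measurable borel" "h \<in> borel_measurable borel"
    and bdd: "\<And>x. f x \<le> ennreal k" "\<And>x. g x \<le> ennreal k"
    and fgh: "\<And>x y. f x * g y \<le> (h ((x + y) / 2))\<^sup>2"
  shows "(\<integral>\<^sup>+x. f x \<partial>lborel) * (\<integral>\<^sup>+x. g x \<partial>lborel) \<le> (\<integral>\<^sup>+x. h x \<partial>lborel)\<^sup>2"
proof (cases "(SUP x. f x) = 0 \<or> (SUP x. g x) = 0")
  case True
  then have "(\<forall>x. f x = 0) \<or> (\<forall>x. g x = 0)"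
    by (metis SUP_upper UNIV_I le_zero_eq)
  then show ?thesis by auto
next
  case False
  have "(SUP x. f x) \<le> ennreal k" "(SUP x. g x) \<le> ennreal k" using bdd by (auto intro: SUP_least)
  then have fin: "(SUP x. f x) < top" "(SUP x. g x) < top"
    by (auto intro: le_less_trans)
  obtain F where F: "(SUP x. f x) = ennreal F" "0 < F"
    using fin(1) False by (cases "SUP x. f x") (auto simp: less_le)
  obtain G where G: "(SUP x. g x) = ennreal G" "0 < G"
    using fin(2) False by (cases "SUP x. g x") (auto simp: less_le)
  define a b r where "a = ennreal (1 / F)" and "b = ennreal (1 / G)" and "r = ennreal (1 / sqrt (F * G))"
  have r2: "r\<^sup>2 = a * b"
    using F G by (simp add: a_def b_def r_def ennreal_power power_divide flip: ennreal_mult)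
  have "(\<integral>\<^sup>+x. a * f x \<partial>lborel) + (\<integral>\<^sup>+x. b * g x \<partial>lborel) \<le> 2 * (\<integral>\<^sup>+x. r * h x \<partial>lborel)"
  proof (rule prekopa_leindler_line_normalized)
    show "(SUP x. a * f x) = 1" "(SUP x. b * g x) = 1"
      using F G by (simp_all add: a_def b_def flip: SUP_mult_left_ennreal ennreal_mult)
    show "a * f x * (b * g y) \<le> (r * h ((x + y) / 2))\<^sup>2" for x y
      using mult_left_mono[OF fgh[of x y], of "a * b"] by (simp add: power_mult_distrib r2 mult_ac)
  qed measurable
  then have "(a * (\<integral>\<^sup>+x. f x \<partial>lborel)) * (b * (\<integral>\<^sup>+x. g x \<partial>lborel)) \<le> (r * (\<integral>\<^sup>+x. h x \<partial>lborel))\<^sup>2"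
    by (intro ennreal_product_le_square) (simp add: nn_integral_cmult)
  then have "(a * b) * ((\<integral>\<^sup>+x. f x \<partial>lborel) * (\<integral>\<^sup>+x. g x \<partial>lborel)) \<le> (a * b) * (\<integral>\<^sup>+x. h x \<partial>lborel)\<^sup>2"
    by (simp add: power_mult_distrib r2 mult_ac)
  then have "ennreal (F * G) * ((a * b) * ((\<integral>\<^sup>+x. f x \<partial>lborel) * (\<integral>\<^sup>+x. g x \<partial>lborel)))
     \<le> ennreal (F * G) * ((a * b) * (\<integral>\<^sup>+x. h x \<partial>lborel)\<^sup>2)"
    by (rule mult_left_mono) simp
  moreover have "ennreal (F * G) * (a * b) = 1"
    using F G by (simp add: a_def b_def flip: ennreal_mult)
  ultimately show ?thesis by (simp flip: mult.assoc)
qed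

text \<open>Truncating \<open>f\<close> and \<open>g\<close> at integer heights preserves the
  hypothesis with the same \<open>h\<close>, and monotone convergence removes the
  truncation.\<close>

lemma prekopa_leindler_line:
  fixes f g h :: "real \<Rightarrow> ennreal"
  assumes [measurable]: "f \<in> borel_measurable borel" "g \<in> borel_measurable borel" "h \<in> borel_measurable borel"
    and fgh: "\<And>x y. f x * g y \<le> (h ((x + y) / 2))\<^sup>2"
  shows "(\<integral>\<^sup>+x. f x \<partial>lborel) * (\<integral>\<^sup>+x. g x \<partial>lborel) \<le> (\<integral>\<^sup>+x. h x \<partial>lborel)\<^sup>2"
proof -
  have trunc: "(\<integral>\<^sup>+x. u x \<partial>lborel) = (SUP k::nat. \<integral>\<^sup>+x. min (u x) (of_nat k) \<partial>lborel)"
    if [measurable]: "u \<in> borel_measurable borel" for u :: "real \<Rightarrow> ennreal"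
  proof -
    have "(SUP k::nat. min (u x) (of_nat k)) = u x" for x
    proof (rule antisym)
      show "u x \<le> (SUP k::nat. min (u x) (of_nat k))"
      proof (rule dense_le)
        fix y assume "y < u x"
        moreover obtain k :: nat where "y < of_nat k"
          using ennreal_Ex_less_of_nat[of y] less_le_trans[OF \<open>y < u x\<close> top_greatest] by auto
        ultimately have "y \<le> min (u x) (of_nat k)" by auto
        then show "y \<le> (SUP k::nat. min (u x) (of_nat k))" by (auto intro: SUP_upper2)
      qed
    qed (auto intro: SUP_least)
    then have "(\<integral>\<^sup>+x. u x \<partial>lborel) = (\<integral>\<^sup>+x. (SUP k::nat. min (u x) (of_nat k)) \<partial>lborel)" by simp
    also have "\<dots> = (SUP k::nat. \<integral>\<^sup>+x. min (u x) (of_nat k) \<partial>lborel)"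
      by (rule nn_integral_monotone_convergence_SUP)
         (auto simp: incseq_def le_fun_def min_le_iff_disj intro!: min.mono of_nat_mono)
    finally show ?thesis .
  qed
  have le: "(\<integral>\<^sup>+x. min (f x) (of_nat k) \<partial>lborel) * (\<integral>\<^sup>+x. min (g x) (of_nat l) \<partial>lborel)
      \<le> (\<integral>\<^sup>+x. h x \<partial>lborel)\<^sup>2" for k l :: nat
  proof (rule prekopa_leindler_line_bounded[where k = "real (max k l)"])
    show "min (f x) (of_nat k) \<le> ennreal (real (max k l))" "min (g x) (of_nat l) \<le> ennreal (real (max k l))" for x
      by (simp_all add: min_le_iff_disj ennreal_of_nat_eq_real_of_nat)
    show "min (f x) (of_nat k) * min (g y) (of_nat l) \<le> (h ((x + y) / 2))\<^sup>2" for x y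
      by (rule order_trans[OF _ fgh]) (intro mult_mono, auto)
  qed measurable
  have "(\<integral>\<^sup>+x. f x \<partial>lborel) * (\<integral>\<^sup>+x. g x \<partial>lborel) =
    (SUP k::nat. (SUP l::nat. (\<integral>\<^sup>+x. min (f x) (of_nat k) \<partial>lborel) * (\<integral>\<^sup>+x. min (g x) (of_nat l) \<partial>lborel)))"
    by (subst (1 2) trunc) (simp_all flip: SUP_mult_left_ennreal SUP_mult_right_ennreal)
  also have "\<dots> \<le> (\<integral>\<^sup>+x. h x \<partial>lborel)\<^sup>2"
    by (intro SUP_least le)
  finally show ?thesis .
qed

text \<open>By the induction hypothesis, the marginals of \<open>f\<close>, \<open>g\<close> and
  \<open>h\<close> in the new coordinate satisfy the hypothesis of the line case. Over the empty
  index set the integrals are values at one point.\<close>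

theorem prekopa_leindler:
  fixes f g h :: "('i \<Rightarrow> real) \<Rightarrow> ennreal"
  assumes "finite I"
    and "f \<in> borel_measurable (PiM I (\<lambda>_. lborel))" "g \<in> borel_measurable (PiM I (\<lambda>_. lborel))"
      "h \<in> borel_measurable (PiM I (\<lambda>_. lborel))"
    and "\<And>x y. x \<in> I \<rightarrow>\<^sub>E UNIV \<Longrightarrow> y \<in> I \<rightarrow>\<^sub>E UNIV \<Longrightarrow> f x * g y \<le> (h (\<lambda>i\<in>I. (x i + y i) / 2))\<^sup>2"
  shows "(\<integral>\<^sup>+x. f x \<partial>PiM I (\<lambda>_. lborel)) * (\<integral>\<^sup>+x. g x \<partial>PiM I (\<lambda>_. lborel))
     \<le> (\<integral>\<^sup>+x. h x \<partial>PiM I (\<lambda>_. lborel))\<^sup>2"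
  using assms
proof (induction I arbitrary: f g h rule: finite_induct)
  case empty
  interpret product_sigma_finite "\<lambda>_. lborel :: real measure" ..
  show ?case
    using empty(4)[of "\<lambda>_. undefined" "\<lambda>_. undefined"] by (simp add: nn_integral_empty restrict_def)
next
  case (insert i I)
  interpret product_sigma_finite "\<lambda>_. lborel :: real measure" ..
  interpret finite_product_sigma_finite "\<lambda>_. lborel :: real measure" I by standard (rule insert(1))
  note [measurable] = insert.prems(1-3)
  have split: "(\<integral>\<^sup>+x. u x \<partial>PiM (insert i I) (\<lambda>_. lborel)) = (\<integral>\<^sup>+t. (\<integral>\<^sup>+x. u (x(i := t)) \<partial>PiM I (\<lambda>_. lborel)) \<partial>lborel)"
    if "u \<in> borel_measurable (PiM (insert i I) (\<lambda>_. lborel))" for u :: "('i \<Rightarrow> real) \<Rightarrow> ennreal"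
    using insert(1,2) that by (rule product_nn_integral_insert_rev)
  have meas: "(\<lambda>x. u (x(i := t))) \<in> borel_measurable (PiM I (\<lambda>_. lborel))"
    "(\<lambda>t. \<integral>\<^sup>+x. u (x(i := t)) \<partial>PiM I (\<lambda>_. lborel)) \<in> borel_measurable borel"
    if [measurable]: "u \<in> borel_measurable (PiM (insert i I) (\<lambda>_. lborel))" for u :: "('i \<Rightarrow> real) \<Rightarrow> ennreal" and t
  proof -
    have [measurable]: "t \<in> space lborel" by simp
    show "(\<lambda>x. u (x(i := t))) \<in> borel_measurable (PiM I (\<lambda>_. lborel))" by measurable
    have "(\<lambda>t. \<integral>\<^sup>+x. u (x(i := t)) \<partial>PiM I (\<lambda>_. lborel)) \<in> borel_measurable lborel" by measurable
    then show "(\<lambda>t. \<integral>\<^sup>+x. u (x(i := t)) \<partial>PiM I (\<lambda>_. lborel)) \<in> borel_measurable borel" by simp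
  qed
  show ?case
    unfolding split[OF insert.prems(1)] split[OF insert.prems(2)] split[OF insert.prems(3)]
  proof (rule prekopa_leindler_line)
    fix s t :: real
    show "(\<integral>\<^sup>+x. f (x(i := s)) \<partial>PiM I (\<lambda>_. lborel)) * (\<integral>\<^sup>+x. g (x(i := t)) \<partial>PiM I (\<lambda>_. lborel))
      \<le> (\<integral>\<^sup>+x. h (x(i := (s + t) / 2)) \<partial>PiM I (\<lambda>_. lborel))\<^sup>2"
    proof (rule insert.IH)
      fix x y :: "'i \<Rightarrow> real" assume xy: "x \<in> I \<rightarrow>\<^sub>E UNIV" "y \<in> I \<rightarrow>\<^sub>E UNIV"
      have "(\<lambda>j\<in>insert i I. ((x(i := s)) j + (y(i := t)) j) / 2) = (\<lambda>j\<in>I. (x j + y j) / 2)(i := (s + t) / 2)"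
        using insert(2) by (auto simp: fun_eq_iff)
      then show "f (x(i := s)) * g (y(i := t)) \<le> (h ((\<lambda>j\<in>I. (x j + y j) / 2)(i := (s + t) / 2)))\<^sup>2"
        using insert.prems(4)[OF PiE_fun_upd[OF UNIV_I xy(1), of i s] PiE_fun_upd[OF UNIV_I xy(2), of i t]]
        by (simp only:)
    qed (intro meas insert.prems)+
  qed (intro meas insert.prems)+
qed

section \<open>Linear maps and Lebesgue measure\<close>

interpretation lborel_product: product_sigma_finite "\<lambda>_::nat. lborel :: real measure" ..

lemma sigma_finite_lebn: "sigma_finite_measure (lebn n)"
  unfolding lebn_def by (rule lborel_product.sigma_finite) simp

lemma Rn_sets[measurable]: "Rn n \<in> sets (lebn n)"
  by (metis sets.top space_lebn)

lemma Rn_eqI: "x \<in> Rn n \<Longrightarrow> y \<in> Rn n \<Longrightarrow> (\<And>i. i < n \<Longrightarrow> x i = y i) \<Longrightarrow> x = y"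
  by (auto simp: Rn_def intro: PiE_ext)

lemma restrict_in_Rn[simp]: "restrict f {..<n} \<in> Rn n"
  by (simp add: Rn_def)

lemma vadd_in[simp]: "vadd n x y \<in> Rn n" and vscale_in[simp]: "vscale n a x \<in> Rn n"
  and vzero_in[simp]: "vzero n \<in> Rn n"
  by (simp_all add: vadd_def vscale_def vzero_def)

lemma component_measurable_lebn[measurable]:
  assumes "i < n"
  shows "(\<lambda>x. x i) \<in> borel_measurable (lebn n)"
  using measurable_component_singleton[of i "{..<n}" "\<lambda>_. lborel :: real measure"] assms
  by (simp add: lebn_def)

lemma measurable_restrict_lebn:
  assumes "\<And>i. i < n \<Longrightarrow> (\<lambda>x. f x i) \<in> borel_measurable M"
  shows "(\<lambda>x. \<lambda>i\<in>{..<n}. f x i) \<in> measurable M (lebn n)"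
  unfolding lebn_def by (rule measurable_restrict) (use assms in auto)

lemma component_measurable_comp:
  assumes "f \<in> measurable M (lebn n)" "i < n"
  shows "(\<lambda>x. f x i) \<in> borel_measurable M"
  using measurable_compose[OF assms(1) component_measurable_lebn[OF assms(2)]] by simp

lemma dot_measurable[measurable]:
  assumes [measurable]: "f \<in> measurable M (lebn n)" "g \<in> measurable M (lebn n)"
  shows "(\<lambda>x. dot n (f x) (g x)) \<in> borel_measurable M"
  unfolding dot_def
  by (intro borel_measurable_sum borel_measurable_times component_measurable_comp[where n = n] assms) auto

lemma vadd_measurable[measurable]:
  assumes [measurable]: "f \<in> measurable M (lebn n)" "g \<in> measurable M (lebn n)"
  shows "(\<lambda>x. vadd n (f x) (g x)) \<in> measurable M (lebn n)"
  unfolding vadd_def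
  by (intro measurable_restrict_lebn borel_measurable_add component_measurable_comp[where n = n] assms) auto

lemma vscale_measurable[measurable]:
  assumes [measurable]: "a \<in> borel_measurable M" "f \<in> measurable M (lebn n)"
  shows "(\<lambda>x. vscale n (a x) (f x)) \<in> measurable M (lebn n)"
  unfolding vscale_def
  by (intro measurable_restrict_lebn borel_measurable_times component_measurable_comp[where n = n] assms) auto

lemma const_measurable_lebn: "x \<in> Rn n \<Longrightarrow> (\<lambda>_. x) \<in> measurable M (lebn n)"
  by (simp add: space_lebn)

lemma dot_const_measurable[measurable]: "(\<lambda>x. dot n x t) \<in> borel_measurable (lebn n)"
  unfolding dot_def by (intro borel_measurable_sum borel_measurable_times) auto

lemma distr_lebn_vadd:
  assumes a: "a \<in> Rn n"
  shows "distr (lebn n) (lebn n) (vadd n a) = lebn n"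
proof -
  have [measurable]: "vadd n a \<in> measurable (lebn n) (lebn n)"
    using vadd_measurable[OF const_measurable_lebn[OF a] measurable_ident] by simp
  have "distr (lebn n) (lebn n) (vadd n a) = PiM {..<n} (\<lambda>_. lborel)"
  proof (rule lborel_product.PiM_eqI)
    fix A :: "nat \<Rightarrow> real set" assume A: "\<And>i. i \<in> {..<n} \<Longrightarrow> A i \<in> sets lborel"
    have "emeasure (distr (lebn n) (lebn n) (vadd n a)) (PiE {..<n} A) =
      emeasure (lebn n) (vadd n a -` PiE {..<n} A \<inter> space (lebn n))"
    proof (rule emeasure_distr)
      show "PiE {..<n} A \<in> sets (lebn n)" unfolding lebn_def by (rule sets_PiM_I_finite) (use A in auto)
    qed measurable
    also have "vadd n a -` PiE {..<n} A \<inter> space (lebn n) = PiE {..<n} (\<lambda>i. (+) (a i) -` A i)"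
      by (auto simp: space_lebn Rn_def vadd_def PiE_def Pi_def extensional_def)
    also have "emeasure (lebn n) \<dots> = (\<Prod>i<n. emeasure lborel ((+) (a i) -` A i))"
      unfolding lebn_def
    proof (rule lborel_product.emeasure_PiM)
      show "(+) (a i) -` A i \<in> sets lborel" if "i \<in> {..<n}" for i
        using measurable_sets[of "(+) (a i)" borel borel "A i"] A[OF that] by simp
    qed simp
    also have "\<dots> = (\<Prod>i<n. emeasure lborel (A i))"
    proof (rule prod.cong[OF refl])
      fix i assume i: "i \<in> {..<n}"
      have "emeasure lborel (A i) = emeasure (distr lborel borel ((+) (a i))) (A i)"
        by (simp add: lborel_distr_plus)
      also have "\<dots> = emeasure lborel ((+) (a i) -` A i)"
        using A[OF i] by (subst emeasure_distr) auto
      finally show "emeasure lborel ((+) (a i) -` A i) = emeasure lborel (A i)" by simp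
    qed
    finally show "emeasure (distr (lebn n) (lebn n) (vadd n a)) (PiE {..<n} A) = (\<Prod>i<n. emeasure lborel (A i))" .
  qed (simp_all add: lebn_def)
  then show ?thesis by (simp add: lebn_def)
qed

text \<open>Substitute \<open>x - y\<close> for \<open>x\<close>, then \<open>y + x\<close> for
  \<open>y\<close>, then \<open>x - y\<close> for \<open>x\<close> in the double integral of \<open>1\<^sub>A y * 1\<^sub>B x\<close>.\<close>

lemma translation_invariant_unique:
  assumes M: "sigma_finite_measure M" "sets M = sets (lebn n)"
    and inv: "\<And>a. a \<in> Rn n \<Longrightarrow> distr M (lebn n) (vadd n a) = M"
    and [measurable]: "A \<in> sets (lebn n)" "B \<in> sets (lebn n)"
  shows "emeasure M A * emeasure (lebn n) B =
    emeasure (lebn n) A * emeasure M {x \<in> Rn n. vscale n (-1) x \<in> B}"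
proof -
  interpret M: sigma_finite_measure M by fact
  interpret L: sigma_finite_measure "lebn n" by (rule sigma_finite_lebn)
  interpret prd: pair_sigma_finite M "lebn n" ..
  note M(2)[measurable_cong]
  have spM: "space M = Rn n" using sets_eq_imp_space_eq[OF M(2)] by (simp add: space_lebn)
  have shiftL: "(\<integral>\<^sup>+x. f (vadd n a x) \<partial>lebn n) = (\<integral>\<^sup>+x. f x \<partial>lebn n)"
    if [measurable]: "f \<in> borel_measurable (lebn n)" and a: "a \<in> Rn n" for a and f :: "_ \<Rightarrow> ennreal"
  proof -
    have [measurable]: "vadd n a \<in> measurable (lebn n) (lebn n)"
      using vadd_measurable[OF const_measurable_lebn[OF a] measurable_ident] by simp
    have "(\<integral>\<^sup>+x. f x \<partial>lebn n) = (\<integral>\<^sup>+x. f x \<partial>distr (lebn n) (lebn n) (vadd n a))"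
      by (simp add: distr_lebn_vadd[OF a])
    then show ?thesis by (simp add: nn_integral_distr)
  qed
  have shiftM: "(\<integral>\<^sup>+x. f (vadd n a x) \<partial>M) = (\<integral>\<^sup>+x. f x \<partial>M)"
    if [measurable]: "f \<in> borel_measurable (lebn n)" and a: "a \<in> Rn n" for a and f :: "_ \<Rightarrow> ennreal"
  proof -
    have [measurable]: "vadd n a \<in> measurable M (lebn n)"
      using vadd_measurable[OF const_measurable_lebn[OF a] measurable_ident] measurable_cong_sets[OF M(2) refl] by auto
    have "(\<integral>\<^sup>+x. f x \<partial>M) = (\<integral>\<^sup>+x. f x \<partial>distr M (lebn n) (vadd n a))"
      by (simp add: inv[OF a])
    then show ?thesis by (simp add: nn_integral_distr)
  qed
  have [measurable]: "(\<lambda>x. x) \<in> measurable M (lebn n)" using M(2) by (rule measurable_ident_sets)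
  have "emeasure M A * emeasure (lebn n) B = (\<integral>\<^sup>+y. indicator A y * (\<integral>\<^sup>+x. indicator B x \<partial>lebn n) \<partial>M)"
    by (simp add: nn_integral_multc M(2))
  also have "\<dots> = (\<integral>\<^sup>+y. (\<integral>\<^sup>+x. indicator A y * indicator B x \<partial>lebn n) \<partial>M)"
    by (simp add: nn_integral_cmult)
  also have "\<dots> = (\<integral>\<^sup>+y. (\<integral>\<^sup>+x. indicator A y * indicator B (vadd n (vscale n (-1) y) x) \<partial>lebn n) \<partial>M)"
    by (intro nn_integral_cong shiftL[symmetric, of "\<lambda>x. indicator A _ * indicator B x"]) auto
  also have "\<dots> = (\<integral>\<^sup>+x. (\<integral>\<^sup>+y. indicator A y * indicator B (vadd n (vscale n (-1) y) x) \<partial>M) \<partial>lebn n)"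
    by (rule prd.Fubini'[symmetric]) measurable
  also have "\<dots> = (\<integral>\<^sup>+x. (\<integral>\<^sup>+y. indicator A (vadd n x y) * indicator B (vscale n (-1) y) \<partial>M) \<partial>lebn n)"
  proof (rule nn_integral_cong)
    fix x assume "x \<in> space (lebn n)"
    then have x: "x \<in> Rn n" by (simp add: space_lebn)
    have [measurable]: "(\<lambda>_. x) \<in> measurable (lebn n) (lebn n)" by (rule const_measurable_lebn[OF x])
    have "vadd n (vscale n (-1) (vadd n x y)) x = vscale n (-1) y" for y
      by (rule Rn_eqI[of _ n]) (auto simp: vadd_def vscale_def)
    then show "(\<integral>\<^sup>+y. indicator A y * indicator B (vadd n (vscale n (-1) y) x) \<partial>M)
       = (\<integral>\<^sup>+y. indicator A (vadd n x y) * indicator B (vscale n (-1) y) \<partial>M)"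
      using shiftM[of "\<lambda>y. indicator A y * indicator B (vadd n (vscale n (-1) y) x)" x] x by simp
  qed
  also have "\<dots> = (\<integral>\<^sup>+y. (\<integral>\<^sup>+x. indicator A (vadd n x y) * indicator B (vscale n (-1) y) \<partial>lebn n) \<partial>M)"
    by (rule prd.Fubini') measurable
  also have "\<dots> = (\<integral>\<^sup>+y. (\<integral>\<^sup>+x. indicator A x * indicator B (vscale n (-1) y) \<partial>lebn n) \<partial>M)"
  proof (rule nn_integral_cong)
    fix y assume "y \<in> space M"
    then have y: "y \<in> Rn n" by (simp add: spM)
    have "vadd n x y = vadd n y x" for x by (simp add: vadd_def add.commute)
    then show "(\<integral>\<^sup>+x. indicator A (vadd n x y) * indicator B (vscale n (-1) y) \<partial>lebn n)
       = (\<integral>\<^sup>+x. indicator A x * indicator B (vscale n (-1) y) \<partial>lebn n)"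
      using shiftL[of "\<lambda>x. indicator A x * indicator B (vscale n (-1) y)" y] y by simp
  qed
  also have "\<dots> = (\<integral>\<^sup>+y. emeasure (lebn n) A * indicator {x \<in> Rn n. vscale n (-1) x \<in> B} y \<partial>M)"
    by (intro nn_integral_cong) (auto simp: nn_integral_multc spM split: split_indicator)
  also have "\<dots> = emeasure (lebn n) A * emeasure M {x \<in> Rn n. vscale n (-1) x \<in> B}"
  proof (rule nn_integral_cmult_indicator)
    have "{x \<in> space (lebn n). vscale n (-1) x \<in> B} \<in> sets (lebn n)" by measurable
    then show "{x \<in> Rn n. vscale n (-1) x \<in> B} \<in> sets M" by (simp add: M(2) space_lebn)
  qed
  finally show ?thesis .
qed

definition basis :: "nat \<Rightarrow> nat \<Rightarrow> nat \<Rightarrow> real" where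
  "basis n j = (\<lambda>i\<in>{..<n}. if i = j then 1 else 0)"

lemma basis_in[simp]: "basis n j \<in> Rn n"
  by (simp add: basis_def)

lemma linear_nD:
  assumes "linear_n n T"
  shows "x \<in> Rn n \<Longrightarrow> T x \<in> Rn n"
    "x \<in> Rn n \<Longrightarrow> y \<in> Rn n \<Longrightarrow> T (vadd n x y) = vadd n (T x) (T y)"
    "x \<in> Rn n \<Longrightarrow> T (vscale n a x) = vscale n a (T x)"
  using assms by (auto simp: linear_n_def)

lemma linear_n_expand:
  assumes T: "linear_n n T" and x: "x \<in> Rn n"
  shows "T x = (\<lambda>i\<in>{..<n}. \<Sum>j<n. x j * T (basis n j) i)"
proof -
  have "T (\<lambda>i\<in>{..<n}. if i < k then x i else 0) = (\<lambda>i\<in>{..<n}. \<Sum>j<k. x j * T (basis n j) i)"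
    if "k \<le> n" for k
    using that
  proof (induction k)
    case 0
    have "T (\<lambda>i\<in>{..<n}. 0) = T (vscale n 0 x)" by (simp add: vscale_def)
    also have "\<dots> = vscale n 0 (T x)" by (rule linear_nD(3)[OF T x])
    finally show ?case by (simp only: vscale_def not_less_zero if_False lessThan_0 sum.empty mult_zero_left)
  next
    case (Suc k)
    have "(\<lambda>i\<in>{..<n}. if i < Suc k then x i else 0) =
      vadd n (\<lambda>i\<in>{..<n}. if i < k then x i else 0) (vscale n (x k) (basis n k))"
      using Suc.prems by (intro Rn_eqI[of _ n]) (auto simp: vadd_def vscale_def basis_def less_Suc_eq)
    then have "T (\<lambda>i\<in>{..<n}. if i < Suc k then x i else 0) =
      vadd n (T (\<lambda>i\<in>{..<n}. if i < k then x i else 0)) (vscale n (x k) (T (basis n k)))"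
      by (simp add: linear_nD[OF T])
    also have "T (\<lambda>i\<in>{..<n}. if i < k then x i else 0) = (\<lambda>i\<in>{..<n}. \<Sum>j<k. x j * T (basis n j) i)"
      by (rule Suc.IH) (use Suc.prems in simp)
    finally show ?case
      by (simp only:) (rule ext, simp add: vadd_def vscale_def)
  qed
  from this[of n] have "T (\<lambda>i\<in>{..<n}. if i < n then x i else 0) = (\<lambda>i\<in>{..<n}. \<Sum>j<n. x j * T (basis n j) i)"
    by simp
  moreover have "(\<lambda>i\<in>{..<n}. if i < n then x i else 0) = x"
    using x by (intro Rn_eqI[of _ n]) auto
  ultimately show ?thesis by simp
qed

lemma linear_n_measurable:
  assumes T: "linear_n n T"
  shows "T \<in> measurable (lebn n) (lebn n)"
proof -
  have "(\<lambda>x. \<lambda>i\<in>{..<n}. \<Sum>j<n. x j * T (basis n j) i) \<in> measurable (lebn n) (lebn n)"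
    by (intro measurable_restrict_lebn borel_measurable_sum borel_measurable_times) auto
  then show ?thesis
    by (subst measurable_cong[where g = "\<lambda>x. \<lambda>i\<in>{..<n}. \<Sum>j<n. x j * T (basis n j) i"])
       (auto simp: space_lebn linear_n_expand[OF T])
qed

lemma linear_n_inverse:
  assumes T: "linear_n n T" and bij: "bij_betw T (Rn n) (Rn n)"
  shows "linear_n n (the_inv_into (Rn n) T)"
proof -
  let ?S = "the_inv_into (Rn n) T"
  have inj: "inj_on T (Rn n)" and im: "T ` Rn n = Rn n" using bij by (auto simp: bij_betw_def)
  have S: "?S y \<in> Rn n" "T (?S y) = y" if "y \<in> Rn n" for y
    using the_inv_into_into[OF inj, of y "Rn n"] f_the_inv_into_f[OF inj, of y] that im by auto
  have eq: "?S y = z" if "z \<in> Rn n" "T z = y" for y z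
    using that the_inv_into_f_f[OF inj] by auto
  show ?thesis
    unfolding linear_n_def
    by (auto intro!: eq S(1) simp: linear_nD[OF T] S)
qed

text \<open>Since \<open>T\<close> turns a shift by a into a shift by T a, assigning to a set the
  volume of its image is a translation-invariant measure, hence proportional to Lebesgue measure.
  The reference set \<open>B\<close> takes the place of |det T|; its symmetry absorbs the reflection
  in \<open>translation_invariant_unique\<close>.\<close>

lemma emeasure_linear_image:
  assumes T: "linear_n n T" and bij: "bij_betw T (Rn n) (Rn n)"
    and A[measurable]: "A \<in> sets (lebn n)" and B[measurable]: "B \<in> sets (lebn n)" and sym: "symmetric_n n B"
  shows "T ` A \<in> sets (lebn n)"
    and "emeasure (lebn n) (T ` A) * emeasure (lebn n) B = emeasure (lebn n) A * emeasure (lebn n) (T ` B)"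
proof -
  let ?S = "the_inv_into (Rn n) T"
  have inj: "inj_on T (Rn n)" and im: "T ` Rn n = Rn n" using bij by (auto simp: bij_betw_def)
  have S: "?S y \<in> Rn n" "T (?S y) = y" if "y \<in> Rn n" for y
    using the_inv_into_into[OF inj, of y "Rn n"] f_the_inv_into_f[OF inj, of y] that im by auto
  have ST: "?S (T x) = x" if "x \<in> Rn n" for x using the_inv_into_f_f[OF inj that] .
  have Slin: "linear_n n ?S" by (rule linear_n_inverse[OF T bij])
  have Sm[measurable]: "?S \<in> measurable (lebn n) (lebn n)" by (rule linear_n_measurable[OF Slin])
  have image: "T ` X = ?S -` X \<inter> space (lebn n)" if X: "X \<in> sets (lebn n)" for X
  proof -
    have "X \<subseteq> Rn n" using sets.sets_into_space[OF X] by (simp add: space_lebn)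
    then show ?thesis
      using S ST linear_nD(1)[OF T] by (auto simp: space_lebn) (metis image_eqI)
  qed
  have image_sets: "T ` X \<in> sets (lebn n)" if X: "X \<in> sets (lebn n)" for X
    unfolding image[OF X] by (rule measurable_sets[OF Sm X])
  then show "T ` A \<in> sets (lebn n)" using A .
  define M where "M = distr (lebn n) (lebn n) ?S"
  have M_eq: "emeasure M X = emeasure (lebn n) (T ` X)" if X: "X \<in> sets (lebn n)" for X
    unfolding M_def by (simp add: emeasure_distr X image)
  have setsM: "sets M = sets (lebn n)" by (simp add: M_def)
  \<comment> \<open>The preimages under \<open>T\<close> of a countable cover by sets of finite
    measure have their images inside those sets, so \<open>M\<close> is finite on them.\<close>
  have "sigma_finite_measure M"
  proof -
    interpret L: sigma_finite_measure "lebn n" by (rule sigma_finite_lebn)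
    obtain C where C: "countable C" "C \<subseteq> sets (lebn n)" "\<Union>C = space (lebn n)" "\<forall>a\<in>C. emeasure (lebn n) a \<noteq> \<infinity>"
      using L.sigma_finite_countable by blast
    have Tm: "T \<in> measurable (lebn n) (lebn n)" by (rule linear_n_measurable[OF T])
    show ?thesis
    proof (rule sigma_finite_measure.intro, intro exI[of _ "(\<lambda>c. T -` c \<inter> space (lebn n)) ` C"] conjI ballI)
      show "(\<lambda>c. T -` c \<inter> space (lebn n)) ` C \<subseteq> sets M"
        using C(2) measurable_sets[OF Tm] by (auto simp: setsM)
      show "\<Union> ((\<lambda>c. T -` c \<inter> space (lebn n)) ` C) = space M"
        using C(3) linear_nD(1)[OF T] by (auto simp: M_def space_lebn) (metis UnionE)
      fix a assume "a \<in> (\<lambda>c. T -` c \<inter> space (lebn n)) ` C"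
      then obtain c where c: "c \<in> C" "a = T -` c \<inter> space (lebn n)" by auto
      have "T ` a \<subseteq> c" using c by auto
      then have "emeasure (lebn n) (T ` a) \<le> emeasure (lebn n) c"
        using c C(2) by (intro emeasure_mono) auto
      moreover have "a \<in> sets (lebn n)" using c C(2) measurable_sets[OF Tm] by auto
      ultimately show "emeasure M a \<noteq> \<infinity>" using C(4) c by (auto simp: M_eq top_unique)
    qed (use C(1) in auto)
  qed
  moreover have "distr M (lebn n) (vadd n a) = M" if a: "a \<in> Rn n" for a
  proof -
    have vm: "vadd n b \<in> measurable (lebn n) (lebn n)" if "b \<in> Rn n" for b
      using vadd_measurable[OF const_measurable_lebn[OF that] measurable_ident] by simp
    have "distr M (lebn n) (vadd n a) = distr (lebn n) (lebn n) (vadd n a \<circ> ?S)"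
      unfolding M_def by (rule distr_distr) (auto intro: vm a)
    also have "\<dots> = distr (lebn n) (lebn n) (?S \<circ> vadd n (T a))"
    proof (rule distr_cong)
      fix x assume "x \<in> space (lebn n)"
      then have x: "x \<in> Rn n" by (simp add: space_lebn)
      show "(vadd n a \<circ> ?S) x = (?S \<circ> vadd n (T a)) x"
        using linear_nD(2)[OF Slin linear_nD(1)[OF T a] x] by (simp add: ST a)
    qed auto
    also have "\<dots> = distr (distr (lebn n) (lebn n) (vadd n (T a))) (lebn n) ?S"
      by (rule distr_distr[symmetric]) (auto intro: vm linear_nD(1)[OF T a])
    also have "\<dots> = M" by (simp add: distr_lebn_vadd linear_nD(1)[OF T a] M_def)
    finally show ?thesis .
  qed
  moreover have "{x \<in> Rn n. vscale n (-1) x \<in> B} = B"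
  proof -
    have "B \<subseteq> Rn n" using sets.sets_into_space[OF B] by (simp add: space_lebn)
    moreover have "vscale n (-1) (vscale n (-1) x) = x" if "x \<in> Rn n" for x
      using that by (intro Rn_eqI[of _ n]) (auto simp: vscale_def)
    ultimately show ?thesis using sym unfolding symmetric_n_def
      by (auto simp: image_iff) (metis imageI)+
  qed
  ultimately show "emeasure (lebn n) (T ` A) * emeasure (lebn n) B = emeasure (lebn n) A * emeasure (lebn n) (T ` B)"
    using translation_invariant_unique[OF _ setsM, of A B] A B by (simp add: M_eq)
qed

section \<open>The isotropic constant\<close>

abbreviation nrm :: "nat \<Rightarrow> (nat \<Rightarrow> real) \<Rightarrow> real" where
  "nrm n x \<equiv> L2_set x {..<n}"

lemma nrm_squared: "(nrm n x)\<^sup>2 = dot n x x"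
  by (simp add: L2_set_def dot_def power2_eq_square sum_nonneg)

lemma dot_commute: "dot n x y = dot n y x"
  by (simp add: dot_def mult.commute)

lemma dot_vadd: "dot n (vadd n x y) z = dot n x z + dot n y z"
  by (simp add: dot_def vadd_def sum.distrib distrib_right)

lemma dot_vscale: "dot n (vscale n a x) z = a * dot n x z"
  by (simp add: dot_def vscale_def sum_distrib_left mult.assoc)

lemma dot_vadd_right: "dot n z (vadd n x y) = dot n z x + dot n z y"
  by (simp add: dot_commute[of n z] dot_vadd)

lemma dot_vscale_right: "dot n z (vscale n a x) = a * dot n z x"
  by (simp add: dot_commute[of n z] dot_vscale)

lemma dot_basis: "i < n \<Longrightarrow> dot n x (basis n i) = x i"
  by (simp add: dot_def basis_def if_distrib[of "(*) _"] cong: if_cong)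

lemma nrm_vscale: "nrm n (vscale n a x) = \<bar>a\<bar> * nrm n x"
  by (rule power2_eq_imp_eq) (simp_all add: nrm_squared power_mult_distrib dot_vscale dot_vscale_right, simp add: power2_eq_square mult.assoc)

lemma nrm_basis: "i < n \<Longrightarrow> nrm n (basis n i) = 1"
  by (rule power2_eq_imp_eq) (simp_all add: nrm_squared dot_basis, simp add: basis_def)

lemma nrm_eq_0_iff: "x \<in> Rn n \<Longrightarrow> nrm n x = 0 \<longleftrightarrow> x = vzero n"
  by (auto simp: L2_set_eq_0_iff vzero_def intro: Rn_eqI)

lemma abs_dot_le: "\<bar>dot n x y\<bar> \<le> nrm n x * nrm n y"
proof -
  have "\<bar>dot n x y\<bar> \<le> (\<Sum>i<n. \<bar>x i\<bar> * \<bar>y i\<bar>)"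
    unfolding dot_def abs_mult[symmetric] by (rule sum_abs)
  then show ?thesis using L2_set_mult_ineq[of x y "{..<n}"] by simp
qed

lemma abs_component_le_nrm: "i < n \<Longrightarrow> \<bar>x i\<bar> \<le> nrm n x"
  using abs_dot_le[of n x "basis n i"] by (simp add: dot_basis nrm_basis)

lemma nrm_measurable[measurable]: "nrm n \<in> borel_measurable (lebn n)"
  unfolding L2_set_def[abs_def] by measurable

lemma unit_ball_sets[measurable]: "unit_ball n \<in> sets (lebn n)"
proof -
  have "{x \<in> space (lebn n). nrm n x \<le> 1} \<in> sets (lebn n)" by measurable
  then show ?thesis by (simp add: unit_ball_def space_lebn)
qed

lemma vscale_vscale: "vscale n a (vscale n b x) = vscale n (a * b) x"
  by (simp add: vscale_def restrict_def fun_eq_iff mult.assoc)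

lemma vscale_one: "x \<in> Rn n \<Longrightarrow> vscale n 1 x = x"
  by (rule Rn_eqI[of _ n]) (auto simp: vscale_def)

lemma symmetric_nI:
  assumes "A \<subseteq> Rn n" "\<And>x. x \<in> A \<Longrightarrow> vscale n (-1) x \<in> A"
  shows "symmetric_n n A"
  unfolding symmetric_n_def
proof (intro equalityI subsetI)
  fix x assume "x \<in> A"
  then show "x \<in> vscale n (-1) ` A"
    using assms by (intro image_eqI[of _ _ "vscale n (-1) x"]) (auto simp: vscale_vscale vscale_one)
qed (use assms in auto)

lemma symmetric_unit_ball: "symmetric_n n (unit_ball n)"
  by (rule symmetric_nI) (auto simp: unit_ball_def nrm_vscale)

section \<open>Cubes, dilations and the volume of the unit ball\<close>

definition cube :: "nat \<Rightarrow> real \<Rightarrow> (nat \<Rightarrow> real) set" where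
  "cube n r = PiE {..<n} (\<lambda>_. {-r..r})"

lemma cube_sets[measurable]: "cube n r \<in> sets (lebn n)"
  unfolding cube_def lebn_def by (rule sets_PiM_I_finite) auto

lemma emeasure_cube: "0 \<le> r \<Longrightarrow> emeasure (lebn n) (cube n r) = ennreal ((2 * r) ^ n)"
  unfolding cube_def lebn_def
  by (subst lborel_product.emeasure_PiM) (auto simp: ennreal_power)

lemma symmetric_cube: "symmetric_n n (cube n r)"
  by (rule symmetric_nI) (auto simp: cube_def Rn_def vscale_def PiE_iff extensional_def minus_le_iff)

lemma mem_cubeI: "x \<in> Rn n \<Longrightarrow> nrm n x \<le> r \<Longrightarrow> x \<in> cube n r"
  using abs_component_le_nrm[of _ n x] by (force simp: cube_def Rn_def abs_le_iff PiE_iff)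

lemma linear_vscale: "linear_n n (vscale n r)"
  unfolding linear_n_def
  by (intro conjI funcsetI ballI allI vscale_in) (auto simp: vscale_def vadd_def restrict_def fun_eq_iff algebra_simps)

lemma bij_vscale:
  assumes "r \<noteq> 0"
  shows "bij_betw (vscale n r) (Rn n) (Rn n)"
  by (rule bij_betwI[where g = "vscale n (1 / r)"]) (use assms in \<open>auto simp: vscale_vscale vscale_one\<close>)

lemma vscale_image_cube:
  assumes "0 < r"
  shows "vscale n r ` cube n s = cube n (r * s)"
proof (intro equalityI subsetI)
  fix x assume x: "x \<in> cube n (r * s)"
  then have "\<And>i. i < n \<Longrightarrow> - s \<le> (1 / r) * x i" "\<And>i. i < n \<Longrightarrow> (1 / r) * x i \<le> s"
    using assms by (auto simp: cube_def PiE_iff field_simps)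
  then have "vscale n (1 / r) x \<in> cube n s"
    by (auto simp: cube_def vscale_def)
  moreover have "x = vscale n r (vscale n (1 / r) x)"
    using assms x by (simp add: vscale_vscale vscale_one cube_def Rn_def PiE_iff)
  ultimately show "x \<in> vscale n r ` cube n s" by blast
next
  fix x assume "x \<in> vscale n r ` cube n s"
  then obtain y where y: "y \<in> cube n s" "x = vscale n r y" by auto
  have "- (r * s) \<le> r * y i \<and> r * y i \<le> r * s" if "i < n" for i
    using y(1) that mult_left_mono[of "- s" "y i" r] mult_left_mono[of "y i" s r] assms by (auto simp: cube_def PiE_iff)
  then show "x \<in> cube n (r * s)" by (auto simp: y(2) cube_def vscale_def)
qed

text \<open>The cube has an explicit volume before and after dilation, which determines the factor
  in \<open>emeasure_linear_image\<close>.\<close>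

lemma emeasure_vscale_image:
  assumes A[measurable]: "A \<in> sets (lebn n)" and r: "0 < r"
  shows "emeasure (lebn n) (vscale n r ` A) = ennreal (r ^ n) * emeasure (lebn n) A"
proof -
  have "emeasure (lebn n) (vscale n r ` A) * ennreal (2 ^ n) = emeasure (lebn n) A * ennreal ((2 * r) ^ n)"
    using emeasure_linear_image(2)[OF linear_vscale bij_vscale A cube_sets[of n 1] symmetric_cube] r
    by (simp add: vscale_image_cube emeasure_cube)
  also have "\<dots> = (ennreal (r ^ n) * emeasure (lebn n) A) * ennreal (2 ^ n)"
    using r by (simp add: power_mult_distrib ennreal_mult mult_ac)
  finally show ?thesis by (simp add: ennreal_mult_cancel_left mult.commute[of _ "ennreal (2 ^ n)"])
qed

lemma cube_subset_unit_ball: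
  assumes "1 \<le> n"
  shows "cube n (1 / sqrt n) \<subseteq> unit_ball n"
proof
  fix x assume x: "x \<in> cube n (1 / sqrt n)"
  have "(x i)\<^sup>2 \<le> 1 / n" if "i < n" for i
  proof -
    have "- (1 / sqrt n) \<le> x i" "x i \<le> 1 / sqrt n" using x that by (auto simp: cube_def PiE_iff)
    then have "\<bar>x i\<bar> \<le> 1 / sqrt n" by (simp add: abs_le_iff)
    then have "\<bar>x i\<bar>\<^sup>2 \<le> (1 / sqrt n)\<^sup>2" by (rule power_mono) simp
    then show ?thesis by (simp add: power_divide)
  qed
  then have "(\<Sum>i<n. (x i)\<^sup>2) \<le> (\<Sum>i<n. 1 / n)" by (intro sum_mono) auto
  then have "nrm n x \<le> 1" using assms by (simp add: L2_set_def)
  with x show "x \<in> unit_ball n" by (auto simp: unit_ball_def cube_def Rn_def PiE_iff)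
qed

text \<open>The inscribed cube of half-side 1 / sqrt n is where the bound sqrt n / 2 for
  Vol(D_n)^(-1/n) comes from.\<close>

lemma emeasure_unit_ball:
  assumes "1 \<le> n"
  shows "ennreal ((2 / sqrt n) ^ n) \<le> emeasure (lebn n) (unit_ball n)" "emeasure (lebn n) (unit_ball n) < top"
proof -
  show "ennreal ((2 / sqrt n) ^ n) \<le> emeasure (lebn n) (unit_ball n)"
    using emeasure_mono[OF cube_subset_unit_ball[OF assms], of "lebn n"] assms by (simp add: emeasure_cube)
  have "emeasure (lebn n) (unit_ball n) \<le> emeasure (lebn n) (cube n 1)"
    by (rule emeasure_mono) (auto simp: unit_ball_def intro: mem_cubeI)
  then show "emeasure (lebn n) (unit_ball n) < top"
    by (simp add: emeasure_cube) (metis ennreal_less_top le_less_trans)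
qed

text \<open>Links the topology in which bodies are compact to the sigma-algebra in which they are
  measured: boxes with rational endpoints form a countable base.\<close>

lemma openin_topn_sets:
  assumes "openin (topn n) U"
  shows "U \<in> sets (lebn n)"
proof -
  define box where "box = (\<lambda>f :: nat \<Rightarrow> rat \<times> rat. PiE {..<n} (\<lambda>i. {real_of_rat (fst (f i)) <..< real_of_rat (snd (f i))}))"
  \<comment> \<open>Extensionality keeps the index set countable: only the coordinates below
    \<open>n\<close> carry a choice.\<close>
  define F where "F = {f \<in> PiE {..<n} (\<lambda>_. UNIV). box f \<subseteq> U}"
  have "countable (PiE {..<n} (\<lambda>_. UNIV :: (rat \<times> rat) set))"
    by (rule countable_PiE) auto
  then have "countable F" by (rule countable_subset[rotated]) (auto simp: F_def)
  have "U = (\<Union>f\<in>F. box f)"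
  proof (intro equalityI subsetI)
    fix x assume x: "x \<in> U"
    obtain V where V: "\<And>i. i < n \<Longrightarrow> open (V i)" "x \<in> PiE {..<n} V" "PiE {..<n} V \<subseteq> U"
      using assms x unfolding topn_def openin_product_topology_alt by (metis lessThan_iff open_openin)
    have "\<exists>ab :: rat \<times> rat. x i \<in> {real_of_rat (fst ab) <..< real_of_rat (snd ab)} \<and>
        {real_of_rat (fst ab) <..< real_of_rat (snd ab)} \<subseteq> V i" if i: "i < n" for i
    proof -
      have "x i \<in> V i" using V(2) i by auto
      then obtain e where e: "0 < e" "ball (x i) e \<subseteq> V i" using V(1)[OF i] by (auto simp: open_contains_ball)
      obtain a where a: "x i - e < real_of_rat a" "real_of_rat a < x i" using of_rat_dense[of "x i - e" "x i"] e(1) by auto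
      obtain b where b: "x i < real_of_rat b" "real_of_rat b < x i + e" using of_rat_dense[of "x i" "x i + e"] e(1) by auto
      have "{real_of_rat a <..< real_of_rat b} \<subseteq> ball (x i) e" using a b by (auto simp: dist_real_def)
      then show ?thesis using a b e by (intro exI[of _ "(a, b)"]) auto
    qed
    then obtain f :: "nat \<Rightarrow> rat \<times> rat" where f: "\<And>i. i < n \<Longrightarrow> x i \<in> {real_of_rat (fst (f i)) <..< real_of_rat (snd (f i))}"
      "\<And>i. i < n \<Longrightarrow> {real_of_rat (fst (f i)) <..< real_of_rat (snd (f i))} \<subseteq> V i"
      by metis
    have "box (restrict f {..<n}) \<subseteq> PiE {..<n} V"
      unfolding box_def using f(2) by (intro PiE_mono) auto
    moreover have "x \<in> box (restrict f {..<n})"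
      using f(1) V(2) by (auto simp: box_def PiE_iff)
    ultimately show "x \<in> (\<Union>f\<in>F. box f)"
      using V(3) by (intro UN_I[of "restrict f {..<n}"]) (auto simp: F_def simp del: restrict_apply)
  qed (auto simp: F_def)
  moreover have "box f \<in> sets (lebn n)" for f
    unfolding box_def lebn_def by (rule sets_PiM_I_finite) auto
  then have "(\<Union>f\<in>F. box f) \<in> sets (lebn n)"
    using \<open>countable F\<close> by (intro sets.countable_UN') auto
  ultimately show ?thesis by simp
qed

lemma compactin_topn:
  assumes K: "compactin (topn n) K"
  shows "K \<in> sets (lebn n)" "K \<subseteq> Rn n" "\<exists>R>0. \<forall>x\<in>K. nrm n x \<le> R"
proof -
  show sub: "K \<subseteq> Rn n" using compactin_subset_topspace[OF K] by (simp add: topspace_topn)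
  have "Hausdorff_space (topn n)"
    unfolding topn_def Hausdorff_space_product_topology by (simp add: Hausdorff_space_euclidean)
  then have "closedin (topn n) K" using K by (rule compactin_imp_closedin)
  then have "openin (topn n) (Rn n - K)" by (simp add: closedin_def topspace_topn)
  then have "Rn n - K \<in> sets (lebn n)" by (rule openin_topn_sets)
  then have "Rn n - (Rn n - K) \<in> sets (lebn n)" by (rule sets.Diff[OF Rn_sets])
  moreover have "Rn n - (Rn n - K) = K" using sub by auto
  ultimately show "K \<in> sets (lebn n)" by simp
  have "\<exists>R. \<forall>x\<in>K. \<bar>x i\<bar> \<le> R" if i: "i < n" for i
  proof -
    have "continuous_map (topn n) euclideanreal (\<lambda>x. x i)"
      unfolding topn_def using i by (intro continuous_map_product_projection) auto
    then have "compactin euclideanreal ((\<lambda>x. x i) ` K)" using K by (rule image_compactin[rotated])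
    then have "bounded ((\<lambda>x. x i) ` K)" by (simp add: compact_imp_bounded)
    then show ?thesis by (auto simp: bounded_iff)
  qed
  then obtain R where R: "\<And>i x. i < n \<Longrightarrow> x \<in> K \<Longrightarrow> \<bar>x i\<bar> \<le> R i" by metis
  show "\<exists>R>0. \<forall>x\<in>K. nrm n x \<le> R"
  proof (intro exI[of _ "\<bar>\<Sum>i<n. R i\<bar> + 1"] conjI ballI)
    fix x assume "x \<in> K"
    then have "nrm n x \<le> (\<Sum>i<n. R i)"
      using L2_set_le_sum_abs[of x "{..<n}"] sum_mono[of "{..<n}" "\<lambda>i. \<bar>x i\<bar>" R] R by fastforce
    then show "nrm n x \<le> \<bar>\<Sum>i<n. R i\<bar> + 1" by linarith
  qed auto
qed

section \<open>Adjoints and similarities\<close>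

definition adj :: "nat \<Rightarrow> ((nat \<Rightarrow> real) \<Rightarrow> nat \<Rightarrow> real) \<Rightarrow> (nat \<Rightarrow> real) \<Rightarrow> nat \<Rightarrow> real" where
  "adj n T y = (\<lambda>j\<in>{..<n}. dot n (T (basis n j)) y)"

lemma adj_in[simp]: "adj n T y \<in> Rn n"
  by (simp add: adj_def)

lemma dot_adj:
  assumes "linear_n n T" "x \<in> Rn n"
  shows "dot n (T x) y = dot n x (adj n T y)"
proof -
  have "dot n (T x) y = (\<Sum>i<n. (\<Sum>j<n. x j * T (basis n j) i) * y i)"
    by (subst linear_n_expand[OF assms]) (simp add: dot_def)
  also have "\<dots> = (\<Sum>j<n. \<Sum>i<n. x j * T (basis n j) i * y i)"
    by (subst sum.swap) (simp add: sum_distrib_right)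
  also have "\<dots> = dot n x (adj n T y)"
    by (simp add: dot_def adj_def sum_distrib_left mult.assoc)
  finally show ?thesis .
qed

lemma Rn_eq_dotI:
  assumes "x \<in> Rn n" "y \<in> Rn n" "\<And>z. z \<in> Rn n \<Longrightarrow> dot n x z = dot n y z"
  shows "x = y"
proof (rule Rn_eqI[OF assms(1,2)])
  show "x i = y i" if "i < n" for i
    using assms(3)[of "basis n i"] that by (simp add: dot_basis)
qed

lemma linear_adj: "linear_n n (adj n T)"
  unfolding linear_n_def
proof (intro conjI funcsetI ballI allI adj_in)
  show "adj n T (vadd n x y) = vadd n (adj n T x) (adj n T y)" for x y
    by (rule Rn_eqI[of _ n]) (simp_all add: adj_def dot_vadd_right, simp add: vadd_def)
  show "adj n T (vscale n a x) = vscale n a (adj n T x)" for a x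
    by (rule Rn_eqI[of _ n]) (simp_all add: adj_def dot_vscale_right, simp add: vscale_def)
qed

lemma nrm_scaled_of_sphere:
  assumes T: "linear_n n T" and c: "\<And>\<theta>. \<theta> \<in> unit_sphere n \<Longrightarrow> (nrm n (T \<theta>))\<^sup>2 = c" and x: "x \<in> Rn n"
  shows "(nrm n (T x))\<^sup>2 = c * (nrm n x)\<^sup>2"
proof (cases "nrm n x = 0")
  case True
  then have "x = vscale n 0 x" using x nrm_eq_0_iff[OF x] by (simp add: vscale_def vzero_def)
  then have "T x = vscale n 0 (T x)" using linear_nD(3)[OF T x, of 0] by simp
  then have "nrm n (T x) = 0" using nrm_vscale[of n 0 "T x"] by simp
  with True show ?thesis by simp
next
  case False
  let ?y = "vscale n (1 / nrm n x) x"
  have "?y \<in> unit_sphere n" using False by (simp add: unit_sphere_def nrm_vscale)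
  then have "(nrm n (vscale n (1 / nrm n x) (T x)))\<^sup>2 = c" using c linear_nD(3)[OF T x] by metis
  then show ?thesis using False by (simp add: nrm_vscale power_mult_distrib power_divide field_simps)
qed

text \<open>Polarization: expand the squared norm of the image of x + y.\<close>

lemma conformal_dot:
  assumes T: "linear_n n T" and c: "\<And>x. x \<in> Rn n \<Longrightarrow> (nrm n (T x))\<^sup>2 = c * (nrm n x)\<^sup>2"
    and x: "x \<in> Rn n" and y: "y \<in> Rn n"
  shows "dot n (T x) (T y) = c * dot n x y"
proof -
  have "dot n (vadd n (T x) (T y)) (vadd n (T x) (T y)) = c * dot n (vadd n x y) (vadd n x y)"
    using c[of "vadd n x y"] linear_nD(2)[OF T x y] by (simp add: nrm_squared)
  moreover have "dot n (T x) (T x) = c * dot n x x" "dot n (T y) (T y) = c * dot n y y"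
    using c[OF x] c[OF y] by (simp_all add: nrm_squared)
  ultimately show ?thesis
    by (simp add: dot_vadd dot_vadd_right dot_commute[of n "T y" "T x"] dot_commute[of n y x] distrib_left)
qed

text \<open>From \<open>T T\<^sup>* = c\<close> and injectivity of \<open>T\<close> one gets \<open>T\<^sup>* T = c\<close>.\<close>

lemma conformal_of_adj:
  assumes T: "linear_n n T" and inj: "inj_on T (Rn n)"
    and c: "\<And>x. x \<in> Rn n \<Longrightarrow> (nrm n (adj n T x))\<^sup>2 = c * (nrm n x)\<^sup>2"
    and x: "x \<in> Rn n"
  shows "(nrm n (T x))\<^sup>2 = c * (nrm n x)\<^sup>2"
proof -
  have TT: "T (adj n T y) = vscale n c y" if y: "y \<in> Rn n" for y
  proof (rule Rn_eq_dotI[of _ n])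
    fix z assume z: "z \<in> Rn n"
    have "dot n (T (adj n T y)) z = dot n (adj n T y) (adj n T z)" by (rule dot_adj[OF T]) simp
    also have "\<dots> = c * dot n y z" by (rule conformal_dot[OF linear_adj c y z])
    finally show "dot n (T (adj n T y)) z = dot n (vscale n c y) z" by (simp add: dot_vscale)
  qed (auto intro: linear_nD(1)[OF T])
  have "T (adj n T (T x)) = T (vscale n c x)"
    using TT[OF linear_nD(1)[OF T x]] linear_nD(3)[OF T x] by simp
  then have "adj n T (T x) = vscale n c x" using inj by (auto dest: inj_onD)
  then have "dot n (T x) (T x) = c * dot n x x" using dot_adj[OF T x, of "T x"] by (simp add: dot_vscale_right)
  then show ?thesis by (simp add: nrm_squared)
qed

lemma conformal_image_unit_ball:
  assumes T: "linear_n n T" and im: "T ` Rn n = Rn n" and r: "0 < r"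
    and c: "\<And>x. x \<in> Rn n \<Longrightarrow> nrm n (T x) = r * nrm n x"
  shows "T ` unit_ball n = vscale n r ` unit_ball n"
proof (intro equalityI subsetI)
  fix y assume "y \<in> T ` unit_ball n"
  then obtain x where x: "x \<in> Rn n" "nrm n x \<le> 1" "y = T x" by (auto simp: unit_ball_def)
  have "y = vscale n r (vscale n (1 / r) y)"
    using r x linear_nD(1)[OF T] by (simp add: vscale_vscale vscale_one)
  moreover have "vscale n (1 / r) y \<in> unit_ball n"
    using r x c by (simp add: unit_ball_def nrm_vscale)
  ultimately show "y \<in> vscale n r ` unit_ball n" by blast
next
  fix y assume "y \<in> vscale n r ` unit_ball n"
  then obtain z where z: "z \<in> Rn n" "nrm n z \<le> 1" "y = vscale n r z" by (auto simp: unit_ball_def)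
  obtain x where x: "x \<in> Rn n" "T x = y" using im z by (metis imageE vscale_in)
  have "r * nrm n x = r * nrm n z" using c[OF x(1)] x z r by (simp add: nrm_vscale)
  then have "x \<in> unit_ball n" using x z r by (simp add: unit_ball_def)
  with x show "y \<in> T ` unit_ball n" by blast
qed

lemma isotropic_moment:
  assumes iso: "isotropic_position n K" and n: "1 \<le> n" and y: "y \<in> Rn n"
  shows "(LINT x:K|lebn n. (dot n x y)\<^sup>2) = second_moment n K (basis n 0) * (nrm n y)\<^sup>2"
proof (cases "nrm n y = 0")
  case True
  then have "dot n x y = 0" for x using abs_dot_le[of n x y] by simp
  with True show ?thesis by (simp add: set_lebesgue_integral_def)
next
  case False
  let ?t = "vscale n (1 / nrm n y) y"
  have t: "?t \<in> unit_sphere n" using False by (simp add: unit_sphere_def nrm_vscale)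
  have b: "basis n 0 \<in> unit_sphere n" using n by (simp add: unit_sphere_def nrm_basis)
  have "second_moment n K (basis n 0) = second_moment n K ?t" using iso t b unfolding isotropic_position_def by blast
  also have "\<dots> = (LINT x:K|lebn n. (1 / nrm n y)\<^sup>2 * (dot n x y)\<^sup>2)"
    by (simp only: second_moment_def dot_vscale_right power_mult_distrib)
  also have "\<dots> = (1 / nrm n y)\<^sup>2 * (LINT x:K|lebn n. (dot n x y)\<^sup>2)"
    by (simp only: set_integral_mult_right)
  finally show ?thesis using False by (simp add: field_simps)
qed

text \<open>\<open>K\<close> and the unit ball both have volume \<open>v\<close>, so an image of
  \<open>K\<close> of volume 1 forces the image of the ball to have volume 1, and \<open>T\<close>
  multiplies volumes by 1 / v. Moving \<open>T\<close> to the other side of the inner product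
  expresses the moments of the image through those of \<open>K\<close>.\<close>

lemma second_moment_image:
  assumes n: "1 \<le> n" and K[measurable]: "K \<in> sets (lebn n)" and v: "emeasure (lebn n) K = ennreal v" "0 < v"
    and ball: "emeasure (lebn n) (unit_ball n) = ennreal v"
    and iso: "isotropic_position n K"
    and T: "linear_n n T" and bij: "bij_betw T (Rn n) (Rn n)" and vol: "vol n (T ` K) = 1" and y: "y \<in> Rn n"
  shows "second_moment n (T ` K) y = second_moment n K (basis n 0) / v * (nrm n (adj n T y))\<^sup>2"
    and "emeasure (lebn n) (T ` unit_ball n) = 1"
proof -
  let ?S = "the_inv_into (Rn n) T"
  have "emeasure (lebn n) (T ` K) = 1"
    using vol unfolding vol_def measure_def by (cases "emeasure (lebn n) (T ` K)") auto
  then have "ennreal v * 1 = ennreal v * emeasure (lebn n) (T ` unit_ball n)"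
    using emeasure_linear_image(2)[OF T bij K unit_ball_sets symmetric_unit_ball] v ball by simp
  then show TB: "emeasure (lebn n) (T ` unit_ball n) = 1"
    unfolding ennreal_mult_cancel_left using v(2) by auto
  have inj: "inj_on T (Rn n)" and im: "T ` Rn n = Rn n" using bij by (auto simp: bij_betw_def)
  have S: "?S z \<in> Rn n" "T (?S z) = z" if "z \<in> Rn n" for z
    using the_inv_into_into[OF inj, of z "Rn n"] f_the_inv_into_f[OF inj, of z] that im by auto
  have ST: "?S (T x) = x" if "x \<in> Rn n" for x using the_inv_into_f_f[OF inj that] .
  have Sm[measurable]: "?S \<in> measurable (lebn n) (lebn n)"
    by (rule linear_n_measurable[OF linear_n_inverse[OF T bij]])
  have Ksub: "K \<subseteq> Rn n" using sets.sets_into_space[OF K] by (simp add: space_lebn)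
  \<comment> \<open>This is the change of variables formula for \<open>T\<close>, with the Jacobian
    factor read off from the ball.\<close>
  have distr: "distr (lebn n) (lebn n) ?S = density (lebn n) (\<lambda>_. ennreal (1 / v))"
  proof (rule measure_eqI)
    fix A assume "A \<in> sets (distr (lebn n) (lebn n) ?S)"
    then have A[measurable]: "A \<in> sets (lebn n)" by simp
    have Asub: "A \<subseteq> Rn n" using sets.sets_into_space[OF A] by (simp add: space_lebn)
    have "?S -` A \<inter> space (lebn n) = T ` A"
      using S ST Asub linear_nD(1)[OF T] by (auto simp: space_lebn) (metis image_eqI)
    then have "emeasure (distr (lebn n) (lebn n) ?S) A * ennreal v = emeasure (lebn n) A"
      using emeasure_linear_image(2)[OF T bij A unit_ball_sets symmetric_unit_ball] TB ball
      by (simp add: emeasure_distr)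
    moreover have "ennreal v * ennreal (1 / v) = 1" using v(2) by (simp flip: ennreal_mult)
    ultimately have "emeasure (distr (lebn n) (lebn n) ?S) A = emeasure (lebn n) A * ennreal (1 / v)"
      by (metis mult.assoc mult.right_neutral)
    then show "emeasure (distr (lebn n) (lebn n) ?S) A = emeasure (density (lebn n) (\<lambda>_. ennreal (1 / v))) A"
      by (simp add: emeasure_density_const mult.commute)
  qed simp
  define g where "g = (\<lambda>x. indicator K x * (dot n x (adj n T y))\<^sup>2 :: real)"
  have g[measurable]: "g \<in> borel_measurable (lebn n)" unfolding g_def by measurable
  have "second_moment n (T ` K) y = (LINT z|lebn n. g (?S z))"
    unfolding second_moment_def set_lebesgue_integral_def
  proof (rule Bochner_Integration.integral_cong[OF refl])
    fix z assume "z \<in> space (lebn n)"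
    then have z: "z \<in> Rn n" by (simp add: space_lebn)
    have "z \<in> T ` K \<longleftrightarrow> ?S z \<in> K" 
    proof
      assume "z \<in> T ` K"
      then obtain x where "x \<in> K" "z = T x" by blast
      then show "?S z \<in> K" using ST[of x] Ksub by auto
    next
      assume "?S z \<in> K"
      then have "T (?S z) \<in> T ` K" by (rule imageI)
      then show "z \<in> T ` K" by (simp only: S(2)[OF z])
    qed
    moreover have "dot n z y = dot n (?S z) (adj n T y)" using dot_adj[OF T S(1)[OF z], of y] S(2)[OF z] by simp
    ultimately show "indicat_real (T ` K) z *\<^sub>R (dot n z y)\<^sup>2 = g (?S z)"
      by (simp add: g_def indicator_def)
  qed
  also have "\<dots> = (LINT x|distr (lebn n) (lebn n) ?S. g x)" by (rule integral_distr[symmetric]) measurable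
  also have "\<dots> = (LINT x|lebn n. (1 / v) *\<^sub>R g x)"
    unfolding distr by (rule integral_density) (use v in auto)
  also have "\<dots> = (1 / v) * (LINT x:K|lebn n. (dot n x (adj n T y))\<^sup>2)"
    by (simp add: g_def set_lebesgue_integral_def)
  also have "\<dots> = second_moment n K (basis n 0) / v * (nrm n (adj n T y))\<^sup>2"
    by (simp add: isotropic_moment[OF iso n])
  finally show "second_moment n (T ` K) y = second_moment n K (basis n 0) / v * (nrm n (adj n T y))\<^sup>2" .
qed

text \<open>A set of positive volume is not contained, up to a null set, in the hyperplane x_0 = 0.
  Boundedness supplies integrability, without which the Bochner integral would be 0 by
  convention.\<close>

lemma second_moment_pos:
  assumes n: "1 \<le> n" and K[measurable]: "K \<in> sets (lebn n)" and v: "emeasure (lebn n) K = ennreal v" "0 < v"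
    and R: "\<And>x. x \<in> K \<Longrightarrow> nrm n x \<le> R"
  shows "0 < second_moment n K (basis n 0)"
proof -
  let ?f = "\<lambda>x. indicator K x * (dot n x (basis n 0))\<^sup>2 :: real"
  have int: "integrable (lebn n) ?f"
  proof (rule Bochner_Integration.integrable_bound)
    show "integrable (lebn n) (\<lambda>x. indicator K x * R\<^sup>2 :: real)"
      using v by (intro integrable_mult_indicator integrable_mult_left integrable_real_indicator) auto
    have "(dot n x (basis n 0))\<^sup>2 \<le> R\<^sup>2" if "x \<in> K" for x
      using abs_dot_le[of n x "basis n 0"] R[OF that] n nrm_basis[of 0 n] by (simp add: abs_le_square_iff[symmetric])
    then show "AE x in lebn n. norm (?f x) \<le> norm (indicator K x * R\<^sup>2 :: real)"
      by (auto split: split_indicator)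
  qed measurable
  have sm: "second_moment n K (basis n 0) = (LINT x|lebn n. ?f x)"
    by (simp add: second_moment_def set_lebesgue_integral_def)
  moreover have "(LINT x|lebn n. ?f x) \<noteq> 0"
  proof
    assume "(LINT x|lebn n. ?f x) = 0"
    then have "AE x in lebn n. ?f x = 0" using int by (subst (asm) integral_nonneg_eq_0_iff_AE) auto
    then have "AE x in lebn n. x \<notin> K \<or> x 0 = 0"
      by (rule AE_mp) (use n in \<open>auto intro!: AE_I2 simp: dot_basis split: split_indicator_asm\<close>)
    moreover have "AE x in lebn n. x 0 \<noteq> 0"
    proof (rule AE_I)
      let ?N = "PiE {..<n} (\<lambda>i. if i = 0 then {0::real} else UNIV)"
      show "?N \<in> sets (lebn n)" unfolding lebn_def by (rule sets_PiM_I_finite) auto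
      show "emeasure (lebn n) ?N = 0"
        unfolding lebn_def by (subst lborel_product.emeasure_PiM) (use n in \<open>auto intro!: bexI[of _ 0] simp: prod_zero_iff\<close>)
      show "{x \<in> space (lebn n). \<not> x 0 \<noteq> 0} \<subseteq> ?N" by (auto simp: space_lebn Rn_def PiE_iff extensional_def)
    qed
    ultimately have "AE x in lebn n. x \<notin> K" by eventually_elim auto
    then have "emeasure (lebn n) K = 0" by (subst (asm) AE_iff_measurable[OF K]) (use sets.sets_into_space[OF K] in auto)
    with v show False by simp
  qed
  moreover have "0 \<le> (LINT x|lebn n. ?f x)" by (rule Bochner_Integration.integral_nonneg) simp
  ultimately show ?thesis by linarith
qed

text \<open>The dilation by r = v^(-1/n) shows that the described number exists. For uniqueness,
  constancy of the second moments of the image on the sphere says that the adjoint of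
  \<open>T\<close> is a similarity; then so is \<open>T\<close>, it maps the unit ball to a ball,
  and volume 1 forces its ratio to be r again.\<close>

lemma isotropic_const_eq:
  assumes n: "1 \<le> n" and K[measurable]: "K \<in> sets (lebn n)" and v: "emeasure (lebn n) K = ennreal v" "0 < v"
    and R: "\<And>x. x \<in> K \<Longrightarrow> nrm n x \<le> R"
    and ball: "emeasure (lebn n) (unit_ball n) = ennreal v"
    and iso: "isotropic_position n K"
  shows "isotropic_const n K = sqrt (second_moment n K (basis n 0) / v) * v powr (- 1 / n)"
proof -
  let ?m = "second_moment n K (basis n 0)"
  have m: "0 < ?m" by (rule second_moment_pos[OF n K v R])
  define r where "r = v powr (- 1 / n)"
  have r: "0 < r" using v by (simp add: r_def)
  have "r ^ n = v powr (- 1)" using n v(2) by (simp add: r_def flip: powr_realpow) (simp add: powr_powr)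
  then have rn: "r ^ n * v = 1" using v(2) by (simp add: powr_minus)
  have b: "basis n 0 \<in> unit_sphere n" using n by (simp add: unit_sphere_def nrm_basis)
  have "isotropic_const n K = sqrt (?m / v) * r"
    unfolding isotropic_const_def
  proof (rule the_equality)
    have vol: "vol n (vscale n r ` K) = 1"
      using v(2) r rn by (simp add: vol_def measure_def emeasure_vscale_image v(1) flip: ennreal_mult)
    have bij: "bij_betw (vscale n r) (Rn n) (Rn n)" using r by (intro bij_vscale) simp
    have "nrm n (adj n (vscale n r) y) = r" if "y \<in> unit_sphere n" for y
    proof -
      have y: "y \<in> Rn n" "nrm n y = 1" using that by (auto simp: unit_sphere_def)
      have "adj n (vscale n r) y = vscale n r y"
        using y(1) by (intro Rn_eqI[of _ n]) (simp_all add: adj_def dot_vscale dot_commute[of n "basis n _"] dot_basis, simp add: vscale_def)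
      then show ?thesis using y r by (simp add: nrm_vscale)
    qed
    then have sm: "second_moment n (vscale n r ` K) y = (sqrt (?m / v) * r)\<^sup>2" if "y \<in> unit_sphere n" for y
      using second_moment_image(1)[OF n K v ball iso linear_vscale bij vol, of y] that m v(2)
      by (simp add: unit_sphere_def power_mult_distrib)
    show "0 \<le> sqrt (?m / v) * r \<and> (\<exists>T. linear_n n T \<and> bij_betw T (Rn n) (Rn n) \<and> vol n (T ` K) = 1 \<and>
        isotropic_position n (T ` K) \<and> (\<forall>\<theta>\<in>unit_sphere n. second_moment n (T ` K) \<theta> = (sqrt (?m / v) * r)\<^sup>2))"
      using m v(2) r vol bij linear_vscale sm
      by (intro conjI exI[of _ "vscale n r"]) (auto simp: isotropic_position_def)
  next
    fix l assume "0 \<le> l \<and> (\<exists>T. linear_n n T \<and> bij_betw T (Rn n) (Rn n) \<and> vol n (T ` K) = 1 \<and>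
        isotropic_position n (T ` K) \<and> (\<forall>\<theta>\<in>unit_sphere n. second_moment n (T ` K) \<theta> = l\<^sup>2))"
    then obtain T where l: "0 \<le> l" and T: "linear_n n T" "bij_betw T (Rn n) (Rn n)" "vol n (T ` K) = 1"
      and sm: "\<And>\<theta>. \<theta> \<in> unit_sphere n \<Longrightarrow> second_moment n (T ` K) \<theta> = l\<^sup>2" by blast
    \<comment> \<open>The squared ratio of the similarity, solved from l^2 = (?m / v) c.\<close>
    define c where "c = l\<^sup>2 * v / ?m"
    have inj: "inj_on T (Rn n)" and im: "T ` Rn n = Rn n" using T(2) by (auto simp: bij_betw_def)
    have "(nrm n (adj n T y))\<^sup>2 = c" if "y \<in> unit_sphere n" for y
      using second_moment_image(1)[OF n K v ball iso T, of y] sm[OF that] that m v(2)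
      by (simp add: unit_sphere_def c_def field_simps)
    then have "(nrm n (adj n T y))\<^sup>2 = c * (nrm n y)\<^sup>2" if "y \<in> Rn n" for y
      using nrm_scaled_of_sphere[OF linear_adj _ that] by blast
    then have Tc: "(nrm n (T x))\<^sup>2 = c * (nrm n x)\<^sup>2" if "x \<in> Rn n" for x
      using conformal_of_adj[OF T(1) inj _ that] by blast
    \<comment> \<open>With ratio 0 the map \<open>T\<close> would send both a basis vector and 0 to
      0, against injectivity.\<close>
    have "0 < c"
    proof (rule ccontr)
      assume "\<not> 0 < c"
      moreover have "0 \<le> c" using v(2) m by (simp add: c_def)
      ultimately have c0: "c = 0" by simp
      have "T (basis n 0) = vzero n"
        using Tc[of "basis n 0"] linear_nD(1)[OF T(1)] by (simp add: c0 nrm_eq_0_iff)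
      moreover have "T (vzero n) = vzero n"
        using Tc[of "vzero n"] linear_nD(1)[OF T(1)] by (simp add: c0 nrm_eq_0_iff)
      ultimately have "basis n 0 = vzero n" using inj by (metis inj_onD basis_in vzero_in)
      then show False using nrm_basis[of 0 n] nrm_eq_0_iff[of "vzero n" n] n by simp
    qed
    have "nrm n (T x) = sqrt c * nrm n x" if "x \<in> Rn n" for x
    proof (rule power2_eq_imp_eq)
      show "(nrm n (T x))\<^sup>2 = (sqrt c * nrm n x)\<^sup>2"
        unfolding Tc[OF that] power_mult_distrib using \<open>0 < c\<close> by simp
    qed (use \<open>0 < c\<close> in simp_all)
    then have "T ` unit_ball n = vscale n (sqrt c) ` unit_ball n"
      using \<open>0 < c\<close> by (intro conformal_image_unit_ball[OF T(1) im]) auto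
    then have "ennreal (sqrt c ^ n) * ennreal v = 1"
      using second_moment_image(2)[OF n K v ball iso T vzero_in] ball
        emeasure_vscale_image[OF unit_ball_sets, of "sqrt c" n] \<open>0 < c\<close> by simp
    then have "sqrt c ^ n * v = 1" using v(2) \<open>0 < c\<close> by (simp flip: ennreal_mult)
    then have "sqrt c ^ n = r ^ n" using rn v(2) mult_right_cancel[of v "sqrt c ^ n" "r ^ n"] by simp
    then have "sqrt c = r"
    proof (rule power_eq_imp_eq_base)
      show "0 \<le> sqrt c" "0 \<le> r" "0 < n" using \<open>0 < c\<close> r n by simp_all
    qed
    then have "c = r\<^sup>2" using \<open>0 < c\<close> by (metis real_sqrt_pow2 less_imp_le)
    then have "l\<^sup>2 = ?m / v * r\<^sup>2" using v(2) m by (simp add: c_def field_simps)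
    then show "l = sqrt (?m / v) * r"
      using l r m v(2) by - (rule power2_eq_imp_eq, auto simp: power_mult_distrib)
  qed
  then show ?thesis by (simp add: r_def)
qed

lemma isotropic_const_le:
  assumes n: "1 \<le> n" and K[measurable]: "K \<in> sets (lebn n)" and v: "emeasure (lebn n) K = ennreal v" "0 < v"
    and R: "\<And>x. x \<in> K \<Longrightarrow> nrm n x \<le> R"
    and ball: "emeasure (lebn n) (unit_ball n) = ennreal v"
    and iso: "isotropic_position n K"
  shows "isotropic_const n K \<le> sqrt (second_moment n K (basis n 0) / v) * sqrt n / 2"
proof -
  have "(2 / sqrt n) ^ n \<le> v" using emeasure_unit_ball(1)[OF n] ball v(2) by simp
  then have "((2 / sqrt n) ^ n) powr (1 / n) \<le> v powr (1 / n)" by (intro powr_mono2) auto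
  then have "2 / sqrt n \<le> v powr (1 / n)" using n by (simp add: powr_realpow[symmetric] powr_powr)
  then have "v powr (- 1 / n) \<le> sqrt n / 2"
    using n v(2) by (simp add: powr_minus_divide field_simps)
  then show ?thesis
    using second_moment_pos[OF n K v R] v(2)
    by (subst isotropic_const_eq[OF n K v R ball iso]) (auto intro: mult_left_mono)
qed

section \<open>Log-concave tails\<close>

text \<open>Prekopa-Leindler for three indicator functions. In this multiplicative form
  Brunn-Minkowski yields log-concavity of the volumes of half-space sections of
  \<open>K\<close>.\<close>

lemma brunn_minkowski_midpoint:
  assumes [measurable]: "A \<in> sets (lebn n)" "B \<in> sets (lebn n)" "C \<in> sets (lebn n)"
    and mid: "\<And>x y. x \<in> A \<Longrightarrow> y \<in> B \<Longrightarrow> (\<lambda>i\<in>{..<n}. (x i + y i) / 2) \<in> C"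
  shows "emeasure (lebn n) A * emeasure (lebn n) B \<le> (emeasure (lebn n) C)\<^sup>2"
proof -
  have "(\<integral>\<^sup>+x. indicator A x \<partial>lebn n) * (\<integral>\<^sup>+x. indicator B x \<partial>lebn n) \<le> (\<integral>\<^sup>+x. indicator C x \<partial>lebn n)\<^sup>2"
    unfolding lebn_def
  proof (rule prekopa_leindler)
    show "indicator A x * indicator B y \<le> (indicator C (\<lambda>i\<in>{..<n}. (x i + y i) / 2) :: ennreal)\<^sup>2" for x y
      using mid[of x y] by (auto simp: indicator_def)
  qed (auto simp flip: lebn_def)
  then show ?thesis by simp
qed

text \<open>For q < 1 the full series sums to (1 + q) / (1 - q)^2. Clearing the denominator keeps q
  = 1 admissible, and the partial sums have a closed form in which the subtracted remainder is
  nonnegative.\<close>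

lemma sum_odd_powers_le:
  fixes q :: real
  assumes "0 \<le> q" "q \<le> 1"
  shows "(1 - q)\<^sup>2 * (\<Sum>k<m. (2 * real k + 1) * q ^ k) \<le> 2"
proof -
  have "(1 - q)\<^sup>2 * (\<Sum>k<m. (2 * real k + 1) * q ^ k) = 1 + q - q ^ m * ((2 * real m + 1) - (2 * real m - 1) * q)"
    by (induction m) (simp_all add: power2_eq_square algebra_simps)
  moreover have "0 \<le> q ^ m * ((2 * real m + 1) - (2 * real m - 1) * q)"
  proof (intro mult_nonneg_nonneg)
    have "(2 * real m - 1) * q \<le> 2 * real m + 1"
    \<comment> \<open>For m = 0 the coefficient 2 m - 1 is negative, so q <= 1 cannot be multiplied
      by it.\<close>
    proof (cases m)
      case (Suc k)
      then have "(2 * real m - 1) * q \<le> (2 * real m - 1) * 1" using assms by (intro mult_left_mono) auto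
      then show ?thesis by simp
    qed (use assms in simp)
    then show "0 \<le> (2 * real m + 1) - (2 * real m - 1) * q" by simp
  qed (use assms in simp)
  ultimately show ?thesis using assms by linarith
qed

text \<open>Discrete layer cake: (j + 1)^2 is the sum of the first j + 1 odd numbers, with j the
  integer part of a / t.\<close>

lemma square_le_sum_levels:
  fixes a t :: real
  assumes "0 < t" "0 \<le> a" "a < real m * t"
  shows "a\<^sup>2 \<le> t\<^sup>2 * (\<Sum>k<m. (2 * real k + 1) * (if real k * t \<le> a then 1 else 0))"
proof -
  define j where "j = nat \<lfloor>a / t\<rfloor>"
  have j: "real j \<le> a / t" "a / t < real j + 1" using assms by (auto simp: j_def)
  have jt: "real j * t \<le> a" using j(1) assms(1) by (simp add: field_simps)
  have "j < m"
  proof -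
    have "real j * t < real m * t" using jt assms(3) by linarith
    then show ?thesis using assms(1) by simp
  qed
  have "(\<Sum>k<Suc i. 2 * real k + 1) = (real i + 1)\<^sup>2" for i
    by (induction i) (simp_all add: power2_eq_square algebra_simps)
  then have "(real j + 1)\<^sup>2 = (\<Sum>k<Suc j. 2 * real k + 1)" by simp
  also have "\<dots> = (\<Sum>k<Suc j. (2 * real k + 1) * (if real k * t \<le> a then 1 else 0))"
  proof (rule sum.cong[OF refl])
    fix k assume "k \<in> {..<Suc j}"
    then have "real k * t \<le> real j * t" using assms(1) by (intro mult_right_mono) auto
    then show "2 * real k + 1 = (2 * real k + 1) * (if real k * t \<le> a then 1 else 0)" using jt by simp
  qed
  also have "\<dots> \<le> (\<Sum>k<m. (2 * real k + 1) * (if real k * t \<le> a then 1 else 0))"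
    using \<open>j < m\<close> by (intro sum_mono2) auto
  finally have "(real j + 1)\<^sup>2 \<le> (\<Sum>k<m. (2 * real k + 1) * (if real k * t \<le> a then 1 else 0))" .
  moreover have "(a / t)\<^sup>2 \<le> (real j + 1)\<^sup>2" using j assms by (intro power_mono) auto
  ultimately have "(a / t)\<^sup>2 \<le> (\<Sum>k<m. (2 * real k + 1) * (if real k * t \<le> a then 1 else 0))" by simp
  then have "t\<^sup>2 * (a / t)\<^sup>2 \<le> t\<^sup>2 * (\<Sum>k<m. (2 * real k + 1) * (if real k * t \<le> a then 1 else 0))"
    by (rule mult_left_mono) simp
  then show ?thesis using assms(1) by (simp add: power_divide)
qed

text \<open>Abstracts a linear functional under the uniform distribution on \<open>K\<close>. The
  bound \<open>R\<close> provides integrability and finite sums; the resulting estimates are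
  independent of its size.\<close>

locale symmetric_log_concave = prob_space P for P :: "'a measure" +
  fixes X :: "'a \<Rightarrow> real" and R :: real
  assumes X[measurable]: "X \<in> borel_measurable P"
    and bounded: "AE x in P. \<bar>X x\<bar> \<le> R"
    and symmetric: "\<And>r. prob {x \<in> space P. X x \<le> - r} = prob {x \<in> space P. r \<le> X x}"
    and log_concave: "\<And>r r'. prob {x \<in> space P. r \<le> X x} * prob {x \<in> space P. r' \<le> X x}
       \<le> (prob {x \<in> space P. (r + r') / 2 \<le> X x})\<^sup>2"
begin

text \<open>Let a_k be the probability of X >= k t. Log-concavity makes the ratios a_(k+1) / a_k
  nonincreasing, and the first is at most 2 a_1 = q, because symmetry gives a_0 >= 1/2.\<close>

lemma tail_le:
  assumes t: "0 < t"
  shows "prob {x \<in> space P. real k * t \<le> \<bar>X x\<bar>} \<le> (1 - prob {x \<in> space P. \<bar>X x\<bar> < t}) ^ k"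
proof (cases k)
  case 0
  then show ?thesis by simp
next
  case (Suc i)
  define q where "q = 1 - prob {x \<in> space P. \<bar>X x\<bar> < t}"
  define a where "a = (\<lambda>k :: nat. prob {x \<in> space P. real k * t \<le> X x})"
  have a_nonneg: "0 \<le> a k" for k by (simp add: a_def)
  have a_dec: "a l \<le> a k" if "k \<le> l" for k l
  proof -
    have "real k * t \<le> real l * t" using that t by (intro mult_right_mono) auto
    then show ?thesis unfolding a_def by (intro finite_measure_mono) auto
  qed
  have abs_eq: "prob {x \<in> space P. r \<le> \<bar>X x\<bar>} = 2 * prob {x \<in> space P. r \<le> X x}" if "0 < r" for r
  proof -
    have "prob {x \<in> space P. r \<le> \<bar>X x\<bar>} = prob ({x \<in> space P. r \<le> X x} \<union> {x \<in> space P. X x \<le> - r})"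
      by (rule arg_cong[where f = prob]) (use that in auto)
    also have "\<dots> = prob {x \<in> space P. r \<le> X x} + prob {x \<in> space P. X x \<le> - r}"
      using that by (intro finite_measure_Union) auto
    finally show ?thesis by (simp add: symmetric)
  qed
  \<comment> \<open>Both half-lines contain 0, hence only an inequality follows. The spelling
    \<open>- 0\<close> is what the rewrite rule \<open>symmetric\<close> matches.\<close>
  have "1 = prob ({x \<in> space P. 0 \<le> X x} \<union> {x \<in> space P. X x \<le> - 0})"
    by (subst prob_space[symmetric]) (rule arg_cong[where f = prob], auto)
  also have "\<dots> \<le> prob {x \<in> space P. 0 \<le> X x} + prob {x \<in> space P. X x \<le> - 0}"
    by (intro measure_Un_le) auto
  finally have a0: "1 \<le> 2 * a 0" by (simp add: a_def symmetric del: minus_zero)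
  have "prob {x \<in> space P. t \<le> \<bar>X x\<bar>} = q"
    unfolding q_def by (subst prob_compl[symmetric]) (auto intro!: arg_cong[where f = prob])
  then have a1: "2 * a 1 = q" using abs_eq[OF t] by (simp add: a_def)
  have q0: "0 \<le> q" using a1 a_nonneg[of 1] by simp
  have step: "a (Suc k) \<le> q * a k" for k
  proof (induction k)
    case 0
    have "a 1 * 1 \<le> a 1 * (2 * a 0)" using a0 a_nonneg by (intro mult_left_mono) auto
    then show ?case using a1 by (simp add: mult_ac)
  next
    case (Suc k)
    show ?case
    \<comment> \<open>The factor \<open>a k\<close> is cancelled below; if it vanishes, so do all
      later tails.\<close>
    proof (cases "a k = 0")
      case True
      then show ?thesis using a_dec[of k "Suc (Suc k)"] a_nonneg[of "Suc k"] a_nonneg[of "Suc (Suc k)"] q0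
        by (metis le_SucI mult_nonneg_nonneg order_trans le_refl)
    next
      case False
      have "(real (Suc (Suc k)) * t + real k * t) / 2 = real (Suc k) * t" by (simp add: field_simps)
      then have "a (Suc (Suc k)) * a k \<le> (a (Suc k))\<^sup>2"
        using log_concave[of "real (Suc (Suc k)) * t" "real k * t"] unfolding a_def by metis
      also have "\<dots> \<le> (q * a (Suc k)) * a k"
        using mult_right_mono[OF Suc.IH a_nonneg[of "Suc k"]] by (simp add: power2_eq_square mult_ac)
      finally show ?thesis using False a_nonneg[of k] by (simp add: less_le)
    qed
  qed
  have "2 * a (Suc i) \<le> q ^ Suc i" for i
  proof (induction i)
    case 0
    then show ?case using a1 by simp
  next
    case (Suc i)
    have "2 * a (Suc (Suc i)) \<le> q * (2 * a (Suc i))" using step[of "Suc i"] by simp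
    also have "\<dots> \<le> q * q ^ Suc i" by (rule mult_left_mono[OF Suc q0])
    finally show ?case by simp
  qed
  then have "2 * a k \<le> q ^ k" using Suc by simp
  then show ?thesis using abs_eq[of "real k * t"] t Suc by (simp add: q_def a_def)
qed

lemma integrable_bounded:
  assumes [measurable]: "f \<in> borel_measurable P" and "AE x in P. \<bar>f x\<bar> \<le> (B::real)"
  shows "integrable P f"
  by (rule integrable_const_bound[where B = B]) (use assms in auto)

text \<open>With d the probability of |X| < t, the tail at level k t is at most (1 - d)^k. The
  discrete layer cake then bounds the second moment by t^2 times the sum of (2k + 1)(1 - d)^k, hence
  by 2 t^2 / d^2; the statement avoids the division.\<close>

lemma small_ball:
  assumes t: "0 < t"
  shows "(prob {x \<in> space P. \<bar>X x\<bar> < t})\<^sup>2 * expectation (\<lambda>x. (X x)\<^sup>2) \<le> 2 * t\<^sup>2"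
proof -
  define d where "d = prob {x \<in> space P. \<bar>X x\<bar> < t}"
  \<comment> \<open>From level \<open>m\<close> on the tails vanish, so finitely many levels
    suffice.\<close>
  obtain m :: nat where m: "R / t < real m" using reals_Archimedean2 by blast
  let ?I = "\<lambda>k. {x \<in> space P. real k * t \<le> \<bar>X x\<bar>}"
  have int: "integrable P (\<lambda>x. (2 * real k + 1) * indicator (?I k) x)" for k
    by (intro integrable_mult_right integrable_real_indicator) (auto simp: less_top[symmetric])
  have "expectation (\<lambda>x. (X x)\<^sup>2) \<le> expectation (\<lambda>x. t\<^sup>2 * (\<Sum>k<m. (2 * real k + 1) * indicator (?I k) x))"
  proof (rule integral_mono_AE)
    show "integrable P (\<lambda>x. (X x)\<^sup>2)"
    proof (rule integrable_bounded)
      show "AE x in P. \<bar>(X x)\<^sup>2\<bar> \<le> R\<^sup>2"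
        using bounded by (rule AE_mp) (auto intro!: AE_I2 simp: abs_le_square_iff[symmetric])
    qed measurable
    show "integrable P (\<lambda>x. t\<^sup>2 * (\<Sum>k<m. (2 * real k + 1) * indicator (?I k) x))"
      by (intro integrable_mult_right Bochner_Integration.integrable_sum int)
    show "AE x in P. (X x)\<^sup>2 \<le> t\<^sup>2 * (\<Sum>k<m. (2 * real k + 1) * indicator (?I k) x)"
      using bounded AE_space
    proof eventually_elim
      case (elim x)
      have "\<bar>X x\<bar> < real m * t" using elim(1) m t by (simp add: field_simps)
      then have "\<bar>X x\<bar>\<^sup>2 \<le> t\<^sup>2 * (\<Sum>k<m. (2 * real k + 1) * (if real k * t \<le> \<bar>X x\<bar> then 1 else 0))"
        using t by (intro square_le_sum_levels) auto
      moreover have "(if real k * t \<le> \<bar>X x\<bar> then 1 else 0 :: real) = indicator (?I k) x" for k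
        using elim(2) by simp
      ultimately show ?case by (simp only: power2_abs)
    qed
  qed
  also have "\<dots> = t\<^sup>2 * (\<Sum>k<m. (2 * real k + 1) * prob (?I k))"
    using Bochner_Integration.integral_sum[of "{..<m}" P "\<lambda>k x. (2 * real k + 1) * indicator (?I k) x", OF int]
    by (simp add: Bochner_Integration.integrable_sum int)
  also have "\<dots> \<le> t\<^sup>2 * (\<Sum>k<m. (2 * real k + 1) * (1 - d) ^ k)"
    unfolding d_def by (intro mult_left_mono sum_mono tail_le t) auto
  finally have "d\<^sup>2 * expectation (\<lambda>x. (X x)\<^sup>2) \<le> d\<^sup>2 * (t\<^sup>2 * (\<Sum>k<m. (2 * real k + 1) * (1 - d) ^ k))"
    by (rule mult_left_mono) simp
  also have "\<dots> = t\<^sup>2 * ((1 - (1 - d))\<^sup>2 * (\<Sum>k<m. (2 * real k + 1) * (1 - d) ^ k))" by simp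
  also have "\<dots> \<le> t\<^sup>2 * 2"
    by (intro mult_left_mono sum_odd_powers_le) (auto simp: d_def)
  finally show ?thesis by (simp add: d_def)
qed

lemma small_ball_dyadic:
  assumes s: "0 < s" "expectation (\<lambda>x. (X x)\<^sup>2) = s\<^sup>2"
  shows "prob {x \<in> space P. \<bar>X x\<bar> < s / 2 ^ k} \<le> sqrt 2 / 2 ^ k"
proof -
  let ?d = "prob {x \<in> space P. \<bar>X x\<bar> < s / 2 ^ k}"
  have "?d\<^sup>2 * s\<^sup>2 \<le> 2 * (s / 2 ^ k)\<^sup>2" using small_ball[of "s / 2 ^ k"] s by simp
  also have "\<dots> = (sqrt 2 / 2 ^ k)\<^sup>2 * s\<^sup>2" by (simp add: power_divide)
  finally have "?d\<^sup>2 \<le> (sqrt 2 / 2 ^ k)\<^sup>2" using s(1) by simp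
  then show ?thesis by (rule power2_le_imp_le) simp
qed

lemma AE_nonzero:
  assumes s: "0 < s" "expectation (\<lambda>x. (X x)\<^sup>2) = s\<^sup>2"
  shows "AE x in P. X x \<noteq> 0"
proof -
  have le: "prob {x \<in> space P. X x = 0} \<le> sqrt 2 * (1 / 2) ^ k" for k :: nat
  proof -
    have "prob {x \<in> space P. X x = 0} \<le> prob {x \<in> space P. \<bar>X x\<bar> < s / 2 ^ k}"
      by (rule finite_measure_mono) (use s in auto)
    with small_ball_dyadic[OF s, of k] show ?thesis by (simp add: power_divide)
  qed
  have "(\<lambda>k. sqrt 2 * (1 / 2) ^ k) \<longlonglongrightarrow> sqrt 2 * 0"
    by (intro tendsto_mult tendsto_const LIMSEQ_power_zero) simp
  then have "prob {x \<in> space P. X x = 0} \<le> sqrt 2 * 0"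
    by (rule LIMSEQ_le_const) (use le in auto)
  then have "prob {x \<in> space P. X x = 0} = 0" by (simp add: measure_le_0_iff)
  then show ?thesis by (subst AE_iff_measurable[OF _ refl]) (auto simp: emeasure_eq_measure)
qed

text \<open>The negative part of ln u is at most ln 2 times the number of k with u < 2^(-k). Summing
  the dyadic small ball bounds gives a geometric series with value 2 sqrt 2 ln 2, just below
  2.\<close>

lemma nn_integral_log_le:
  assumes s: "0 < s" "expectation (\<lambda>x. (X x)\<^sup>2) = s\<^sup>2"
  shows "(\<integral>\<^sup>+x. ennreal (max 0 (- ln (\<bar>X x\<bar> / s))) \<partial>P) \<le> 2"
proof -
  let ?I = "\<lambda>k. {x \<in> space P. \<bar>X x\<bar> < s / 2 ^ k}"
  have "(\<integral>\<^sup>+x. ennreal (max 0 (- ln (\<bar>X x\<bar> / s))) \<partial>P) \<le> (\<integral>\<^sup>+x. (\<Sum>k. ennreal (ln 2) * indicator (?I k) x) \<partial>P)"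
  proof (rule nn_integral_mono)
    fix x assume x: "x \<in> space P"
    define u where "u = \<bar>X x\<bar> / s"
    show "ennreal (max 0 (- ln u)) \<le> (\<Sum>k. ennreal (ln 2) * indicator (?I k) x)"
    proof (cases "0 < u \<and> u < 1")
      case True
      define m where "m = nat \<lceil>- ln u / ln 2\<rceil>"
      have "- ln u / ln 2 \<le> real m" unfolding m_def by linarith
      then have "- ln u \<le> real m * ln 2" by (simp add: field_simps)
      then have "ennreal (max 0 (- ln u)) \<le> ennreal (\<Sum>k<m. ln 2)"
        by (intro ennreal_leI) simp
      also have "\<dots> = (\<Sum>k<m. ennreal (ln 2) * indicator (?I k) x)"
      proof (subst sum_ennreal[symmetric])
        show "(\<Sum>k<m. ennreal (ln 2)) = (\<Sum>k<m. ennreal (ln 2) * indicator (?I k) x)"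
        proof (rule sum.cong[OF refl])
          fix k assume "k \<in> {..<m}"
          then have "real k < - ln u / ln 2" unfolding m_def by (simp) linarith
          then have "ln u < - (real k * ln 2)" by (simp add: field_simps)
          also have "- (real k * ln 2) = ln (1 / 2 ^ k)" by (simp add: ln_div ln_realpow)
          finally have "u < 1 / 2 ^ k" using True by (subst (asm) ln_less_cancel_iff) auto
          then have "x \<in> ?I k" using x s(1) by (simp add: u_def field_simps)
          then show "ennreal (ln 2) = ennreal (ln 2) * indicator (?I k) x" by simp
        qed
      qed simp
      also have "\<dots> \<le> (\<Sum>k. ennreal (ln 2) * indicator (?I k) x)"
        by (rule sum_le_suminf) auto
      finally show ?thesis .
    next
      case False
      moreover have "0 \<le> u" using s(1) by (simp add: u_def)
      \<comment> \<open>The convention \<open>ln 0 = 0\<close> makes the integrand vanish at u = 0,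
        where the true value is infinite; by \<open>AE_nonzero\<close> this event is null.\<close>
      ultimately have "u = 0 \<or> 1 \<le> u" by linarith
      then have "max 0 (- ln u) = 0" by auto
      then show ?thesis by simp
    qed
  qed
  also have "\<dots> = (\<Sum>k. ennreal (ln 2) * emeasure P (?I k))"
    by (subst nn_integral_suminf) (auto simp: nn_integral_cmult_indicator)
  also have "\<dots> \<le> (\<Sum>k. ennreal (ln 2 * sqrt 2 * (1 / 2) ^ k))"
  proof (rule suminf_le)
    show "ennreal (ln 2) * emeasure P (?I k) \<le> ennreal (ln 2 * sqrt 2 * (1 / 2) ^ k)" for k
    proof -
      have "ln 2 * prob (?I k) \<le> ln 2 * (sqrt 2 / 2 ^ k)"
        by (rule mult_left_mono[OF small_ball_dyadic[OF s]]) simp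
      then show ?thesis
        by (simp add: emeasure_eq_measure power_divide flip: ennreal_mult)
    qed
  qed auto
  also have "\<dots> = ennreal (ln 2 * sqrt 2 * 2)"
  proof (rule suminf_ennreal_eq)
    have "(\<lambda>k. (1 / 2 :: real) ^ k) sums 2" using geometric_sums[of "1 / 2 :: real"] by simp
    then show "(\<lambda>k. ln 2 * sqrt 2 * (1 / 2) ^ k) sums (ln 2 * sqrt 2 * 2)" by (rule sums_mult)
  qed simp
  also have "\<dots> \<le> ennreal 2"
  proof (rule ennreal_leI)
    have "sqrt 2 \<le> (1.415 :: real)" by (rule real_le_lsqrt) (simp_all add: power2_eq_square)
    then have "ln 2 * sqrt 2 \<le> 25 / 36 * (1.415 :: real)" using ln2_le_25_over_36 by (intro mult_mono) auto
    then show "ln 2 * sqrt 2 * 2 \<le> (2 :: real)" by simp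
  qed
  finally show ?thesis by simp
qed

text \<open>Khinchine-type inequality with a constant not depending on \<open>p\<close>, not even for \<open>p\<close> near \<open>0\<close>:
  it follows from the bound for the logarithm by \<open>exp z \<ge> 1 + z\<close>.\<close>

lemma moment_ge:
  assumes s: "0 < s" "expectation (\<lambda>x. (X x)\<^sup>2) = s\<^sup>2" and p: "0 < p"
  shows "ennreal ((exp (- 2) * s) powr p) \<le> (\<integral>\<^sup>+x. ennreal (\<bar>X x\<bar> powr p) \<partial>P)"
proof -
  let ?Z = "\<lambda>x. max 0 (- ln (\<bar>X x\<bar> / s))"
  have fin: "(\<integral>\<^sup>+x. ennreal (?Z x) \<partial>P) < top"
    by (rule le_less_trans[OF nn_integral_log_le[OF s]]) simp
  have intZ: "integrable P ?Z"
    by (rule integrableI_nonneg) (use fin in auto)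
  have "ennreal (expectation ?Z) = (\<integral>\<^sup>+x. ennreal (?Z x) \<partial>P)"
    by (rule nn_integral_eq_integral[symmetric, OF intZ]) simp
  then have EZ: "expectation ?Z \<le> 2"
    using nn_integral_log_le[OF s] by (metis ennreal_le_iff ennreal_numeral zero_le_numeral)
  have intp: "integrable P (\<lambda>x. \<bar>X x\<bar> powr p)"
  proof (rule integrable_bounded)
    show "AE x in P. \<bar>\<bar>X x\<bar> powr p\<bar> \<le> R powr p"
      using bounded by (rule AE_mp) (use p in \<open>auto intro!: AE_I2 powr_mono2\<close>)
  qed measurable
  \<comment> \<open>The integrand on the right comes from exp z >= 1 + z at z = p (2 + ln u) with u
    = |X| / s, scaled by (e^-2 s)^p. Since \<open>?Z\<close> has mean at most 2, the shift by 2 p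
    leaves a mean of at least (e^-2 s)^p.\<close>
  have "(exp (- 2) * s) powr p * (1 + 2 * p) - (exp (- 2) * s) powr p * p * expectation ?Z
     = expectation (\<lambda>x. (exp (- 2) * s) powr p * (1 + 2 * p) - (exp (- 2) * s) powr p * p * ?Z x)"
    using intZ by (simp add: prob_space)
  also have "\<dots> \<le> expectation (\<lambda>x. \<bar>X x\<bar> powr p)"
  proof (rule integral_mono_AE)
    show "AE x in P. (exp (- 2) * s) powr p * (1 + 2 * p) - (exp (- 2) * s) powr p * p * ?Z x \<le> \<bar>X x\<bar> powr p"
      using AE_nonzero[OF s]
    proof eventually_elim
      case (elim x)
      define u where "u = \<bar>X x\<bar> / s"
      have u: "0 < u" "\<bar>X x\<bar> = u * s" using elim s(1) by (auto simp: u_def)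
      have "1 + 2 * p - p * max 0 (- ln u) \<le> 1 + p * (2 + ln u)"
        using mult_left_mono[of "- ln u" "max 0 (- ln u)" p] p by (simp add: algebra_simps)
      also have "\<dots> \<le> exp (p * (2 + ln u))" by (rule exp_ge_add_one_self)
      also have "\<dots> = u powr p * exp (2 * p)" using u by (simp add: powr_def exp_add[symmetric] algebra_simps)
      finally have "(exp (- 2) * s) powr p * (1 + 2 * p - p * max 0 (- ln u)) \<le> (exp (- 2) * s) powr p * (u powr p * exp (2 * p))"
        by (rule mult_left_mono) simp
      also have "\<dots> = (u * s) powr p"
      proof -
        have "exp (- 2) powr p * exp (2 * p) = 1" by (simp add: powr_def exp_add[symmetric])
        then show ?thesis using u s(1) by (simp add: powr_mult mult_ac)
      qed
      finally show ?case by (simp add: u(2) u_def[symmetric] algebra_simps)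
    qed
  qed (use intZ intp in auto)
  finally have "(exp (- 2) * s) powr p * (1 + 2 * p) - (exp (- 2) * s) powr p * p * expectation ?Z \<le> expectation (\<lambda>x. \<bar>X x\<bar> powr p)" .
  moreover have "(exp (- 2) * s) powr p * p * expectation ?Z \<le> (exp (- 2) * s) powr p * p * 2"
    using EZ p by (intro mult_left_mono) auto
  ultimately have "(exp (- 2) * s) powr p \<le> expectation (\<lambda>x. \<bar>X x\<bar> powr p)"
    by (simp add: algebra_simps)
  then have "ennreal ((exp (- 2) * s) powr p) \<le> ennreal (expectation (\<lambda>x. \<bar>X x\<bar> powr p))" by (rule ennreal_leI)
  also have "\<dots> = (\<integral>\<^sup>+x. ennreal (\<bar>X x\<bar> powr p) \<partial>P)"
    by (rule nn_integral_eq_integral[symmetric, OF intp]) simp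
  finally show ?thesis .
qed

end

section \<open>Linear functionals on the body and on the sphere\<close>

lemma emeasure_reflect:
  assumes A: "A \<in> sets (lebn n)"
  shows "emeasure (lebn n) (vscale n (-1) ` A) = emeasure (lebn n) A"
proof -
  have "vscale n (-1) ` cube n 1 = cube n 1" using symmetric_cube by (simp add: symmetric_n_def)
  then have "emeasure (lebn n) (vscale n (-1) ` A) * ennreal (2 ^ n) = emeasure (lebn n) A * ennreal (2 ^ n)"
    using emeasure_linear_image(2)[OF linear_vscale bij_vscale A cube_sets[of n 1] symmetric_cube, of "-1"]
    by (simp add: emeasure_cube)
  then show ?thesis by (simp add: ennreal_mult_cancel_left mult.commute[of _ "ennreal (2 ^ n)"])
qed

locale isotropic_body =
  fixes n :: nat and K :: "(nat \<Rightarrow> real) set" and v R :: real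
  assumes dim_pos: "1 \<le> n"
    and K_sets[measurable]: "K \<in> sets (lebn n)"
    and emeasure_K: "emeasure (lebn n) K = ennreal v" and v_pos: "0 < v"
    and ball: "emeasure (lebn n) (unit_ball n) = ennreal v"
    and K_bounded: "\<And>x. x \<in> K \<Longrightarrow> nrm n x \<le> R"
    and iso: "isotropic_position n K"
    and convex: "convex_n n K"
    and symmetric_K: "symmetric_n n K"
begin

definition unif :: "(nat \<Rightarrow> real) measure" where
  "unif = uniform_measure (lebn n) K"

text \<open>By isotropy the first basis vector stands for every direction, see
  \<open>second_moment_unif\<close>.\<close>

definition s :: real where
  "s = sqrt (second_moment n K (basis n 0) / v)"

lemma s_pos: "0 < s"
  using second_moment_pos[OF dim_pos K_sets emeasure_K v_pos K_bounded] v_pos by (simp add: s_def)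

lemma K_subset: "K \<subseteq> Rn n"
  using sets.sets_into_space[OF K_sets] by (simp add: space_lebn)

lemma sets_unif[simp, measurable_cong]: "sets unif = sets (lebn n)"
  and space_unif[simp]: "space unif = Rn n"
  by (simp_all add: unif_def space_lebn)

lemma prob_space_unif: "prob_space unif"
  unfolding unif_def by (rule prob_space_uniform_measure) (use emeasure_K v_pos in auto)

sublocale unif: prob_space unif by (rule prob_space_unif)

lemma AE_unif: "(\<And>x. x \<in> K \<Longrightarrow> Q x) \<Longrightarrow> AE x in unif. Q x"
  unfolding unif_def by (rule AE_uniform_measureI) auto

lemma unif_eq_density: "unif = density (lebn n) (\<lambda>x. ennreal (indicator K x / v))"
  unfolding unif_def uniform_measure_def emeasure_K using v_pos
  by (intro density_cong) (auto intro!: AE_I2 split: split_indicator simp: divide_ennreal[symmetric])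

lemma measure_unif:
  assumes "A \<in> sets (lebn n)"
  shows "measure unif A = measure (lebn n) (K \<inter> A) / v"
proof -
  have "measure (lebn n) K = v" using emeasure_K v_pos by (simp add: measure_def)
  then show ?thesis
    unfolding unif_def using assms emeasure_K v_pos by (subst measure_uniform_measure) auto
qed

lemma fin_K: "A \<in> sets (lebn n) \<Longrightarrow> emeasure (lebn n) (K \<inter> A) = ennreal (measure (lebn n) (K \<inter> A))"
proof (rule emeasure_eq_ennreal_measure)
  have "emeasure (lebn n) (K \<inter> A) \<le> emeasure (lebn n) K" by (rule emeasure_mono) auto
  then show "emeasure (lebn n) (K \<inter> A) \<noteq> top" using emeasure_K by (auto simp: top_unique)
qed

text \<open>Convexity puts midpoints of two half-space sections of \<open>K\<close> into the section
  at the averaged level, so \<open>brunn_minkowski_midpoint\<close> applies; central symmetry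
  exchanges opposite sections.\<close>

lemma log_concave_unif: "symmetric_log_concave unif (\<lambda>x. dot n x y) (R * nrm n y)"
proof
  show "(\<lambda>x. dot n x y) \<in> borel_measurable unif" by measurable
  show "AE x in unif. \<bar>dot n x y\<bar> \<le> R * nrm n y"
  proof (rule AE_unif)
    fix x assume "x \<in> K"
    then have "nrm n x * nrm n y \<le> R * nrm n y" by (intro mult_right_mono K_bounded) auto
    then show "\<bar>dot n x y\<bar> \<le> R * nrm n y" using abs_dot_le[of n x y] by linarith
  qed
  have lev[measurable]: "{x \<in> Rn n. r \<le> dot n x y} \<in> sets (lebn n)" "{x \<in> Rn n. dot n x y \<le> r} \<in> sets (lebn n)" for r
    unfolding space_lebn[symmetric] by measurable
  fix r r' :: real
  show "measure unif {x \<in> space unif. dot n x y \<le> - r} = measure unif {x \<in> space unif. r \<le> dot n x y}"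
  proof -
    have "K \<inter> {x \<in> Rn n. dot n x y \<le> - r} = vscale n (-1) ` (K \<inter> {x \<in> Rn n. r \<le> dot n x y})"
    proof (intro equalityI subsetI)
      fix x assume x: "x \<in> K \<inter> {x \<in> Rn n. dot n x y \<le> - r}"
      have "x = vscale n (-1) (vscale n (-1) x)" using x by (simp add: vscale_vscale vscale_one)
      moreover have "vscale n (-1) x \<in> K" using x symmetric_K unfolding symmetric_n_def by blast
      ultimately show "x \<in> vscale n (-1) ` (K \<inter> {x \<in> Rn n. r \<le> dot n x y})"
        using x by (intro image_eqI[of _ _ "vscale n (-1) x"]) (auto simp: dot_vscale)
    next
      fix x assume "x \<in> vscale n (-1) ` (K \<inter> {x \<in> Rn n. r \<le> dot n x y})"
      then obtain z where z: "z \<in> K" "r \<le> dot n z y" "x = vscale n (-1) z" by auto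
      moreover have "vscale n (-1) z \<in> K" using z symmetric_K unfolding symmetric_n_def by blast
      ultimately show "x \<in> K \<inter> {x \<in> Rn n. dot n x y \<le> - r}" by (auto simp: dot_vscale)
    qed
    then have "measure (lebn n) (K \<inter> {x \<in> Rn n. dot n x y \<le> - r}) = measure (lebn n) (K \<inter> {x \<in> Rn n. r \<le> dot n x y})"
      unfolding measure_def by (simp add: emeasure_reflect)
    then show ?thesis by (simp add: measure_unif)
  qed
  show "measure unif {x \<in> space unif. r \<le> dot n x y} * measure unif {x \<in> space unif. r' \<le> dot n x y}
     \<le> (measure unif {x \<in> space unif. (r + r') / 2 \<le> dot n x y})\<^sup>2"
  proof -
    let ?m = "\<lambda>r. measure (lebn n) (K \<inter> {x \<in> Rn n. r \<le> dot n x y})"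
    have "emeasure (lebn n) (K \<inter> {x \<in> Rn n. r \<le> dot n x y}) * emeasure (lebn n) (K \<inter> {x \<in> Rn n. r' \<le> dot n x y})
      \<le> (emeasure (lebn n) (K \<inter> {x \<in> Rn n. (r + r') / 2 \<le> dot n x y}))\<^sup>2"
    proof (rule brunn_minkowski_midpoint)
      fix x z assume x: "x \<in> K \<inter> {x \<in> Rn n. r \<le> dot n x y}" and z: "z \<in> K \<inter> {x \<in> Rn n. r' \<le> dot n x y}"
      have eq: "(\<lambda>i\<in>{..<n}. (x i + z i) / 2) = vadd n (vscale n (1 - 1/2) x) (vscale n (1/2) z)"
        by (rule Rn_eqI[of _ n]) (auto simp: vadd_def vscale_def)
      have "vadd n (vscale n (1 - 1/2) x) (vscale n (1/2) z) \<in> K"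
        using convex[unfolded convex_n_def, rule_format, of x z "1/2"] x z by simp
      then show "(\<lambda>i\<in>{..<n}. (x i + z i) / 2) \<in> K \<inter> {x \<in> Rn n. (r + r') / 2 \<le> dot n x y}"
        unfolding eq using x z by (auto simp: dot_vadd dot_vscale)
    qed measurable
    then have "ennreal (?m r * ?m r') \<le> ennreal ((?m ((r + r') / 2))\<^sup>2)"
      by (simp add: fin_K ennreal_mult ennreal_power)
    then have "?m r * ?m r' \<le> (?m ((r + r') / 2))\<^sup>2" by (simp add: ennreal_le_iff)
    then have "?m r * ?m r' / v\<^sup>2 \<le> (?m ((r + r') / 2))\<^sup>2 / v\<^sup>2" by (rule divide_right_mono) simp
    then show ?thesis by (simp add: measure_unif power_divide power2_eq_square)
  qed
qed

lemma second_moment_unif: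
  assumes "y \<in> Rn n"
  shows "unif.expectation (\<lambda>x. (dot n x y)\<^sup>2) = (s * nrm n y)\<^sup>2"
proof -
  have "unif.expectation (\<lambda>x. (dot n x y)\<^sup>2) = (LINT x|lebn n. (indicator K x / v) *\<^sub>R (dot n x y)\<^sup>2)"
    unfolding unif_eq_density by (rule integral_density) (use v_pos in auto)
  also have "\<dots> = (LINT x:K|lebn n. (dot n x y)\<^sup>2) / v"
    by (simp add: set_lebesgue_integral_def)
  also have "\<dots> = (s * nrm n y)\<^sup>2"
    using s_pos by (simp add: isotropic_moment[OF iso dim_pos assms] power_mult_distrib s_def)
  finally show ?thesis .
qed

lemma nn_integral_log_dot_le:
  assumes "y \<in> unit_sphere n"
  shows "(\<integral>\<^sup>+x. ennreal (max 0 (- ln (\<bar>dot n x y\<bar> / s))) \<partial>unif) \<le> 2"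
proof -
  interpret symmetric_log_concave unif "\<lambda>x. dot n x y" "R * nrm n y" by (rule log_concave_unif)
  show ?thesis
    using nn_integral_log_le[OF s_pos] second_moment_unif[of y] assms by (simp add: unit_sphere_def)
qed

lemma AE_nonzero_unif: "AE x in unif. x \<noteq> vzero n"
proof -
  interpret symmetric_log_concave unif "\<lambda>x. dot n x (basis n 0)" "R * nrm n (basis n 0)" by (rule log_concave_unif)
  have "AE x in unif. dot n x (basis n 0) \<noteq> 0"
    using AE_nonzero[OF s_pos] second_moment_unif[of "basis n 0"] dim_pos by (simp add: nrm_basis)
  then show ?thesis by (rule AE_mp) (use dim_pos in \<open>auto intro!: AE_I2 simp: dot_basis vzero_def\<close>)
qed

lemma moment_dot_ge:
  assumes y: "y \<in> Rn n" and p: "0 < p"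
  shows "ennreal ((exp (- 2) * s * nrm n y) powr p) \<le> (\<integral>\<^sup>+x. ennreal (\<bar>dot n x y\<bar> powr p) \<partial>unif)"
proof (cases "nrm n y = 0")
  case False
  interpret symmetric_log_concave unif "\<lambda>x. dot n x y" "R * nrm n y" by (rule log_concave_unif)
  have "0 < s * nrm n y" using False s_pos by (simp add: less_le)
  from moment_ge[OF this second_moment_unif[OF y] p] show ?thesis by (simp add: mult.assoc)
qed simp

lemma isotropic_const_bound: "isotropic_const n K \<le> s * sqrt n / 2"
  unfolding s_def by (rule isotropic_const_le[OF dim_pos K_sets emeasure_K v_pos K_bounded ball iso])

end

section \<open>Reflections and the rotation-invariant measure\<close>

definition householder :: "nat \<Rightarrow> (nat \<Rightarrow> real) \<Rightarrow> (nat \<Rightarrow> real) \<Rightarrow> nat \<Rightarrow> real" where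
  "householder n w x = vadd n x (vscale n (- 2 * dot n x w / dot n w w) w)"

lemma dot_householder: "dot n (householder n w x) y = dot n x y - 2 * dot n x w * dot n w y / dot n w w"
  by (simp add: householder_def dot_vadd dot_vscale)

lemma orthogonal_householder:
  assumes "w \<in> Rn n" "nrm n w \<noteq> 0"
  shows "orthogonal_n n (householder n w)"
proof -
  have "linear_n n (householder n w)"
    unfolding linear_n_def
  proof (intro conjI funcsetI ballI allI)
    show "householder n w x \<in> Rn n" for x by (simp add: householder_def)
    fix x y assume "x \<in> Rn n" "y \<in> Rn n"
    show "householder n w (vadd n x y) = vadd n (householder n w x) (householder n w y)"
      by (rule Rn_eq_dotI[of _ n]) (simp_all add: householder_def dot_vadd dot_vscale algebra_simps add_divide_distrib diff_divide_distrib)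
  next
    fix a x assume "x \<in> Rn n"
    show "householder n w (vscale n a x) = vscale n a (householder n w x)"
      by (rule Rn_eq_dotI[of _ n]) (simp_all add: householder_def dot_vadd dot_vscale algebra_simps)
  qed
  moreover have "nrm n (householder n w x) = nrm n x" for x
  proof (rule power2_eq_imp_eq)
    have nz: "dot n w w \<noteq> 0" using assms(2) nrm_squared[of w n] by auto
    have "dot n (householder n w x) (householder n w x) = dot n x x"
      unfolding dot_householder dot_commute[of n x "householder n w x"] dot_commute[of n w "householder n w x"] 
      using nz by (simp add: dot_householder dot_commute[of n w x] field_simps)
    then show "(nrm n (householder n w x))\<^sup>2 = (nrm n x)\<^sup>2" by (simp add: nrm_squared)
  qed auto
  ultimately show ?thesis by (simp add: orthogonal_n_def)
qed

text \<open>For w = a - b with unit vectors a and b one has 2 <w,a> = <w,w>, so the reflection in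
  the hyperplane orthogonal to \<open>w\<close> swaps \<open>a\<close> and \<open>b\<close>.
  Reflections alone thus move any direction to any other.\<close>

lemma householder_exchange:
  assumes a: "a \<in> unit_sphere n" and b: "b \<in> unit_sphere n" and ne: "a \<noteq> b"
  defines "w \<equiv> vadd n a (vscale n (-1) b)"
  shows "nrm n w \<noteq> 0" "dot n (householder n w x) a = dot n x b"
proof -
  have ab: "a \<in> Rn n" "b \<in> Rn n" "dot n a a = 1" "dot n b b = 1"
    using a b nrm_squared[of a n] nrm_squared[of b n] by (auto simp: unit_sphere_def)
  show nz: "nrm n w \<noteq> 0"
  proof
    assume "nrm n w = 0"
    then have "w = vzero n" by (subst (asm) nrm_eq_0_iff) (simp_all add: w_def)
    then have "w i = 0" if "i < n" for i using that by (simp add: vzero_def)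
    then have "a i = b i" if "i < n" for i
      using that by (simp add: w_def vadd_def vscale_def)
    then show False using ne Rn_eqI[OF ab(1,2)] by blast
  qed
  have ww: "dot n w w = 2 * (1 - dot n a b)" "dot n w a = 1 - dot n a b"
    by (simp_all add: w_def dot_vadd dot_vadd_right dot_vscale dot_vscale_right ab dot_commute[of n b a])
  have "1 - dot n a b \<noteq> 0" using nz ww(1) nrm_squared[of w n] by auto
  then have "dot n (householder n w x) a = dot n x a - dot n x w"
    by (simp add: dot_householder ww field_simps)
  then show "dot n (householder n w x) a = dot n x b"
    by (simp add: w_def dot_vadd_right dot_vscale_right)
qed

locale haar =
  fixes n :: nat and \<sigma> :: "(nat \<Rightarrow> real) measure"
  assumes dim_pos: "1 \<le> n" and haar: "haar_sphere n \<sigma>"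
begin

sublocale prob_space \<sigma> using haar by (simp add: haar_sphere_def)

lemma sets_sigma[measurable_cong]: "sets \<sigma> = sets (restrict_space (lebn n) (unit_sphere n))"
  using haar by (simp add: haar_sphere_def sphere_borel_def)

lemma space_sigma: "space \<sigma> = unit_sphere n"
  using sets_eq_imp_space_eq[OF sets_sigma] by (auto simp: space_restrict_space space_lebn unit_sphere_def)

lemma ident_measurable[measurable]: "(\<lambda>x. x) \<in> measurable \<sigma> (lebn n)"
  using measurable_restrict_space1[OF measurable_ident, of "lebn n" "unit_sphere n"]
    measurable_cong_sets[OF sets_sigma refl, of "lebn n"] by (simp add: id_def)

text \<open>Push \<open>\<sigma>\<close> forward by the reflection that swaps \<open>a\<close> and
  \<open>b\<close>. Rotation invariance enters the later estimates only through this lemma.\<close>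

lemma invariant:
  assumes [measurable]: "F \<in> borel_measurable borel" and a: "a \<in> unit_sphere n" and b: "b \<in> unit_sphere n"
  shows "(\<integral>\<^sup>+x. F (dot n x a) \<partial>\<sigma>) = (\<integral>\<^sup>+x. F (dot n x b) \<partial>\<sigma>)"
proof (cases "a = b")
  case False
  define w where "w = vadd n a (vscale n (-1) b)"
  let ?U = "householder n w"
  note ex = householder_exchange[OF a b False, folded w_def]
  have orth: "orthogonal_n n ?U" by (rule orthogonal_householder) (use ex(1) in \<open>simp_all add: w_def\<close>)
  have "?U \<in> measurable \<sigma> (restrict_space (lebn n) (unit_sphere n))"
  proof (rule measurable_restrict_space2)
    show "?U \<in> space \<sigma> \<rightarrow> unit_sphere n"
      using orth by (auto simp: space_sigma unit_sphere_def orthogonal_n_def linear_n_def)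
    show "?U \<in> measurable \<sigma> (lebn n)"
      using measurable_compose[OF ident_measurable linear_n_measurable[of n ?U]] orth by (simp add: orthogonal_n_def)
  qed
  then have [measurable]: "?U \<in> measurable \<sigma> \<sigma>" using measurable_cong_sets[OF refl sets_sigma] by blast
  have "(\<integral>\<^sup>+x. F (dot n x a) \<partial>\<sigma>) = (\<integral>\<^sup>+x. F (dot n x a) \<partial>distr \<sigma> \<sigma> ?U)"
    using haar orth by (simp add: haar_sphere_def)
  also have "\<dots> = (\<integral>\<^sup>+x. F (dot n (?U x) a) \<partial>\<sigma>)"
    by (rule nn_integral_distr) measurable
  finally show ?thesis by (simp add: ex(2))
qed simp

text \<open>By invariance the n coordinate directions contribute equally, and the squared
  coordinates sum to 1 on the sphere.\<close>

lemma second_moment_sphere: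
  assumes a: "a \<in> unit_sphere n"
  shows "(\<integral>\<^sup>+x. ennreal ((dot n x a)\<^sup>2) \<partial>\<sigma>) = ennreal (1 / n)"
proof -
  let ?I = "\<integral>\<^sup>+x. ennreal ((dot n x a)\<^sup>2) \<partial>\<sigma>"
  have "of_nat n * ?I = (\<Sum>i<n. \<integral>\<^sup>+x. ennreal ((dot n x (basis n i))\<^sup>2) \<partial>\<sigma>)"
  proof -
    have "(\<integral>\<^sup>+x. ennreal ((dot n x (basis n i))\<^sup>2) \<partial>\<sigma>) = ?I" if "i < n" for i
      using that a by (intro invariant[of "\<lambda>u. ennreal (u\<^sup>2)"]) (auto simp: unit_sphere_def nrm_basis)
    then show ?thesis by simp
  qed
  also have "\<dots> = (\<integral>\<^sup>+x. (\<Sum>i<n. ennreal ((dot n x (basis n i))\<^sup>2)) \<partial>\<sigma>)"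
    by (rule nn_integral_sum[symmetric]) measurable
  also have "\<dots> = (\<integral>\<^sup>+x. 1 \<partial>\<sigma>)"
  proof (rule nn_integral_cong)
    fix x assume "x \<in> space \<sigma>"
    then have "dot n x x = 1" using nrm_squared[of x n] by (simp add: space_sigma unit_sphere_def)
    moreover have "(\<Sum>i<n. ennreal ((dot n x (basis n i))\<^sup>2)) = ennreal (dot n x x)"
      by (simp add: dot_basis) (simp add: dot_def power2_eq_square)
    ultimately show "(\<Sum>i<n. ennreal ((dot n x (basis n i))\<^sup>2)) = 1" by simp
  qed
  also have "\<dots> = 1" by (simp add: emeasure_space_1)
  finally have "ennreal n * ?I = 1" by (simp add: ennreal_of_nat_eq_real_of_nat)
  then have "ennreal n * ?I = ennreal n * ennreal (1 / n)" using dim_pos by (simp flip: ennreal_mult)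
  then show ?thesis unfolding ennreal_mult_cancel_left using dim_pos by auto
qed

end

text \<open>Weighted AM-GM for a and 1, from convexity of exp; it serves as Jensen's inequality for
  a concave power.\<close>

lemma powr_le_linear:
  fixes a q :: real
  assumes "0 \<le> a" "0 < q" "q \<le> 1"
  shows "a powr q \<le> (1 - q) + q * a"
proof (cases "a = 0")
  case False
  then have "exp ((1 - q) *\<^sub>R 0 + q *\<^sub>R ln a) \<le> (1 - q) * exp 0 + q * exp (ln a)"
    using assms by (intro convex_onD[OF exp_convex]) auto
  then show ?thesis using False assms by (simp add: powr_def)
qed (use assms in simp)

text \<open>The exponent is weaker than the sharp a^2 / 2 but elementary: on [0,1] both exponentials
  have quadratic upper bounds, and beyond 1 one has a <= a^2.\<close>

lemma exp_add_exp_minus_le: "exp a + exp (- a) \<le> 2 * exp (a\<^sup>2)" for a :: real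
proof -
  have main: "exp a + exp (- a) \<le> 2 * exp (a\<^sup>2)" if "0 \<le> a" for a :: real
  proof (cases "a \<le> 1")
    case True
    have "exp (- a) * (1 + a) \<le> exp (- a) * exp a" by (intro mult_left_mono exp_ge_add_one_self) auto
    then have "exp (- a) * (1 + a) \<le> 1" by (simp add: exp_add[symmetric])
    \<comment> \<open>The product equals 1 + a^3.\<close>
    also have "1 \<le> (1 - a + a\<^sup>2) * (1 + a)" using that by (simp add: algebra_simps power2_eq_square)
    finally have "exp (- a) \<le> 1 - a + a\<^sup>2" using that by (simp add: mult_le_cancel_right)
    then have "exp a + exp (- a) \<le> 2 * (1 + a\<^sup>2)" using exp_bound[OF that True] by simp
    also have "\<dots> \<le> 2 * exp (a\<^sup>2)" by (intro mult_left_mono exp_ge_add_one_self) simp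
    finally show ?thesis .
  next
    case False
    then have "a \<le> a\<^sup>2" by (simp add: power2_eq_square)
    then have "exp a \<le> exp (a\<^sup>2)" "exp (- a) \<le> exp (a\<^sup>2)" using that by auto
    then show ?thesis by linarith
  qed
  show ?thesis using main[of a] main[of "- a"] by (cases "0 \<le> a") (auto simp: add.commute)
qed

text \<open>This is b <= exp(b - 1) for b = |u| / sqrt p, raised to the power p. The scale sqrt p
  makes exp(-p) cancel the exp(p) that \<open>sum_signs_exp_le\<close> produces at t = sqrt
  p.\<close>

lemma abs_powr_le_exp:
  fixes u p :: real
  assumes p: "0 < p"
  shows "\<bar>u\<bar> powr p \<le> (sqrt p) powr p * exp (- p) * (exp (sqrt p * u) + exp (sqrt p * - u))"
proof (cases "u = 0")
  case False
  define b where "b = \<bar>u\<bar> / sqrt p"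
  have b: "0 < b" "\<bar>u\<bar> = sqrt p * b" using False p by (simp_all add: b_def)
  have "ln b \<le> b - 1" using ln_le_minus_one[OF b(1)] .
  then have "p * ln b \<le> p * (b - 1)" using p by (intro mult_left_mono) auto
  then have "b powr p \<le> exp (- p + p * b)" using b by (simp add: powr_def algebra_simps)
  also have "\<dots> = exp (- p) * exp (p * b)" by (rule exp_add)
  also have "p * b = sqrt p * \<bar>u\<bar>" using b(2) p by (simp add: mult.assoc[symmetric])
  finally have "b powr p \<le> exp (- p) * exp (sqrt p * \<bar>u\<bar>)" .
  also have "\<dots> \<le> exp (- p) * (exp (sqrt p * u) + exp (sqrt p * - u))"
    by (intro mult_left_mono) (auto simp: abs_if)
  finally have "sqrt p powr p * b powr p \<le> sqrt p powr p * (exp (- p) * (exp (sqrt p * u) + exp (sqrt p * - u)))"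
    by (rule mult_left_mono) simp
  then show ?thesis using b p by (simp add: powr_mult mult.assoc)
qed (use p in simp)

definition signs :: "nat \<Rightarrow> (nat \<Rightarrow> real) set" where
  "signs n = PiE {..<n} (\<lambda>_. {-1, 1})"

lemma card_signs: "card (signs n) = 2 ^ n"
  by (simp add: signs_def card_PiE numeral_2_eq_2)

text \<open>Independence of the signs factors the exponential sum into a product of terms 2 cosh(t
  x_i).\<close>

lemma sum_signs_exp_le: "(\<Sum>e\<in>signs n. exp (t * dot n x e)) \<le> 2 ^ n * exp (t\<^sup>2 * (nrm n x)\<^sup>2)"
proof -
  have "(\<Sum>e\<in>signs n. exp (t * dot n x e)) = (\<Sum>e\<in>signs n. \<Prod>i<n. exp (t * x i * e i))"
    by (simp add: dot_def exp_sum sum_distrib_left mult.assoc)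
  also have "\<dots> = (\<Prod>i<n. \<Sum>b\<in>{-1, 1}. exp (t * x i * b))"
    unfolding signs_def by (rule prod_sum_PiE[symmetric]) auto
  also have "\<dots> \<le> (\<Prod>i<n. 2 * exp ((t * x i)\<^sup>2))"
    using exp_add_exp_minus_le by (intro prod_mono) (auto simp: add.commute intro: add_nonneg_nonneg)
  also have "\<dots> = 2 ^ n * exp (\<Sum>i<n. (t * x i)\<^sup>2)"
    by (simp add: prod.distrib exp_sum)
  also have "(\<Sum>i<n. (t * x i)\<^sup>2) = t\<^sup>2 * (nrm n x)\<^sup>2"
    unfolding nrm_squared dot_def power_mult_distrib sum_distrib_left by (simp add: power2_eq_square)
  finally show ?thesis .
qed

text \<open>After the cancellation prepared in \<open>abs_powr_le_exp\<close> there remains the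
  factor 2 from the two signs of the exponent; it stands outside the p-th power.\<close>

lemma khinchine:
  assumes p: "0 < p" and x: "nrm n x = 1"
  shows "(\<Sum>e\<in>signs n. \<bar>dot n x e\<bar> powr p) \<le> 2 ^ n * (2 * sqrt p powr p)"
proof -
  have "(\<Sum>e\<in>signs n. \<bar>dot n x e\<bar> powr p)
    \<le> (\<Sum>e\<in>signs n. sqrt p powr p * exp (- p) * (exp (sqrt p * dot n x e) + exp (- sqrt p * dot n x e)))"
    using abs_powr_le_exp[OF p] by (intro sum_mono) simp
  also have "\<dots> = sqrt p powr p * exp (- p) * ((\<Sum>e\<in>signs n. exp (sqrt p * dot n x e)) + (\<Sum>e\<in>signs n. exp (- sqrt p * dot n x e)))"
    by (simp only: sum_distrib_left[symmetric] sum.distrib)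
  also have "\<dots> \<le> sqrt p powr p * exp (- p) * (2 ^ n * exp p + 2 ^ n * exp p)"
    using sum_signs_exp_le[of "sqrt p" n x] sum_signs_exp_le[of "- sqrt p" n x] p x
    by (intro mult_left_mono add_mono) auto
  also have "\<dots> = 2 ^ n * (2 * sqrt p powr p)"
    by (simp add: exp_minus field_simps)
  finally show ?thesis .
qed

context haar
begin

text \<open>Power mean inequality against the second moment 1 / n: \<open>powr_le_linear\<close> is
  applied to n <x,a>^2 with exponent p / 2.\<close>

lemma moment_sphere_small:
  assumes p: "0 < p" "p \<le> 2" and a: "a \<in> unit_sphere n"
  shows "(\<integral>\<^sup>+x. ennreal (\<bar>dot n x a\<bar> powr p) \<partial>\<sigma>) \<le> ennreal ((1 / sqrt n) powr p)"
proof -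
  let ?c = "(1 / sqrt n) powr p"
  have "(\<integral>\<^sup>+x. ennreal (\<bar>dot n x a\<bar> powr p) \<partial>\<sigma>)
    \<le> (\<integral>\<^sup>+x. ennreal (?c * (1 - p / 2)) + ennreal (?c * (p / 2) * n) * ennreal ((dot n x a)\<^sup>2) \<partial>\<sigma>)"
  proof (rule nn_integral_mono)
    fix x
    let ?u = "\<bar>dot n x a\<bar>"
    have "?u powr p = (1 / sqrt n * (sqrt n * ?u)) powr p" using dim_pos by simp
    also have "\<dots> = ?c * (sqrt n * ?u) powr p" by (subst powr_mult) auto
    also have "(sqrt n * ?u) powr p = (n * ?u\<^sup>2) powr (p / 2)"
    proof -
      have "(n * ?u\<^sup>2) powr (p / 2) = ((sqrt n * ?u)\<^sup>2) powr (p / 2)" by (simp add: power_mult_distrib)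
      also have "\<dots> = (sqrt n * ?u) powr p"
        by (cases "sqrt n * ?u = 0") (simp_all add: powr_powr flip: powr_numeral)
      finally show ?thesis by simp
    qed
    also have "?c * (n * ?u\<^sup>2) powr (p / 2) \<le> ?c * ((1 - p / 2) + p / 2 * (n * ?u\<^sup>2))"
      using p by (intro mult_left_mono powr_le_linear) auto
    finally have "?u powr p \<le> ?c * (1 - p / 2) + ?c * (p / 2) * n * (dot n x a)\<^sup>2"
      by (simp add: algebra_simps)
    then have "ennreal (?u powr p) \<le> ennreal (?c * (1 - p / 2) + ?c * (p / 2) * n * (dot n x a)\<^sup>2)"
      by (rule ennreal_leI)
    also have "\<dots> = ennreal (?c * (1 - p / 2)) + ennreal (?c * (p / 2) * n) * ennreal ((dot n x a)\<^sup>2)"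
      using p by (subst ennreal_plus) (auto simp flip: ennreal_mult)
    finally show "ennreal (?u powr p) \<le> ennreal (?c * (1 - p / 2)) + ennreal (?c * (p / 2) * n) * ennreal ((dot n x a)\<^sup>2)" .
  qed
  also have "\<dots> = ennreal (?c * (1 - p / 2)) + ennreal (?c * (p / 2) * n) * ennreal (1 / n)"
    by (simp add: nn_integral_add nn_integral_cmult second_moment_sphere[OF a] emeasure_space_1)
  also have "\<dots> = ennreal (?c * (1 - p / 2) + ?c * (p / 2) * n * (1 / n))"
    using p by (simp add: ennreal_plus flip: ennreal_mult)
  also have "?c * (1 - p / 2) + ?c * (p / 2) * n * (1 / n) = ?c"
    using dim_pos by (simp add: algebra_simps)
  finally show ?thesis .
qed

text \<open>The vectors \<open>e / sqrt n\<close> with \<open>e\<close> a sign vector lie on the sphere, so by invariance the moment is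
  the average over them, and the two integrations can be exchanged.\<close>

lemma moment_sphere_signs:
  assumes p: "0 < p" and a: "a \<in> unit_sphere n"
  shows "(\<integral>\<^sup>+x. ennreal (\<bar>dot n x a\<bar> powr p) \<partial>\<sigma>) \<le> ennreal (2 * sqrt (p / n) powr p)"
proof -
  let ?I = "\<integral>\<^sup>+x. ennreal (\<bar>dot n x a\<bar> powr p) \<partial>\<sigma>"
  let ?r = "1 / sqrt n"
  have "of_nat (2 ^ n) * ?I = (\<Sum>e\<in>signs n. \<integral>\<^sup>+x. ennreal (\<bar>dot n x (vscale n ?r e)\<bar> powr p) \<partial>\<sigma>)"
  proof -
    have "(\<integral>\<^sup>+x. ennreal (\<bar>dot n x (vscale n ?r e)\<bar> powr p) \<partial>\<sigma>) = ?I" if e: "e \<in> signs n" for e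
    proof (rule invariant[of "\<lambda>u. ennreal (\<bar>u\<bar> powr p)"])
      have "(e i)\<^sup>2 = 1" if "i < n" for i using e that by (force simp: signs_def PiE_iff)
      then have "nrm n e = sqrt n" by (simp add: L2_set_def)
      then show "vscale n ?r e \<in> unit_sphere n" using dim_pos by (simp add: unit_sphere_def nrm_vscale)
    qed (use a in auto)
    then show ?thesis by (simp add: card_signs)
  qed
  also have "\<dots> = (\<integral>\<^sup>+x. (\<Sum>e\<in>signs n. ennreal (\<bar>dot n x (vscale n ?r e)\<bar> powr p)) \<partial>\<sigma>)"
    by (rule nn_integral_sum[symmetric]) measurable
  also have "\<dots> \<le> (\<integral>\<^sup>+x. ennreal (2 ^ n * (2 * sqrt (p / n) powr p)) \<partial>\<sigma>)"
  proof (rule nn_integral_mono)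
    fix x assume "x \<in> space \<sigma>"
    then have x: "nrm n x = 1" by (simp add: space_sigma unit_sphere_def)
    have "(\<Sum>e\<in>signs n. \<bar>dot n x (vscale n ?r e)\<bar> powr p) = ?r powr p * (\<Sum>e\<in>signs n. \<bar>dot n x e\<bar> powr p)"
      by (simp add: dot_vscale_right abs_mult sum_distrib_left powr_mult[symmetric])
    also have "\<dots> \<le> ?r powr p * (2 ^ n * (2 * sqrt p powr p))"
      by (intro mult_left_mono khinchine p x) simp
    also have "\<dots> = 2 ^ n * (2 * sqrt (p / n) powr p)"
      using p by (simp add: real_sqrt_divide powr_divide)
    finally show "(\<Sum>e\<in>signs n. ennreal (\<bar>dot n x (vscale n ?r e)\<bar> powr p)) \<le> ennreal (2 ^ n * (2 * sqrt (p / n) powr p))"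
      by (simp add: sum_ennreal ennreal_leI)
  qed
  also have "\<dots> = ennreal (2 ^ n) * ennreal (2 * sqrt (p / n) powr p)"
    by (simp add: emeasure_space_1 ennreal_mult)
  also have "of_nat (2 ^ n) = ennreal (2 ^ n)" by (simp add: ennreal_of_nat_eq_real_of_nat)
  finally have "ennreal (2 ^ n) * ?I \<le> ennreal (2 ^ n) * ennreal (2 * sqrt (p / n) powr p)" .
  then have "ennreal (1 / 2 ^ n) * (ennreal (2 ^ n) * ?I) \<le> ennreal (1 / 2 ^ n) * (ennreal (2 ^ n) * ennreal (2 * sqrt (p / n) powr p))"
    by (rule mult_left_mono) simp
  moreover have "ennreal (1 / 2 ^ n) * ennreal (2 ^ n) = 1" by (simp flip: ennreal_mult)
  ultimately show ?thesis by (simp flip: mult.assoc)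
qed

text \<open>Three ranges: the second moment for p <= 2, random signs for 2 < p <= n, and for larger
  p the trivial bound |<x,a>| <= 1, which is why p_0 may stop at n.\<close>

lemma moment_sphere_unit:
  assumes p: "0 < p" and a: "a \<in> unit_sphere n"
  shows "(\<integral>\<^sup>+x. ennreal (\<bar>dot n x a\<bar> powr p) \<partial>\<sigma>) \<le> ennreal ((2 * sqrt (max 1 (min p n) / n)) powr p)"
proof (cases "p \<le> 2")
  case True
  have "(1 / sqrt n) powr p \<le> (2 * sqrt (max 1 (min p n) / n)) powr p"
  proof (rule powr_mono2)
    have "sqrt (1 / n) \<le> sqrt (max 1 (min p n) / n)" by (intro real_sqrt_le_mono divide_right_mono) auto
    also have "\<dots> \<le> 2 * sqrt (max 1 (min p n) / n)" by simp
    finally show "1 / sqrt n \<le> 2 * sqrt (max 1 (min p n) / n)" by (simp only: real_sqrt_divide real_sqrt_one)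
  qed (use p in auto)
  with moment_sphere_small[OF p True a] show ?thesis by (meson ennreal_leI order_trans)
next
  case False
  \<comment> \<open>Moves the factor 2 of \<open>moment_sphere_signs\<close> inside the p-th
    power.\<close>
  have two: "2 \<le> 2 powr p" using False powr_mono[of 1 p 2] by simp
  show ?thesis
  proof (cases "p \<le> n")
    case True
    then have "max 1 (min p n) = p" using False by simp
    moreover have "2 * sqrt (p / n) powr p \<le> (2 * sqrt (p / n)) powr p"
      using two p by (subst powr_mult) (auto intro!: mult_right_mono)
    ultimately show ?thesis
      using moment_sphere_signs[OF p a] by (metis ennreal_leI order_trans)
  next
    case pn: False
    then have one: "max 1 (min p n) / n = 1" using dim_pos by simp
    have "(\<integral>\<^sup>+x. ennreal (\<bar>dot n x a\<bar> powr p) \<partial>\<sigma>) \<le> (\<integral>\<^sup>+x. 1 \<partial>\<sigma>)"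
    proof (rule nn_integral_mono)
      fix x assume "x \<in> space \<sigma>"
      then have "\<bar>dot n x a\<bar> \<le> 1" using a abs_dot_le[of n x a] by (simp add: space_sigma unit_sphere_def)
      then have "\<bar>dot n x a\<bar> powr p \<le> 1 powr p" using p by (intro powr_mono2) auto
      then show "ennreal (\<bar>dot n x a\<bar> powr p) \<le> 1" by (simp add: ennreal_le_1)
    qed
    also have "\<dots> = ennreal 1" by (simp add: emeasure_space_1)
    also have "\<dots> \<le> ennreal (2 powr p)" using two by (intro ennreal_leI) simp
    finally show ?thesis by (simp only: one real_sqrt_one mult_1_right)
  qed
qed

lemma moment_sphere:
  assumes p: "0 < p" and y: "y \<in> Rn n"
  shows "(\<integral>\<^sup>+x. ennreal (\<bar>dot n x y\<bar> powr p) \<partial>\<sigma>)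
    \<le> ennreal ((2 * sqrt (max 1 (min p n) / n)) powr p) * ennreal (nrm n y powr p)"
proof (cases "nrm n y = 0")
  case True
  then have "dot n x y = 0" for x using abs_dot_le[of n x y] by simp
  with p show ?thesis by simp
next
  case False
  let ?a = "vscale n (1 / nrm n y) y"
  have a: "?a \<in> unit_sphere n" using False by (simp add: unit_sphere_def nrm_vscale)
  have "\<bar>dot n x y\<bar> powr p = nrm n y powr p * \<bar>dot n x ?a\<bar> powr p" for x
    using False by (simp add: dot_vscale_right abs_mult powr_mult[symmetric])
  then have "(\<integral>\<^sup>+x. ennreal (\<bar>dot n x y\<bar> powr p) \<partial>\<sigma>) = ennreal (nrm n y powr p) * (\<integral>\<^sup>+x. ennreal (\<bar>dot n x ?a\<bar> powr p) \<partial>\<sigma>)"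
    by (simp add: ennreal_mult nn_integral_cmult)
  also have "\<dots> \<le> ennreal (nrm n y powr p) * ennreal ((2 * sqrt (max 1 (min p n) / n)) powr p)"
    by (intro mult_left_mono moment_sphere_unit p a) simp
  finally show ?thesis by (simp add: mult.commute)
qed

end

section \<open>Comparison with the mean of the norm\<close>

lemma minkowski_le_1:
  assumes "x \<in> L" "L \<subseteq> Rn n"
  shows "minkowski n L x \<le> 1"
  unfolding minkowski_def
proof (rule cInf_lower)
  have "x = vscale n 1 x" using assms by (auto simp: vscale_one)
  then show "1 \<in> {t. 0 \<le> t \<and> x \<in> vscale n t ` L}" using assms by auto
qed (auto intro: bdd_belowI)

text \<open>Boundedness of \<open>L\<close> keeps its gauge away from 0 on the sphere, which yields
  M_p(L) > 0 and a lower bound for the logarithm. Positivity of the radial function makes the set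
  under the infimum nonempty.\<close>

lemma minkowski_sphere_ge:
  assumes L: "star_body n L" and R: "\<And>z. z \<in> L \<Longrightarrow> nrm n z \<le> R" "0 < R" and x: "x \<in> unit_sphere n"
  shows "1 / R \<le> minkowski n L x"
  unfolding minkowski_def
proof (rule cInf_greatest)
  have x': "x \<in> Rn n" "nrm n x = 1" using x by (auto simp: unit_sphere_def)
  show "{t. 0 \<le> t \<and> x \<in> vscale n t ` L} \<noteq> {}"
  proof -
    have "\<exists>r>0. vscale n r x \<in> L"
    proof (rule ccontr)
      assume no: "\<not> (\<exists>r>0. vscale n r x \<in> L)"
      obtain z where "z \<in> L" using L by (auto simp: star_body_def)
      then have "vscale n 0 z \<in> L" using L unfolding star_body_def by (metis atLeastAtMost_iff image_subset_iff order_refl zero_le_one)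
      then have "vscale n 0 x \<in> L" by (simp add: vscale_def)
      then have "{r. 0 \<le> r \<and> vscale n r x \<in> L} = {0}" using no by (auto simp: less_le)
      then have "radial n L x = 0" by (simp add: radial_def)
      moreover have "0 < radial n L x" using L x by (auto simp: star_body_def)
      ultimately show False by simp
    qed
    then obtain r where r: "0 < r" "vscale n r x \<in> L" by blast
    have "x = vscale n (1 / r) (vscale n r x)" using r x' by (simp add: vscale_vscale vscale_one)
    then have "x \<in> vscale n (1 / r) ` L" using r by blast
    then have "1 / r \<in> {t. 0 \<le> t \<and> x \<in> vscale n t ` L}" using r by simp
    then show ?thesis by blast
  qed
  fix t assume "t \<in> {t. 0 \<le> t \<and> x \<in> vscale n t ` L}"
  then obtain z where z: "0 \<le> t" "z \<in> L" "x = vscale n t z" by auto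
  then have "1 = t * nrm n z" using x'(2) nrm_vscale[of n t z] by simp
  also have "\<dots> \<le> t * R" using z R by (intro mult_left_mono) auto
  finally show "1 / R \<le> t" using R by (simp add: field_simps)
qed

text \<open>A linear map into \<open>L\<^sub>p\<close> is almost everywhere \<open>x \<mapsto> \<langle>x, w t\<rangle>\<close>, where \<open>w t\<close> collects the images of
  the basis vectors; integrating against \<open>w\<close> replaces the spherical measure \<open>\<mu>\<^sub>L\<close>.\<close>

lemma SL_pos_representation:
  assumes L: "L \<in> SL_pos n p" and p: "0 < p"
  obtains w where "w \<in> measurable (lebesgue_on {0..1::real}) (lebn n)"
    "\<And>x. x \<in> Rn n \<Longrightarrow> ennreal (minkowski n L x powr p) = (\<integral>\<^sup>+t. ennreal (\<bar>dot n x (w t)\<bar> powr p) \<partial>lebesgue_on {0..1})"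
    "\<And>x. x \<in> Rn n \<Longrightarrow> 0 \<le> minkowski n L x"
proof -
  let ?I = "lebesgue_on {0..1::real}"
  obtain J where J: "linear_to_Lp n p J" "\<And>x. x \<in> Rn n \<Longrightarrow> minkowski n L x = Lp_norm p (J x)"
    using L by (auto simp: SL_pos_def)
  have Lp: "in_Lp p (J x)" if "x \<in> Rn n" for x using J(1) that by (auto simp: linear_to_Lp_def)
  define w where "w = (\<lambda>t. \<lambda>i\<in>{..<n}. J (basis n i) t)"
  have w: "w \<in> measurable ?I (lebn n)"
    unfolding w_def by (rule measurable_restrict_lebn) (use Lp in \<open>auto simp: in_Lp_def\<close>)
  \<comment> \<open>Additivity holds almost everywhere for each pair, so the coordinates are added
    one at a time. The null set may depend on \<open>x\<close>: the equation is only integrated over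
    t with \<open>x\<close> fixed.\<close>
  have AE: "AE t in ?I. J x t = dot n x (w t)" if x: "x \<in> Rn n" for x
  proof -
    have "AE t in ?I. J (\<lambda>i\<in>{..<n}. if i < k then x i else 0) t = (\<Sum>j<k. x j * J (basis n j) t)" if "k \<le> n" for k
      using that
    proof (induction k)
      case 0
      have "AE t in ?I. J (vscale n 0 x) t = 0 * J x t" using J(1) x unfolding linear_to_Lp_def by blast
      moreover have eq: "(\<lambda>i\<in>{..<n}. if i < 0 then x i else 0) = vscale n 0 x" by (simp add: vscale_def)
      ultimately show ?case unfolding eq by simp
    next
      case (Suc k)
      let ?y = "\<lambda>i\<in>{..<n}. if i < k then x i else 0"
      have eq: "(\<lambda>i\<in>{..<n}. if i < Suc k then x i else 0) = vadd n ?y (vscale n (x k) (basis n k))"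
        using Suc.prems by (intro Rn_eqI[of _ n]) (auto simp: vadd_def vscale_def basis_def less_Suc_eq)
      have "AE t in ?I. J ?y t = (\<Sum>j<k. x j * J (basis n j) t)" by (rule Suc.IH) (use Suc.prems in simp)
      moreover have "AE t in ?I. J (vadd n ?y (vscale n (x k) (basis n k))) t = J ?y t + J (vscale n (x k) (basis n k)) t"
        using J(1) restrict_in_Rn vscale_in unfolding linear_to_Lp_def by blast
      moreover have "AE t in ?I. J (vscale n (x k) (basis n k)) t = x k * J (basis n k) t"
        using J(1) basis_in unfolding linear_to_Lp_def by blast
      ultimately show ?case unfolding eq by eventually_elim simp
    qed
    from this[of n] have "AE t in ?I. J (\<lambda>i\<in>{..<n}. if i < n then x i else 0) t = (\<Sum>j<n. x j * J (basis n j) t)" by blast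
    moreover have "(\<lambda>i\<in>{..<n}. if i < n then x i else 0) = x" using x by (intro Rn_eqI[of _ n]) auto
    moreover have "(\<Sum>j<n. x j * J (basis n j) t) = dot n x (w t)" for t by (simp add: dot_def w_def)
    ultimately show ?thesis by simp
  qed
  show thesis
  proof (rule that[OF w])
    fix x assume x: "x \<in> Rn n"
    show "0 \<le> minkowski n L x" by (simp add: J(2)[OF x] Lp_norm_def)
    have "0 \<le> (LINT t|?I. \<bar>J x t\<bar> powr p)" by (rule Bochner_Integration.integral_nonneg) simp
    then have "minkowski n L x powr p = (LINT t|?I. \<bar>J x t\<bar> powr p)"
      using p by (simp add: J(2)[OF x] Lp_norm_def powr_powr)
    then have "ennreal (minkowski n L x powr p) = (\<integral>\<^sup>+t. ennreal (\<bar>J x t\<bar> powr p) \<partial>?I)"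
      using Lp[OF x] by (subst nn_integral_eq_integral) (auto simp: in_Lp_def)
    also have "\<dots> = (\<integral>\<^sup>+t. ennreal (\<bar>dot n x (w t)\<bar> powr p) \<partial>?I)"
      by (rule nn_integral_cong_AE) (use AE[OF x] in \<open>eventually_elim, simp\<close>)
    finally show "ennreal (minkowski n L x powr p) = (\<integral>\<^sup>+t. ennreal (\<bar>dot n x (w t)\<bar> powr p) \<partial>?I)" .
  qed
qed

locale slicing = isotropic_body n K v R + haar n \<sigma> for n K v R \<sigma>
begin

text \<open>The two averages meet in W, the integral of |w(t)|^p: the body gives D^p W <= 1 and the
  sphere gives M_p(L)^p <= B^p W. Positivity of the mean is part of the claim because a quotient by
  0 would be 0.\<close>

lemma M_mean_pos_bound:
  assumes L: "L \<in> SL_pos n p" and p: "0 < p" and KL: "K \<subseteq> L"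
  shows "0 < M_mean n \<sigma> p L \<and> s * sqrt n * M_mean n \<sigma> p L \<le> 2 * exp 2 * sqrt (max 1 (min p n))"
proof -
  let ?I = "lebesgue_on {0..1::real}"
  have star: "star_body n L" using L by (simp add: SL_pos_def)
  then have "compactin (topn n) L" by (simp add: star_body_def)
  then obtain r where r: "0 < r" "\<And>z. z \<in> L \<Longrightarrow> nrm n z \<le> r" and Lsub: "L \<subseteq> Rn n"
    using compactin_topn[of n L] by blast
  obtain w where w[measurable]: "w \<in> measurable ?I (lebn n)"
    and mink: "\<And>x. x \<in> Rn n \<Longrightarrow> ennreal (minkowski n L x powr p) = (\<integral>\<^sup>+t. ennreal (\<bar>dot n x (w t)\<bar> powr p) \<partial>?I)"
    and mink0: "\<And>x. x \<in> Rn n \<Longrightarrow> 0 \<le> minkowski n L x"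
    using SL_pos_representation[OF L p] by blast
  have w_in: "w t \<in> Rn n" if "t \<in> space ?I" for t
    using measurable_space[OF w that] by (simp add: space_lebn)
  interpret I: finite_measure ?I by (rule finite_measure_lebesgue_on) simp
  interpret UI: pair_sigma_finite unif ?I ..
  interpret SI: pair_sigma_finite \<sigma> ?I ..
  have sigma_Rn: "x \<in> Rn n" if "x \<in> space \<sigma>" for x using that by (simp add: space_sigma unit_sphere_def)
  define W where "W = (\<integral>\<^sup>+t. ennreal (nrm n (w t) powr p) \<partial>?I)"
  define B where "B = 2 * sqrt (max 1 (min p n) / n)"
  define D where "D = exp (- 2) * s"
  have D: "0 < D" using s_pos by (simp add: D_def)
  have B: "0 < B" using dim_pos by (simp add: B_def)
  have nrmw[measurable]: "(\<lambda>t. nrm n (w t)) \<in> borel_measurable ?I"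
    using measurable_compose[OF w nrm_measurable] .
  have "ennreal (D powr p) * W = (\<integral>\<^sup>+t. ennreal ((D * nrm n (w t)) powr p) \<partial>?I)"
    unfolding W_def using D by (simp add: powr_mult ennreal_mult nn_integral_cmult)
  also have "\<dots> \<le> (\<integral>\<^sup>+t. (\<integral>\<^sup>+x. ennreal (\<bar>dot n x (w t)\<bar> powr p) \<partial>unif) \<partial>?I)"
    unfolding D_def using w_in by (intro nn_integral_mono moment_dot_ge p) auto
  also have "\<dots> = (\<integral>\<^sup>+x. (\<integral>\<^sup>+t. ennreal (\<bar>dot n x (w t)\<bar> powr p) \<partial>?I) \<partial>unif)"
    by (rule UI.Fubini') measurable
  also have "\<dots> \<le> (\<integral>\<^sup>+x. 1 \<partial>unif)"
  proof (rule nn_integral_mono_AE, rule AE_unif)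
    fix x assume x: "x \<in> K"
    then have "minkowski n L x \<le> 1" "x \<in> Rn n" using KL Lsub by (auto intro: minkowski_le_1)
    then have "minkowski n L x powr p \<le> 1 powr p" using mink0 p by (intro powr_mono2) auto
    then have "ennreal (minkowski n L x powr p) \<le> 1" by (simp add: ennreal_le_1)
    then show "(\<integral>\<^sup>+t. ennreal (\<bar>dot n x (w t)\<bar> powr p) \<partial>?I) \<le> 1" using mink[OF \<open>x \<in> Rn n\<close>] by simp
  qed
  also have "\<dots> = 1" by (simp add: unif.emeasure_space_1[simplified])
  finally have "ennreal (D powr p) * W \<le> 1" .
  then have "ennreal (1 / D powr p) * (ennreal (D powr p) * W) \<le> ennreal (1 / D powr p) * 1"
    by (rule mult_left_mono) simp
  moreover have "ennreal (1 / D powr p) * ennreal (D powr p) = 1" using D by (simp flip: ennreal_mult)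
  ultimately have W: "W \<le> ennreal (1 / D powr p)" by (simp flip: mult.assoc)
  define A where "A = (LINT x|\<sigma>. minkowski n L x powr p)"
  have nn: "(\<integral>\<^sup>+x. ennreal (minkowski n L x powr p) \<partial>\<sigma>) = (\<integral>\<^sup>+x. (\<integral>\<^sup>+t. ennreal (\<bar>dot n x (w t)\<bar> powr p) \<partial>?I) \<partial>\<sigma>)"
    by (rule nn_integral_cong) (simp add: mink sigma_Rn)
  also have "\<dots> = (\<integral>\<^sup>+t. (\<integral>\<^sup>+x. ennreal (\<bar>dot n x (w t)\<bar> powr p) \<partial>\<sigma>) \<partial>?I)"
    by (rule SI.Fubini'[symmetric]) measurable
  also have "\<dots> \<le> (\<integral>\<^sup>+t. ennreal (B powr p) * ennreal (nrm n (w t) powr p) \<partial>?I)"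
    unfolding B_def using w_in by (intro nn_integral_mono moment_sphere p) auto
  also have "\<dots> = ennreal (B powr p) * W" by (simp add: W_def nn_integral_cmult)
  also have "\<dots> \<le> ennreal (B powr p) * ennreal (1 / D powr p)" by (rule mult_left_mono[OF W]) simp
  also have "\<dots> = ennreal ((B / D) powr p)" using B D by (simp add: powr_divide flip: ennreal_mult)
  finally have le: "(\<integral>\<^sup>+x. ennreal (minkowski n L x powr p) \<partial>\<sigma>) \<le> ennreal ((B / D) powr p)" .
  \<comment> \<open>Measurability of the gauge is read off from its integral representation.\<close>
  have meas: "(\<lambda>x. minkowski n L x powr p) \<in> borel_measurable \<sigma>"
  proof (subst measurable_cong)
    show "minkowski n L x powr p = enn2real (\<integral>\<^sup>+t. ennreal (\<bar>dot n x (w t)\<bar> powr p) \<partial>?I)" if "x \<in> space \<sigma>" for x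
      by (simp flip: mink[OF sigma_Rn[OF that]])
  qed measurable
  have int: "integrable \<sigma> (\<lambda>x. minkowski n L x powr p)"
    by (rule integrableI_nonneg[OF meas]) (use le in \<open>auto intro: le_less_trans\<close>)
  have "ennreal A = (\<integral>\<^sup>+x. ennreal (minkowski n L x powr p) \<partial>\<sigma>)"
    unfolding A_def by (rule nn_integral_eq_integral[symmetric, OF int]) simp
  with le have Ale: "A \<le> (B / D) powr p" by (metis ennreal_le_iff powr_ge_zero)
  have "(LINT x|\<sigma>. (1 / r) powr p) \<le> A"
    unfolding A_def
  proof (rule integral_mono[OF _ int])
    fix x assume "x \<in> space \<sigma>"
    then have "1 / r \<le> minkowski n L x" by (intro minkowski_sphere_ge star r) (simp_all add: space_sigma)
    then show "(1 / r) powr p \<le> minkowski n L x powr p" using r p by (intro powr_mono2) auto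
  qed simp
  then have "(1 / r) powr p \<le> A" by (simp add: prob_space)
  moreover have "0 < (1 / r) powr p" using r by simp
  ultimately have Apos: "0 < A" by linarith
  have M: "M_mean n \<sigma> p L = A powr (1 / p)" using p by (simp add: M_mean_def A_def)
  have "A powr (1 / p) \<le> ((B / D) powr p) powr (1 / p)" using Ale Apos p by (intro powr_mono2) auto
  also have "\<dots> = B / D" using p B D by (simp add: powr_powr)
  finally have "D * M_mean n \<sigma> p L \<le> B" unfolding M using D by (simp add: field_simps)
  then have "exp 2 * sqrt n * (D * M_mean n \<sigma> p L) \<le> exp 2 * sqrt n * B" by (intro mult_left_mono) auto
  moreover have "exp 2 * sqrt n * (D * M_mean n \<sigma> p L) = s * sqrt n * M_mean n \<sigma> p L"
  proof -
    have "exp 2 * exp (- 2) = (1 :: real)" by (simp add: exp_minus)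
    then show ?thesis unfolding D_def by (metis (no_types, opaque_lifting) mult.assoc mult.commute mult.left_neutral)
  qed
  moreover have "exp 2 * sqrt n * B = 2 * exp 2 * sqrt (max 1 (min p n))"
    using dim_pos by (simp add: B_def real_sqrt_divide)
  ultimately have "s * sqrt n * M_mean n \<sigma> p L \<le> 2 * exp 2 * sqrt (max 1 (min p n))" by (simp only:)
  then show ?thesis using Apos M by simp
qed

text \<open>The constant \<open>c\<close> links the two sides. On \<open>K\<close> the gauge is at
  most 1, so averaging its logarithm over \<open>K\<close> gives c + ln s <= 2; on the sphere
  Jensen's inequality bounds the mean logarithm by c - (ln n) / 2.\<close>

lemma M_mean_zero_bound:
  assumes L: "L \<in> SL_zero n" and KL: "K \<subseteq> L"
  shows "s * sqrt n * M_mean n \<sigma> 0 L \<le> exp 2"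
proof -
  have star: "star_body n L" using L by (simp add: SL_zero_def)
  then have "compactin (topn n) L" by (simp add: star_body_def)
  then obtain r where r: "0 < r" "\<And>z. z \<in> L \<Longrightarrow> nrm n z \<le> r" and Lsub: "L \<subseteq> Rn n"
    using compactin_topn[of n L] by blast
  obtain \<mu> c where mu: "prob_space \<mu>" "sets \<mu> = sets (sphere_borel n)"
    and H: "\<And>x. x \<in> Rn n - {vzero n} \<Longrightarrow> (AE \<theta> in \<mu>. dot n x \<theta> \<noteq> 0) \<and> integrable \<mu> (\<lambda>\<theta>. ln \<bar>dot n x \<theta>\<bar>) \<and>
           minkowski n L x = exp ((LINT \<theta>|\<mu>. ln \<bar>dot n x \<theta>\<bar>) + c)"
    using L unfolding SL_zero_def by blast
  interpret mu: prob_space \<mu> by fact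
  note sets_mu[measurable_cong] = mu(2)[unfolded sphere_borel_def]
  have space_mu: "space \<mu> = unit_sphere n"
    using sets_eq_imp_space_eq[OF sets_mu] by (auto simp: space_restrict_space space_lebn unit_sphere_def)
  have ident_mu[measurable]: "(\<lambda>x. x) \<in> measurable \<mu> (lebn n)"
    using measurable_restrict_space1[OF measurable_ident, of "lebn n" "unit_sphere n"]
      measurable_cong_sets[OF sets_mu refl, of "lebn n"] by (simp add: id_def)
  have ident_unif[measurable]: "(\<lambda>x. x) \<in> measurable unif (lebn n)"
    by (rule measurable_ident_sets) simp
  interpret UM: pair_sigma_finite unif \<mu> ..
  interpret SM: pair_sigma_finite \<sigma> \<mu> ..
  \<comment> \<open>Keeping only the negative part of the logarithm makes the integrand of the
    exchanged integrals nonnegative; ln |<x,theta>| >= ln s - \<open>?Z\<close> suffices, as a lower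
    bound is wanted.\<close>
  let ?Z = "\<lambda>x \<theta>. max 0 (- ln (\<bar>dot n x \<theta>\<bar> / s))"
  have c: "c + ln s \<le> 2"
  proof -
    have "ennreal (c + ln s) = (\<integral>\<^sup>+x. ennreal (c + ln s) \<partial>unif)"
      by (simp add: unif.emeasure_space_1[simplified])
    also have "\<dots> \<le> (\<integral>\<^sup>+x. (\<integral>\<^sup>+\<theta>. ennreal (?Z x \<theta>) \<partial>\<mu>) \<partial>unif)"
    proof (rule nn_integral_mono_AE)
      \<comment> \<open>The representation is available for nonzero \<open>x\<close> only, and 0 has
        probability 0.\<close>
      have "AE x in unif. x \<in> K" by (rule AE_unif)
      then show "AE x in unif. ennreal (c + ln s) \<le> (\<integral>\<^sup>+\<theta>. ennreal (?Z x \<theta>) \<partial>\<mu>)"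
        using AE_nonzero_unif
      proof eventually_elim
        case (elim x)
        then have x: "x \<in> Rn n - {vzero n}" using K_subset by auto
        note Hx = H[OF x]
        have int: "integrable \<mu> (\<lambda>\<theta>. ln \<bar>dot n x \<theta>\<bar>)" using Hx by simp
        have xm[measurable]: "(\<lambda>_. x) \<in> measurable \<mu> (lebn n)" using x by (intro const_measurable_lebn) simp
        have intZ: "integrable \<mu> (?Z x)"
        proof (rule Bochner_Integration.integrable_bound)
          show "integrable \<mu> (\<lambda>\<theta>. \<bar>ln \<bar>dot n x \<theta>\<bar>\<bar> + \<bar>ln s\<bar>)" using int by simp
          show "AE \<theta> in \<mu>. norm (?Z x \<theta>) \<le> norm (\<bar>ln \<bar>dot n x \<theta>\<bar>\<bar> + \<bar>ln s\<bar>)"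
            using conjunct1[OF Hx] by eventually_elim (use s_pos in \<open>auto simp: ln_div\<close>)
        qed measurable
        have "exp ((LINT \<theta>|\<mu>. ln \<bar>dot n x \<theta>\<bar>) + c) \<le> 1"
          using Hx minkowski_le_1[OF _ Lsub, of x] elim KL by auto
        then have "(LINT \<theta>|\<mu>. ln \<bar>dot n x \<theta>\<bar>) + c \<le> 0" by simp
        moreover have "(LINT \<theta>|\<mu>. ln s - ?Z x \<theta>) \<le> (LINT \<theta>|\<mu>. ln \<bar>dot n x \<theta>\<bar>)"
        proof (rule integral_mono_AE)
          show "AE \<theta> in \<mu>. ln s - ?Z x \<theta> \<le> ln \<bar>dot n x \<theta>\<bar>"
            using conjunct1[OF Hx] by eventually_elim (use s_pos in \<open>auto simp: ln_div\<close>)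
        qed (use int intZ in auto)
        ultimately have "c + ln s \<le> (LINT \<theta>|\<mu>. ?Z x \<theta>)" using intZ by (simp add: mu.prob_space)
        then have "ennreal (c + ln s) \<le> ennreal (LINT \<theta>|\<mu>. ?Z x \<theta>)" by (rule ennreal_leI)
        also have "\<dots> = (\<integral>\<^sup>+\<theta>. ennreal (?Z x \<theta>) \<partial>\<mu>)"
          by (rule nn_integral_eq_integral[symmetric, OF intZ]) simp
        finally show ?case .
      qed
    qed
    also have "\<dots> = (\<integral>\<^sup>+\<theta>. (\<integral>\<^sup>+x. ennreal (?Z x \<theta>) \<partial>unif) \<partial>\<mu>)"
      by (rule UM.Fubini'[symmetric]) measurable
    also have "\<dots> \<le> (\<integral>\<^sup>+\<theta>. 2 \<partial>\<mu>)"
      by (intro nn_integral_mono nn_integral_log_dot_le) (simp add: space_mu)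
    also have "\<dots> = ennreal 2" by (simp add: mu.emeasure_space_1)
    finally show ?thesis by (subst (asm) ennreal_le_iff) auto
  qed
  \<comment> \<open>The tangent line of ln at 1, evaluated at n <x,theta>^2, bounds the logarithm by
    a quadratic expression. Integrating over \<open>\<mu>\<close> gives \<open>g\<close>, whose
    spherical mean is 1 / n, so the linear term averages to 0.\<close>
  define g where "g = (\<lambda>x. LINT \<theta>|\<mu>. (dot n x \<theta>)\<^sup>2)"
  have S: "x \<in> Rn n - {vzero n}" if "x \<in> space \<sigma>" for x
  proof -
    have "x \<in> Rn n" "nrm n x = 1" using that by (auto simp: space_sigma unit_sphere_def)
    then show ?thesis using nrm_eq_0_iff[of x n] by auto
  qed
  have sq1: "(dot n x \<theta>)\<^sup>2 \<le> 1" if "x \<in> space \<sigma>" "\<theta> \<in> space \<mu>" for x \<theta>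
  proof -
    have "\<bar>dot n x \<theta>\<bar> \<le> 1" using abs_dot_le[of n x \<theta>] that by (simp add: space_sigma space_mu unit_sphere_def)
    then show ?thesis by (simp add: abs_square_le_1)
  qed
  have int_sq: "integrable \<mu> (\<lambda>\<theta>. (dot n x \<theta>)\<^sup>2)" if x: "x \<in> space \<sigma>" for x
  proof (rule mu.integrable_const_bound[where B = 1])
    have [measurable]: "(\<lambda>_. x) \<in> measurable \<mu> (lebn n)" using S[OF x] by (intro const_measurable_lebn) simp
    show "(\<lambda>\<theta>. (dot n x \<theta>)\<^sup>2) \<in> borel_measurable \<mu>" by measurable
  qed (use sq1[OF x] in auto)
  have g_meas[measurable]: "g \<in> borel_measurable \<sigma>" unfolding g_def by measurable
  have g01: "0 \<le> g x \<and> g x \<le> 1" if x: "x \<in> space \<sigma>" for x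
  proof -
    have "g x \<le> (LINT \<theta>|\<mu>. 1)" unfolding g_def by (rule integral_mono) (use int_sq[OF x] sq1[OF x] in auto)
    then show ?thesis by (simp add: g_def mu.prob_space)
  qed
  have int_g: "integrable \<sigma> g"
    by (rule integrable_const_bound[where B = 1]) (use g01 in auto)
  have "(LINT x|\<sigma>. g x) = 1 / n"
  proof -
    have "ennreal (LINT x|\<sigma>. g x) = (\<integral>\<^sup>+x. ennreal (g x) \<partial>\<sigma>)"
      by (rule nn_integral_eq_integral[symmetric, OF int_g]) (use g01 in auto)
    also have "\<dots> = (\<integral>\<^sup>+x. (\<integral>\<^sup>+\<theta>. ennreal ((dot n x \<theta>)\<^sup>2) \<partial>\<mu>) \<partial>\<sigma>)"
      unfolding g_def by (rule nn_integral_cong) (simp add: nn_integral_eq_integral[OF int_sq])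
    also have "\<dots> = (\<integral>\<^sup>+\<theta>. (\<integral>\<^sup>+x. ennreal ((dot n x \<theta>)\<^sup>2) \<partial>\<sigma>) \<partial>\<mu>)"
      by (rule SM.Fubini'[symmetric]) measurable
    also have "\<dots> = (\<integral>\<^sup>+\<theta>. ennreal (1 / n) \<partial>\<mu>)"
      by (rule nn_integral_cong) (simp add: space_mu second_moment_sphere)
    also have "\<dots> = ennreal (1 / n)" by (simp add: mu.emeasure_space_1)
    finally have "ennreal (LINT x|\<sigma>. g x) = ennreal (1 / n)" .
    moreover have "0 \<le> (LINT x|\<sigma>. g x)" by (rule Bochner_Integration.integral_nonneg) (simp add: g_def)
    ultimately show ?thesis by simp
  qed
  have ln_mink: "ln (minkowski n L x) = (LINT \<theta>|\<mu>. ln \<bar>dot n x \<theta>\<bar>) + c" if "x \<in> space \<sigma>" for x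
    using H[OF S[OF that]] by simp
  have upper: "ln (minkowski n L x) \<le> (n * g x - 1) / 2 - ln n / 2 + c" if x: "x \<in> space \<sigma>" for x
  proof -
    have "(LINT \<theta>|\<mu>. ln \<bar>dot n x \<theta>\<bar>) \<le> (LINT \<theta>|\<mu>. (n * (dot n x \<theta>)\<^sup>2 - 1) / 2 - ln n / 2)"
    proof (rule integral_mono_AE)
      show "AE \<theta> in \<mu>. ln \<bar>dot n x \<theta>\<bar> \<le> (n * (dot n x \<theta>)\<^sup>2 - 1) / 2 - ln n / 2"
        using conjunct1[OF H[OF S[OF x]]]
      proof eventually_elim
        case (elim \<theta>)
        have "ln (n * (dot n x \<theta>)\<^sup>2) \<le> n * (dot n x \<theta>)\<^sup>2 - 1" using elim dim_pos by (intro ln_le_minus_one) simp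
        moreover have "ln (n * (dot n x \<theta>)\<^sup>2) = ln n + 2 * ln \<bar>dot n x \<theta>\<bar>"
        proof -
          have "ln ((dot n x \<theta>)\<^sup>2) = 2 * ln \<bar>dot n x \<theta>\<bar>"
            using ln_realpow[of "\<bar>dot n x \<theta>\<bar>" 2] elim by simp
          then show ?thesis using elim dim_pos by (subst ln_mult) auto
        qed
        moreover have "b \<le> (q - 1) / 2 - a / 2" if "l \<le> q - 1" "l = a + 2 * b" for a b l q :: real
          using that by argo
        ultimately show ?case by blast
      qed
    qed (use H[OF S[OF x]] int_sq[OF x] in auto)
    also have "\<dots> = (n * g x - 1) / 2 - ln n / 2"
      using int_sq[OF x] by (simp add: g_def mu.prob_space)
    finally show ?thesis by (simp add: ln_mink[OF x])
  qed
  \<comment> \<open>Without integrability the mean logarithm would be 0 by convention; the gauge is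
    bounded below on the sphere because \<open>L\<close> is bounded, and its logarithm is bounded
    above through \<open>g\<close>.\<close>
  have int_mink: "integrable \<sigma> (\<lambda>x. ln (minkowski n L x))"
  proof (rule integrable_const_bound[where B = "\<bar>ln (1 / r)\<bar> + \<bar>c\<bar> + n"])
    show "AE x in \<sigma>. norm (ln (minkowski n L x)) \<le> \<bar>ln (1 / r)\<bar> + \<bar>c\<bar> + n"
    proof (rule AE_I2)
      fix x assume x: "x \<in> space \<sigma>"
      have "1 / r \<le> minkowski n L x" using x by (intro minkowski_sphere_ge star r) (simp_all add: space_sigma)
      moreover have "0 < 1 / r" using r by simp
      ultimately have "ln (1 / r) \<le> ln (minkowski n L x)" by (metis ln_le_cancel_iff less_le_trans)
      moreover have "ln (minkowski n L x) \<le> n + \<bar>c\<bar>"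
      proof -
        have "real n * g x \<le> real n * 1" using g01[OF x] by (intro mult_left_mono) auto
        moreover have "0 \<le> ln n" using dim_pos by simp
        moreover have "y \<le> m + \<bar>c\<bar>" if "q \<le> m * 1" "0 \<le> l" "y \<le> (q - 1) / 2 - l / 2 + c" "0 \<le> m" for y q l m :: real
          using that by (simp add: field_simps)
        ultimately show ?thesis using upper[OF x] by simp
      qed
      ultimately show "norm (ln (minkowski n L x)) \<le> \<bar>ln (1 / r)\<bar> + \<bar>c\<bar> + n" by auto
    qed
    show "(\<lambda>x. ln (minkowski n L x)) \<in> borel_measurable \<sigma>"
      by (subst measurable_cong[OF ln_mink]) measurable
  qed
  have "(LINT x|\<sigma>. ln (minkowski n L x)) \<le> (LINT x|\<sigma>. (n * g x - 1) / 2 - ln n / 2 + c)"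
    by (rule integral_mono) (use int_mink int_g upper in auto)
  also have "\<dots> = - ln n / 2 + c"
    using int_g \<open>(LINT x|\<sigma>. g x) = 1 / n\<close> dim_pos by (simp add: prob_space)
  finally have "M_mean n \<sigma> 0 L \<le> exp (c - ln n / 2)" by (simp add: M_mean_def)
  then have "s * sqrt n * M_mean n \<sigma> 0 L \<le> s * sqrt n * exp (c - ln n / 2)"
    using s_pos by (intro mult_left_mono) auto
  also have "\<dots> = exp (ln s + ln (sqrt n) + (c - ln n / 2))"
    using s_pos dim_pos by (simp add: exp_add)
  also have "\<dots> = exp (c + ln s)" using dim_pos by (simp add: ln_sqrt)
  also have "\<dots> \<le> exp 2" using c by simp
  finally show ?thesis .
qed

text \<open>Both cases fit the factor 2 e^2, with p_0 = 1 at p = 0, and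
  \<open>isotropic_const_bound\<close> halves it.\<close>

lemma isotropic_const_le_quotient:
  assumes L: "L \<in> SL n p" and p: "0 \<le> p" and KL: "K \<subseteq> L"
  shows "isotropic_const n K \<le> exp 2 * (sqrt (max 1 (min p n)) / M_mean n \<sigma> p L)"
proof -
  have "0 < M_mean n \<sigma> p L \<and> s * sqrt n * M_mean n \<sigma> p L \<le> 2 * exp 2 * sqrt (max 1 (min p n))"
  proof (cases "p = 0")
    case True
    have "s * sqrt n * M_mean n \<sigma> 0 L \<le> exp 2" using M_mean_zero_bound L KL True by (simp add: SL_def)
    moreover have "0 < M_mean n \<sigma> 0 L" by (simp add: M_mean_def)
    moreover have "exp 2 \<le> 2 * (exp 2 :: real)" by simp
    ultimately have "0 < M_mean n \<sigma> 0 L \<and> s * sqrt n * M_mean n \<sigma> 0 L \<le> 2 * exp 2" by linarith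
    then show ?thesis using True by simp
  next
    case False
    then show ?thesis using M_mean_pos_bound L KL p by (simp add: SL_def)
  qed
  then have "s * sqrt n / 2 \<le> exp 2 * (sqrt (max 1 (min p n)) / M_mean n \<sigma> p L)"
    by (simp add: field_simps)
  with isotropic_const_bound show ?thesis by linarith
qed

end

section \<open>Euclidean balls as members of \<open>SL n 2\<close>\<close>

definition rball :: "nat \<Rightarrow> real \<Rightarrow> (nat \<Rightarrow> real) set" where
  "rball n r = {x \<in> Rn n. nrm n x \<le> r}"

lemma rball_scaled:
  assumes "0 < r" "0 \<le> t" "x \<in> Rn n"
  shows "x \<in> vscale n t ` rball n r \<longleftrightarrow> nrm n x / r \<le> t"
proof
  assume "x \<in> vscale n t ` rball n r"
  then obtain z where "nrm n z \<le> r" "x = vscale n t z" by (auto simp: rball_def)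
  then have "nrm n x \<le> t * r" using assms by (simp add: nrm_vscale mult_left_mono)
  then show "nrm n x / r \<le> t" using assms by (simp add: field_simps)
next
  assume le: "nrm n x / r \<le> t"
  show "x \<in> vscale n t ` rball n r"
  proof (cases "t = 0")
    case True
    then have "nrm n x = 0" using le assms by (simp add: field_simps) (simp add: antisym)
    then have "x = vscale n t (vzero n)" using nrm_eq_0_iff[OF assms(3)] True by (simp add: vscale_def vzero_def)
    moreover have "vzero n \<in> rball n r" using assms nrm_eq_0_iff[of "vzero n" n] by (simp add: rball_def)
    ultimately show ?thesis by blast
  next
    case False
    then have "x = vscale n t (vscale n (1 / t) x)" using assms by (simp add: vscale_vscale vscale_one)
    moreover have "vscale n (1 / t) x \<in> rball n r"
      using False le assms by (simp add: rball_def nrm_vscale field_simps)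
    ultimately show ?thesis by blast
  qed
qed

lemma minkowski_rball:
  assumes "0 < r" "x \<in> Rn n"
  shows "minkowski n (rball n r) x = nrm n x / r"
proof -
  have "0 \<le> nrm n x / r" using assms by simp
  then have "{t. 0 \<le> t \<and> x \<in> vscale n t ` rball n r} = {nrm n x / r..}"
    using rball_scaled[OF assms(1) _ assms(2)] by fastforce
  then show ?thesis by (simp add: minkowski_def)
qed

lemma compactin_rball: "compactin (topn n) (rball n r)"
proof (rule closed_compactin)
  show "compactin (topn n) (cube n r)" unfolding topn_def cube_def by (auto simp: compactin_PiE)
  show "rball n r \<subseteq> cube n r" by (auto simp: rball_def intro: mem_cubeI)
  have "continuous_map (topn n) euclideanreal (\<lambda>x. \<Sum>i<n. x i * x i)"
    unfolding topn_def
    by (intro continuous_map_sum continuous_map_real_mult continuous_map_product_projection) auto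
  then have "continuous_map (topn n) euclideanreal (nrm n)"
    unfolding L2_set_def[abs_def] power2_eq_square
    using continuous_map_compose[of "topn n" euclideanreal _ euclideanreal sqrt]
    by (auto simp: o_def continuous_on_real_sqrt)
  then have "closedin (topn n) {x \<in> topspace (topn n). nrm n x \<in> {..r}}"
    by (rule closedin_continuous_map_preimage) simp
  then show "closedin (topn n) (rball n r)" by (simp add: rball_def topspace_topn)
qed

lemma star_body_rball:
  assumes r: "0 < r"
  shows "star_body n (rball n r)"
proof -
  have rad: "radial n (rball n r) \<theta> = r" if "\<theta> \<in> unit_sphere n" for \<theta>
  proof -
    have "{t. 0 \<le> t \<and> vscale n t \<theta> \<in> rball n r} = {0..r}"
      using that by (auto simp: rball_def unit_sphere_def nrm_vscale)
    then show ?thesis using r by (simp add: radial_def)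
  qed
  have "vzero n \<in> rball n r" using r nrm_eq_0_iff[of "vzero n" n] by (simp add: rball_def)
  moreover have "symmetric_n n (rball n r)" by (rule symmetric_nI) (auto simp: rball_def nrm_vscale)
  moreover have "vscale n t ` rball n r \<subseteq> rball n r" if "t \<in> {0..1}" for t
  proof -
    have "t * nrm n x \<le> 1 * nrm n x" for x using that by (intro mult_right_mono) auto
    then have "t * nrm n x \<le> r" if "nrm n x \<le> r" for x using that by (metis mult_1 order_trans)
    then show ?thesis using that by (auto simp: rball_def nrm_vscale)
  qed
  moreover have "continuous_map (subtopology (topn n) (unit_sphere n)) euclideanreal (radial n (rball n r))"
    by (rule continuous_map_eq[of _ _ "\<lambda>_. r"]) (auto simp: rad)
  ultimately show ?thesis
    using r rad compactin_rball by (auto simp: star_body_def)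
qed

text \<open>Disjoint intervals give orthogonal functions in \<open>L\<^sub>2\<close>, hence an isometric copy of Euclidean space.\<close>

lemma rball_SL_2:
  assumes n: "1 \<le> n" and r: "0 < r"
  shows "rball n r \<in> SL n 2"
proof -
  let ?I = "lebesgue_on {0..1::real}"
  \<comment> \<open>Half-open intervals are exactly disjoint. In \<open>J\<close> the factor sqrt n
    compensates for their length 1 / n, and 1 / r accounts for the radius.\<close>
  define A where "A = (\<lambda>i. {real i / n ..< (real i + 1) / n})"
  define J where "J = (\<lambda>x t. \<Sum>i<n. sqrt n / r * x i * indicator (A i) t :: real)"
  have disj: "indicator (A i) t * indicator (A j) t = (if i = j then indicator (A i) t else 0 :: real)" for i j t
  proof (cases "t \<in> A i \<and> t \<in> A j")
    case True
    then have "real i \<le> t * n" "t * n < real i + 1" "real j \<le> t * n" "t * n < real j + 1"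
      using n by (auto simp: A_def field_simps)
    then have "i = j" by linarith
    with True show ?thesis by simp
  qed (auto simp: indicator_def)
  have sq: "\<bar>J x t\<bar> powr 2 = (\<Sum>i<n. n / r\<^sup>2 * (x i)\<^sup>2 * indicator (A i) t)" for x t
  proof -
    have "\<bar>J x t\<bar> powr 2 = J x t * J x t" by (simp add: powr_numeral power2_eq_square)
    also have "\<dots> = (\<Sum>i<n. \<Sum>j<n. (sqrt n / r * x i) * (sqrt n / r * x j) * (indicator (A i) t * indicator (A j) t))"
      unfolding J_def sum_product by (intro sum.cong refl) (simp only: mult_ac)
    also have "\<dots> = (\<Sum>i<n. (sqrt n / r * x i) * (sqrt n / r * x i) * indicator (A i) t)"
      unfolding disj by (simp add: if_distrib[of "(*) _"] cong: if_cong)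
    also have "\<dots> = (\<Sum>i<n. n / r\<^sup>2 * (x i)\<^sup>2 * indicator (A i) t)"
      by (intro sum.cong refl) (simp add: power2_eq_square)
    finally show ?thesis .
  qed
  have A_sets: "A i \<in> sets lebesgue" for i by (simp add: A_def)
  have A_meas: "A i \<in> sets ?I" "measure ?I (A i) = 1 / n" "emeasure ?I (A i) < \<infinity>" "A i \<inter> {0..1} = A i" if "i < n" for i
  proof -
    have sub: "A i \<subseteq> {0..1}"
    proof
      fix t assume "t \<in> A i"
      then have t: "real i / n \<le> t" "t < (real i + 1) / n" by (auto simp: A_def)
      have "(real i + 1) / n \<le> 1" using that n by simp
      moreover have "0 \<le> real i / n" by simp
      ultimately show "t \<in> {0..1}" using t by (simp only: atLeastAtMost_iff) linarith
    qed
    show "A i \<inter> {0..1} = A i" using sub by auto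
    show "A i \<in> sets ?I" using sub A_sets by (simp add: sets_restrict_space_iff)
    have "emeasure ?I (A i) = emeasure lebesgue (A i)" using sub by (simp add: emeasure_restrict_space)
    also have "\<dots> = ennreal (1 / n)" using n by (simp add: A_def divide_right_mono add_divide_distrib)
    finally show "measure ?I (A i) = 1 / n" "emeasure ?I (A i) < \<infinity>" using n by (auto simp: measure_def)
  qed
  have int: "integrable ?I (\<lambda>t. n / r\<^sup>2 * (x i)\<^sup>2 * indicator (A i) t)" if "i < n" for x i
    using A_meas[OF that] by (intro integrable_mult_right integrable_real_indicator) auto
  have Jm: "J x \<in> borel_measurable ?I" for x
    unfolding J_def using A_meas by (intro borel_measurable_sum borel_measurable_times borel_measurable_const borel_measurable_indicator) auto
  have "in_Lp 2 (J x)" for x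
    unfolding in_Lp_def sq using Jm by (intro conjI Bochner_Integration.integrable_sum int) auto
  moreover have "J (vadd n x y) t = J x t + J y t" for x y t
    by (simp add: J_def vadd_def sum.distrib[symmetric] algebra_simps add_divide_distrib)
  moreover have "J (vscale n a x) t = a * J x t" for a x t
    by (simp add: J_def vscale_def sum_distrib_left mult_ac)
  ultimately have "linear_to_Lp n 2 J" by (simp add: linear_to_Lp_def)
  moreover have "minkowski n (rball n r) x = Lp_norm 2 (J x)" if x: "x \<in> Rn n" for x
  proof -
    have "(LINT t|?I. \<bar>J x t\<bar> powr 2) = (\<Sum>i<n. LINT t|?I. n / r\<^sup>2 * (x i)\<^sup>2 * indicator (A i) t)"
      unfolding sq by (rule Bochner_Integration.integral_sum) (use int in auto)
    also have "\<dots> = (\<Sum>i<n. (x i)\<^sup>2 / r\<^sup>2)"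
      using A_meas n by (intro sum.cong refl) (simp add: sets_restrict_space_iff)
    also have "\<dots> = (nrm n x / r)\<^sup>2"
      unfolding power_divide nrm_squared dot_def by (simp add: sum_divide_distrib power2_eq_square)
    finally show ?thesis
      using minkowski_rball[OF r x] r by (simp add: Lp_norm_def powr_half_sqrt)
  qed
  ultimately show ?thesis using star_body_rball[OF r] by (auto simp: SL_def SL_pos_def)
qed

theorem theorem1:
  "\<exists>C::real. C > 0 \<and>
     (\<forall>n::nat. n \<ge> 1 \<longrightarrow>
       (\<forall>(\<sigma> :: (nat \<Rightarrow> real) measure) (K :: (nat \<Rightarrow> real) set).
          haar_sphere n \<sigma> \<longrightarrow> sym_convex_body n K \<longrightarrow> isotropic_position n K \<longrightarrow>
          vol n K = vol n (unit_ball n) \<longrightarrow>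
          isotropic_const n K \<le>
            C * Inf {sqrt (max 1 (min p (real n))) / M_mean n \<sigma> p L | (p::real) L.
                       K \<subseteq> L \<and> L \<in> SL n p \<and> p \<ge> 0}))"
proof (intro exI[of _ "exp 2"] conjI allI impI)
  fix n :: nat and \<sigma> :: "(nat \<Rightarrow> real) measure" and K :: "(nat \<Rightarrow> real) set"
  assume n: "1 \<le> n" and haar: "haar_sphere n \<sigma>" and body: "sym_convex_body n K"
    and iso: "isotropic_position n K" and vol: "vol n K = vol n (unit_ball n)"
  let ?Q = "{sqrt (max 1 (min p (real n))) / M_mean n \<sigma> p L | (p::real) L. K \<subseteq> L \<and> L \<in> SL n p \<and> p \<ge> 0}"
  have "compactin (topn n) K" using body by (simp add: sym_convex_body_def)
  then obtain R where K: "K \<in> sets (lebn n)" "K \<subseteq> Rn n" and R: "0 < R" "\<And>x. x \<in> K \<Longrightarrow> nrm n x \<le> R"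
    using compactin_topn(1,2)[of n K] compactin_topn(3)[of n K] by blast
  define v where "v = vol n (unit_ball n)"
  \<comment> \<open>\<open>vol\<close> is real-valued and reads an infinite measure as 0, so
    finiteness of both volumes is checked before they are compared.\<close>
  have ball: "emeasure (lebn n) (unit_ball n) = ennreal v"
    unfolding v_def vol_def by (rule emeasure_eq_ennreal_measure) (use emeasure_unit_ball(2)[OF n] in simp)
  have "emeasure (lebn n) K \<le> emeasure (lebn n) (cube n R)"
    by (rule emeasure_mono) (use K R in \<open>auto intro: mem_cubeI\<close>)
  also have "\<dots> < top" using R by (simp add: emeasure_cube)
  finally have "emeasure (lebn n) K = ennreal (vol n K)"
    unfolding vol_def by (intro emeasure_eq_ennreal_measure) simp
  then have eK: "emeasure (lebn n) K = ennreal v" by (simp add: v_def vol)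
  have v_pos: "0 < v"
  proof -
    have "0 < (2 / sqrt n) ^ n" using n by simp
    then have "0 < ennreal v" using emeasure_unit_ball(1)[OF n] unfolding ball by (metis ennreal_less_zero_iff less_le_trans)
    then show ?thesis by simp
  qed
  interpret slicing n K v R \<sigma>
    by unfold_locales (use n K eK v_pos ball R iso body haar in \<open>auto simp: sym_convex_body_def\<close>)
  have "isotropic_const n K / exp 2 \<le> Inf ?Q"
  \<comment> \<open>The set must be nonempty: the Euclidean ball of radius \<open>R\<close> contains
    \<open>K\<close> and contributes a quotient with p = 2.\<close>
  proof (rule cInf_greatest)
    have "K \<subseteq> rball n R" using K R by (auto simp: rball_def)
    then have "sqrt (max 1 (min 2 (real n))) / M_mean n \<sigma> 2 (rball n R) \<in> ?Q"
      using rball_SL_2[OF n R(1)] by (intro CollectI exI[of _ 2] exI[of _ "rball n R"]) simp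
    then show "?Q \<noteq> {}" by blast
    fix q assume "q \<in> ?Q"
    then obtain p L where "q = sqrt (max 1 (min p (real n))) / M_mean n \<sigma> p L" "K \<subseteq> L" "L \<in> SL n p" "p \<ge> 0" by blast
    then have "isotropic_const n K \<le> exp 2 * q" using isotropic_const_le_quotient by simp
    then show "isotropic_const n K / exp 2 \<le> q" by (simp add: field_simps)
  qed
  then show "isotropic_const n K \<le> exp 2 * Inf ?Q" by (simp add: field_simps)
qed simp

end
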